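(* Let $(X,\tau)$ be a regular Hausdorff definable topological space in $\mathcal{R}$ with $X\subseteq R$. Then there exist disjoint definable $\tau$-open sets $Y,Z\subseteq X$ with $X\setminus(Y\cup Z)$ finite, and natural numbers $n_Y,n_Z>0$, such that: (1) there is a definable embedding $h_Y:(Y,\tau)\hookrightarrow (R\times\{0,\dots,n_Y\},\tau_{lex})$; and (2) there is a definable embedding $h_Z:(Z,\tau)\hookrightarrow (R\times\{0,\dots,n_Z\},\tau_{Alex})$.
   Context: $\mathcal{R}=(R,<,\dots)$ is an arbitrary o-minimal expansion of a dense linear order without endpoints; "definable" means definable in $\mathcal{R}$ with parameters. Fixed parameters $0<1<2<\cdots$ in $R$ are used to name the natural numbers, so $\{0,\dots,n\}\subseteq R$. A definable topological space is a pair $(X,\tau)$ with $X\subseteq R^n$ definable and $\tau$ a topology on $X$ with a basis which is a definable family of sets; a definable embedding is a definable map which is a homeomorphism onto its image (with subspace topology). For $S\subseteq R^2$, $\tau_{lex}$ denotes the order topology on $S$ induced by the lexicographic order on $R^2$. $\tau_{Alex}$ is the topology on $R^2$ in which all points of $R^2\setminus (R\times\{0\})$ are isolated and a basis of neighbourhoods of $\langle x,0\rangle$ is given by the sets $\{\langle x,0\rangle\}\cup(((z,y)\setminus\{x\})\times R)$ for $z<x<y$; on subsets of $R^2$ it denotes the subspace topology. *)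

theory Defs
  imports "HOL-Analysis.Abstract_Topological_Spaces"
begin

section \<open>First-order structures expanding a linear order\<close>

text \<open>
  The universe R is the carrier type. Symbols carry no arity: a symbol together with the length
  of its argument list acts as a symbol of that arity, so every first-order language is covered
  (unused arities may be interpreted as a constant function or the empty relation, which adds
  nothing to definability with parameters). The order is always part of the language,
  through the atomic formula \<open>Less\<close>.
\<close>

record ('a, 'f, 'r) fo_structure =
  fun_interp :: "'f \<Rightarrow> 'a list \<Rightarrow> 'a"
  rel_interp :: "'r \<Rightarrow> 'a list \<Rightarrow> bool"

datatype 'f trm = Var nat | Fun 'f "'f trm list"

datatype ('f, 'r) fm =
    Eq "'f trm" "'f trm"
  | Less "'f trm" "'f trm"
  | Rel 'r "'f trm list"
  | Neg "('f, 'r) fm"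
  | Conj "('f, 'r) fm" "('f, 'r) fm"
  | Exists nat "('f, 'r) fm"

primrec trm_val :: "('a, 'f, 'r) fo_structure \<Rightarrow> (nat \<Rightarrow> 'a) \<Rightarrow> 'f trm \<Rightarrow> 'a" where
  "trm_val \<R> e (Var i) = e i"
| "trm_val \<R> e (Fun f ts) = fun_interp \<R> f (map (trm_val \<R> e) ts)"

primrec sat :: "('a::linorder, 'f, 'r) fo_structure \<Rightarrow> (nat \<Rightarrow> 'a) \<Rightarrow> ('f, 'r) fm \<Rightarrow> bool" where
  "sat \<R> e (Eq s t) \<longleftrightarrow> trm_val \<R> e s = trm_val \<R> e t"
| "sat \<R> e (Less s t) \<longleftrightarrow> trm_val \<R> e s < trm_val \<R> e t"
| "sat \<R> e (Rel r ts) \<longleftrightarrow> rel_interp \<R> r (map (trm_val \<R> e) ts)"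
| "sat \<R> e (Neg \<phi>) \<longleftrightarrow> \<not> sat \<R> e \<phi>"
| "sat \<R> e (Conj \<phi> \<psi>) \<longleftrightarrow> sat \<R> e \<phi> \<and> sat \<R> e \<psi>"
| "sat \<R> e (Exists i \<phi>) \<longleftrightarrow> (\<exists>a. sat \<R> (e(i := a)) \<phi>)"

section \<open>Definability with parameters and o-minimality\<close>

text \<open>
  The power \<open>R\<^sup>n\<close> is the set of lists of length \<open>n\<close>; in particular \<open>R\<close>, as an ambient space of
  definable sets, is the set of lists of length 1. In \<open>\<phi>\<close> the variables \<open>0, \<dots>, n - 1\<close> range over
  the tuple; the other free variables are assigned parameters by \<open>p\<close>.
\<close>

definition definable ::
    "('a::linorder, 'f, 'r) fo_structure \<Rightarrow> nat \<Rightarrow> 'a list set \<Rightarrow> bool" where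
  "definable \<R> n A \<longleftrightarrow>
     (\<exists>\<phi> p. A = {xs. length xs = n \<and> sat \<R> (\<lambda>i. if i < n then xs ! i else p i) \<phi>})"

definition o_minimal :: "('a::linorder, 'f, 'r) fo_structure \<Rightarrow> bool" where
  "o_minimal \<R> \<longleftrightarrow>
     (\<forall>A. definable \<R> 1 A \<longrightarrow>
       (\<exists>\<I>. finite \<I> \<and> {x. [x] \<in> A} = \<Union>\<I> \<and>
         (\<forall>I\<in>\<I>. (\<exists>a. I = {a}) \<or> (\<exists>a b. I = {a<..<b}) \<or>
                 (\<exists>a. I = {..<a}) \<or> (\<exists>a. I = {a<..}) \<or> I = UNIV)))"

text \<open>Families \<open>{A\<^sub>u : u \<in> U}\<close> of subsets of \<open>R\<^sup>n\<close>, where \<open>A\<^sub>u\<close> is the fibre over \<open>u\<close> of \<open>A\<close>.\<close>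

definition definable_family ::
    "('a::linorder, 'f, 'r) fo_structure \<Rightarrow> nat \<Rightarrow> 'a list set set \<Rightarrow> bool" where
  "definable_family \<R> n \<B> \<longleftrightarrow>
     (\<exists>m U A. definable \<R> m U \<and> definable \<R> (n + m) A \<and>
        \<B> = (\<lambda>u. {x. x @ u \<in> A}) ` U)"

definition definable_map ::
    "('a::linorder, 'f, 'r) fo_structure \<Rightarrow> nat \<Rightarrow> nat \<Rightarrow> 'a list set \<Rightarrow>
      ('a list \<Rightarrow> 'a list) \<Rightarrow> bool" where
  "definable_map \<R> m n X f \<longleftrightarrow>
     (\<forall>x\<in>X. length x = m \<and> length (f x) = n) \<and> definable \<R> (m + n) ((\<lambda>x. x @ f x) ` X)"

section \<open>Definable topological spaces\<close>

definition definable_topological_space ::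
    "('a::linorder, 'f, 'r) fo_structure \<Rightarrow> nat \<Rightarrow> 'a list topology \<Rightarrow> bool" where
  "definable_topological_space \<R> n T \<longleftrightarrow>
     definable \<R> n (topspace T) \<and>
     (\<exists>\<B>. definable_family \<R> n \<B> \<and> openin T = arbitrary union_of (\<lambda>B. B \<in> \<B>))"

definition definable_embedding ::
    "('a::linorder, 'f, 'r) fo_structure \<Rightarrow> nat \<Rightarrow> nat \<Rightarrow> 'a list topology \<Rightarrow>
      'a list topology \<Rightarrow> ('a list \<Rightarrow> 'a list) \<Rightarrow> bool" where
  "definable_embedding \<R> m n T T' h \<longleftrightarrow>
     definable_map \<R> m n (topspace T) h \<and> embedding_map T T' h"

text \<open>
  The order topology of the lexicographic order restricted to \<open>S\<close>, from its open rays (it is not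
  the subspace topology from \<open>R\<^sup>2\<close>). The set \<open>S\<close> itself is a generator only to cover sets \<open>S\<close>
  with one element.
\<close>

definition lex_less :: "'a::linorder list \<Rightarrow> 'a list \<Rightarrow> bool" where
  "lex_less x y \<longleftrightarrow> (x, y) \<in> lexord {(a, b). a < b}"

definition lex_topology :: "'a::linorder list set \<Rightarrow> 'a list topology" where
  "lex_topology S = topology_generated_by
     ({S} \<union> {{y \<in> S. lex_less y x} | x. x \<in> S} \<union> {{y \<in> S. lex_less x y} | x. x \<in> S})"

text \<open>The parameter \<open>z0\<close> is the element of \<open>R\<close> named 0.\<close>

definition alex_topology :: "'a::linorder \<Rightarrow> 'a list topology" where
  "alex_topology z0 = topology_generated_by
     ({{[x, t]} | x t. t \<noteq> z0} \<union>
      {{[x, z0]} \<union> {[w, t] | w t. w \<in> {z<..<y} - {x}} | x y z. z < x \<and> x < y})"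

text \<open>The set \<open>R \<times> {0, \<dots>, n}\<close>, where \<open>c k\<close> is the element of \<open>R\<close> naming the number \<open>k\<close>.\<close>

definition strip :: "(nat \<Rightarrow> 'a) \<Rightarrow> nat \<Rightarrow> 'a list set" where
  "strip c n = {[x, c k] | x k. k \<le> n}"

end

theory Submission
  imports Defs
begin

text \<open>
  On definable subsets of the line the topology is determined by the convergence of one-sided
  germs, and a germ has at most one limit. By the monotonicity theorem the map sending a generic
  point to the least limit of its two germs is a local homeomorphism, and by regularity it
  preserves the limits of germs. So, up to a finite set, the space splits into finite classes, the
  members of which move in parallel along an interval parametrised by a base point. If the two
  germs at the base point have the same limit, then the class looks locally like the Alexandroff
  double; otherwise the limits of the left and right germs form the bottom and top of a
  lexicographic strip. All other points of the class are isolated.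
\<close>

section \<open>Definable predicates on environments\<close>

text \<open>The structure need not be complete and need not have definable choice, so limits cannot
  be found by choosing curves or sequences. The substitute is \<open>directed_family\<close>: a
  suitable directed family of nonempty definable sets has a common point or a common germ. It is
  used twice, each time for sets minus a given definable set. Applied to basic neighbourhoods of a
  point, with the Hausdorff property excluding the common point, it reduces openness to germs.
  Applied to preimages under \<open>base\<close> of shrinking one-sided intervals, it gives the
  neighbourhoods that the embeddings need. The least limit can label a class because a generic point
  has at most two limits, and each of them has the same set of limits again; so a class is a fibre
  of \<open>base\<close>. The widths come from counting: \<open>base\<close> is injective on every
  interval without exceptional points, so the number of exceptional points below a point identifies
  it within its class, which takes \<open>card exc + 1\<close> levels. Level 0 is added for limit
  points and, in the lexicographic case, a top level for the limits of right germs.\<close>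

primrec rename_trm :: "(nat \<Rightarrow> nat) \<Rightarrow> 'f trm \<Rightarrow> 'f trm" where
  "rename_trm \<sigma> (Var i) = Var (\<sigma> i)"
| "rename_trm \<sigma> (Fun f ts) = Fun f (map (rename_trm \<sigma>) ts)"

primrec trm_vars :: "'f trm \<Rightarrow> nat set" where
  "trm_vars (Var i) = {i}"
| "trm_vars (Fun f ts) = \<Union>(set (map trm_vars ts))"

text \<open>Bound variables are counted as well: an over-approximation of the free variables
  suffices for agreement of environments and for choosing fresh names.\<close>

primrec fm_vars :: "('f, 'r) fm \<Rightarrow> nat set" where
  "fm_vars (Eq s t) = trm_vars s \<union> trm_vars t"
| "fm_vars (Less s t) = trm_vars s \<union> trm_vars t"
| "fm_vars (Rel r ts) = \<Union>(set (map trm_vars ts))"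
| "fm_vars (Neg \<phi>) = fm_vars \<phi>"
| "fm_vars (Conj \<phi> \<psi>) = fm_vars \<phi> \<union> fm_vars \<psi>"
| "fm_vars (Exists i \<phi>) = insert i (fm_vars \<phi>)"

lemma trm_val_rename: "trm_val \<R> e (rename_trm \<sigma> t) = trm_val \<R> (e \<circ> \<sigma>) t"
  by (induction t) (auto simp: comp_def cong: map_cong)

lemma trm_val_cong: "(\<And>i. i \<in> trm_vars t \<Longrightarrow> e i = e' i) \<Longrightarrow> trm_val \<R> e t = trm_val \<R> e' t"
proof (induction t)
  case (Fun f ts)
  then have "map (trm_val \<R> e) ts = map (trm_val \<R> e') ts" by (intro map_cong) auto
  then show ?case by (simp del: map_eq_conv)
qed simp

lemma finite_trm_vars: "finite (trm_vars t)"
  by (induction t) auto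

lemma finite_fm_vars: "finite (fm_vars \<phi>)"
  by (induction \<phi>) (auto simp: finite_trm_vars)

lemma sat_cong: "(\<And>i. i \<in> fm_vars \<phi> \<Longrightarrow> e i = e' i) \<Longrightarrow> sat \<R> e \<phi> = sat \<R> e' \<phi>"
proof (induction \<phi> arbitrary: e e')
  case (Eq s t)
  then show ?case using trm_val_cong[of s e e' \<R>] trm_val_cong[of t e e' \<R>] by auto
next
  case (Less s t)
  then show ?case using trm_val_cong[of s e e' \<R>] trm_val_cong[of t e e' \<R>] by auto
next
  case (Rel r ts)
  have "map (trm_val \<R> e) ts = map (trm_val \<R> e') ts"
    using Rel by (intro map_cong trm_val_cong) auto
  then show ?case by (simp del: map_eq_conv)
next
  case (Exists i \<phi>)
  have "sat \<R> (e(i := a)) \<phi> = sat \<R> (e'(i := a)) \<phi>" for a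
    using Exists.prems by (intro Exists.IH) auto
  then show ?case by simp
next
  case (Neg \<phi>)
  have "sat \<R> e \<phi> = sat \<R> e' \<phi>" using Neg.prems by (intro Neg.IH) simp
  then show ?case by simp
next
  case (Conj \<phi>1 \<phi>2)
  have "sat \<R> e \<phi>1 = sat \<R> e' \<phi>1" "sat \<R> e \<phi>2 = sat \<R> e' \<phi>2"
    using Conj.prems by (intro Conj.IH; simp)+
  then show ?case by simp
qed

text \<open>Existential instead of a recursive renaming, because under \<open>Exists\<close> a bound
  variable outside the image of \<open>\<sigma>\<close> has to be chosen to avoid capture.\<close>

lemma sat_rename: "\<exists>\<psi>. \<forall>e. sat \<R> e \<psi> = sat \<R> (e \<circ> \<sigma>) \<phi>"
proof (induction \<phi> arbitrary: \<sigma>)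
  case (Eq s t)
  show ?case by (rule exI[of _ "Eq (rename_trm \<sigma> s) (rename_trm \<sigma> t)"]) (simp add: trm_val_rename comp_def)
next
  case (Less s t)
  show ?case by (rule exI[of _ "Less (rename_trm \<sigma> s) (rename_trm \<sigma> t)"]) (simp add: trm_val_rename comp_def)
next
  case (Rel r ts)
  show ?case
    by (rule exI[of _ "Rel r (map (rename_trm \<sigma>) ts)"]) (simp add: trm_val_rename comp_def)
next
  case (Neg \<phi>)
  then obtain \<psi> where "\<forall>e. sat \<R> e \<psi> = sat \<R> (e \<circ> \<sigma>) \<phi>" by blast
  then show ?case by (intro exI[of _ "Neg \<psi>"]) (simp add: comp_def)
next
  case (Conj \<phi>1 \<phi>2)
  obtain \<psi>1 where "\<forall>e. sat \<R> e \<psi>1 = sat \<R> (e \<circ> \<sigma>) \<phi>1" using Conj.IH(1) by blast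
  moreover obtain \<psi>2 where "\<forall>e. sat \<R> e \<psi>2 = sat \<R> (e \<circ> \<sigma>) \<phi>2" using Conj.IH(2) by blast
  ultimately show ?case by (intro exI[of _ "Conj \<psi>1 \<psi>2"]) (simp add: comp_def)
next
  case (Exists i \<phi>)
  obtain j where j: "j \<notin> \<sigma> ` fm_vars \<phi>"
    using ex_new_if_finite[OF infinite_UNIV_nat finite_imageI[OF finite_fm_vars]] by blast
  obtain \<psi> where \<psi>: "\<forall>e. sat \<R> e \<psi> = sat \<R> (e \<circ> \<sigma>(i := j)) \<phi>"
    using Exists.IH by blast
  have "sat \<R> (e(j := a) \<circ> \<sigma>(i := j)) \<phi> = sat \<R> ((e \<circ> \<sigma>)(i := a)) \<phi>" for e a
    using j by (intro sat_cong) auto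
  then show ?case using \<psi> by (intro exI[of _ "Exists j \<psi>"]) (simp add: comp_def)
qed

text \<open>
  A predicate on environments is definable if it is given by a formula whose variables are
  instantiated by \<open>\<sigma>\<close> either with a variable of the environment or with a parameter.
\<close>

definition var_val :: "(nat \<Rightarrow> 'a) \<Rightarrow> nat + 'a \<Rightarrow> 'a" where
  "var_val e v = (case v of Inl j \<Rightarrow> e j | Inr a \<Rightarrow> a)"

lemma var_val_simps [simp]: "var_val e (Inl j) = e j" "var_val e (Inr a) = a"
  by (simp_all add: var_val_def)

definition dpred :: "('a::linorder, 'f, 'r) fo_structure \<Rightarrow> ((nat \<Rightarrow> 'a) \<Rightarrow> bool) \<Rightarrow> bool" where
  "dpred \<R> P \<longleftrightarrow> (\<exists>\<phi> \<sigma>. \<forall>e. P e \<longleftrightarrow> sat \<R> (\<lambda>i. var_val e (\<sigma> i)) \<phi>)"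

lemma dpredI: "(\<And>e. P e \<longleftrightarrow> sat \<R> (\<lambda>i. var_val e (\<sigma> i)) \<phi>) \<Longrightarrow> dpred \<R> P"
  unfolding dpred_def by (intro exI[of _ \<phi>] exI[of _ \<sigma>]) simp

lemma dpredE:
  assumes "dpred \<R> P"
  obtains \<phi> \<sigma> where "\<And>e. P e \<longleftrightarrow> sat \<R> (\<lambda>i. var_val e (\<sigma> i)) \<phi>"
  using assms unfolding dpred_def by (elim exE) (rule that, erule spec)

text \<open>In \<open>dterm\<close> the variable 0 names the value, and the arguments are shifted by one.\<close>

definition dterm :: "('a::linorder, 'f, 'r) fo_structure \<Rightarrow> ((nat \<Rightarrow> 'a) \<Rightarrow> 'a) \<Rightarrow> bool" where
  "dterm \<R> \<tau> \<longleftrightarrow> dpred \<R> (\<lambda>e. e 0 = \<tau> (\<lambda>i. e (Suc i)))"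

abbreviation dpred1 where "dpred1 \<R> P \<equiv> dpred \<R> (\<lambda>e. P (e 0))"
abbreviation dpred2 where "dpred2 \<R> P \<equiv> dpred \<R> (\<lambda>e. P (e 0) (e (Suc 0)))"
abbreviation dfun1 where "dfun1 \<R> f \<equiv> dpred2 \<R> (\<lambda>x y. f x = y)"

section \<open>Closure of definable predicates and terms under the logical operations\<close>

named_theorems dp

lemma dpred_not [dp]:
  assumes "dpred \<R> P" shows "dpred \<R> (\<lambda>e. \<not> P e)"
proof -
  obtain \<phi> \<sigma> where "\<And>e. P e = sat \<R> (\<lambda>i. var_val e (\<sigma> i)) \<phi>" using assms by (rule dpredE) (rule that)
  then show ?thesis by (intro dpredI[of _ \<R> \<sigma> "Neg \<phi>"]) simp
qed

lemma dpred_conj [dp]: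
  assumes "dpred \<R> P" "dpred \<R> Q" shows "dpred \<R> (\<lambda>e. P e \<and> Q e)"
proof -
  obtain \<phi> \<sigma> where P: "\<And>e. P e = sat \<R> (\<lambda>i. var_val e (\<sigma> i)) \<phi>"
    using assms(1) by (rule dpredE) (rule that)
  obtain \<psi> \<tau> where Q: "\<And>e. Q e = sat \<R> (\<lambda>i. var_val e (\<tau> i)) \<psi>"
    using assms(2) by (rule dpredE) (rule that)
  \<comment> \<open>The two formulas come with different instantiations of the same variables;
    moving them to even and odd variables lets one instantiation serve both.\<close>
  obtain \<phi>' where \<phi>': "\<forall>e. sat \<R> e \<phi>' = sat \<R> (e \<circ> (\<lambda>i. 2 * i)) \<phi>" using sat_rename by blast
  obtain \<psi>' where \<psi>': "\<forall>e. sat \<R> e \<psi>' = sat \<R> (e \<circ> (\<lambda>i. 2 * i + 1)) \<psi>" using sat_rename by blast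
  show ?thesis unfolding dpred_def
    by (intro exI[of _ "Conj \<phi>' \<psi>'"]
        exI[of _ "\<lambda>i. if even i then \<sigma> (i div 2) else \<tau> (i div 2)"])
      (simp add: \<phi>' \<psi>' P Q comp_def)
qed

lemma dpred_const [dp]: "dpred \<R> (\<lambda>e. b)"
proof -
  have "dpred \<R> (\<lambda>e. True)" unfolding dpred_def
    by (intro exI[of _ "Eq (Var 0) (Var 0)"] exI[of _ Inl]) simp
  moreover from dpred_not[OF this] have "dpred \<R> (\<lambda>e. False)" by simp
  ultimately show ?thesis by (cases b) auto
qed

lemma dpred_disj [dp]:
  assumes "dpred \<R> P" "dpred \<R> Q" shows "dpred \<R> (\<lambda>e. P e \<or> Q e)"
  using dpred_not[OF dpred_conj[OF dpred_not[OF assms(1)] dpred_not[OF assms(2)]]] by simp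

lemma dpred_imp [dp]:
  assumes "dpred \<R> P" "dpred \<R> Q" shows "dpred \<R> (\<lambda>e. P e \<longrightarrow> Q e)"
  using dpred_disj[OF dpred_not[OF assms(1)] assms(2)] by (simp only: imp_conv_disj)

lemma dpred_iff [dp]:
  assumes "dpred \<R> P" "dpred \<R> Q" shows "dpred \<R> (\<lambda>e. P e \<longleftrightarrow> Q e)"
  using dpred_conj[OF dpred_imp[OF assms] dpred_imp[OF assms(2,1)]] by (simp only: iff_conv_conj_imp)

text \<open>The quantified value enters at position 0 and the rest of the environment is shifted, as
  with de Bruijn indices, so nested quantifiers need no fresh names.\<close>

lemma dpred_ex [dp]:
  assumes "dpred \<R> (\<lambda>e. P (\<lambda>i. e (Suc i)) (e 0))"
  shows "dpred \<R> (\<lambda>e. \<exists>y. P e y)"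
proof -
  obtain \<phi> \<sigma> where P: "\<And>e. P (\<lambda>i. e (Suc i)) (e 0) = sat \<R> (\<lambda>i. var_val e (\<sigma> i)) \<phi>"
    using assms(1) by (rule dpredE) (rule that)
  \<comment> \<open>Several variables of \<open>\<phi>\<close> may be instantiated with the
    quantified value. They are merged into variable 0, which \<open>Exists 0\<close> binds; all
    others are moved away from 0.\<close>
  define \<rho> where "\<rho> i = (if \<sigma> i = Inl 0 then 0 else Suc i)" for i
  define \<sigma>' where "\<sigma>' j = (case j of 0 \<Rightarrow> Inl 0 | Suc i \<Rightarrow>
    (case \<sigma> i of Inl k \<Rightarrow> Inl (k - 1) | Inr a \<Rightarrow> Inr a))" for j
  obtain \<psi> where \<psi>: "\<forall>e. sat \<R> e \<psi> = sat \<R> (e \<circ> \<rho>) \<phi>" using sat_rename by blast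
  have "((\<lambda>i. var_val e (\<sigma>' i))(0 := y) \<circ> \<rho>) = (\<lambda>i. var_val (case_nat y e) (\<sigma> i))" for e y
    by (auto simp: fun_eq_iff \<rho>_def \<sigma>'_def split: sum.splits nat.splits)
  then have "P e y \<longleftrightarrow> sat \<R> ((\<lambda>i. var_val e (\<sigma>' i))(0 := y)) \<psi>" for e y
    using P[of "case_nat y e"] \<psi> by simp
  then have "(\<exists>y. P e y) \<longleftrightarrow> sat \<R> (\<lambda>i. var_val e (\<sigma>' i)) (Exists 0 \<psi>)" for e
    unfolding sat.simps by (rule ex_cong1)
  then show ?thesis by (rule dpredI)
qed

lemma dpred_all [dp]:
  assumes "dpred \<R> (\<lambda>e. P (\<lambda>i. e (Suc i)) (e 0))"
  shows "dpred \<R> (\<lambda>e. \<forall>y. P e y)"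
  using dpred_not[OF dpred_ex[of \<R> "\<lambda>e y. \<not> P e y", OF dpred_not[OF assms]]] by simp

lemma dpred_all_bool [dp]:
  assumes "\<And>s::bool. dpred \<R> (P s)" shows "dpred \<R> (\<lambda>e. \<forall>s. P s e)"
  using dpred_conj[OF assms[of True] assms[of False]] by (simp add: all_bool_eq)

lemma dpred_ex_bool [dp]:
  assumes "\<And>s::bool. dpred \<R> (P s)" shows "dpred \<R> (\<lambda>e. \<exists>s. P s e)"
  using dpred_disj[OF assms[of True] assms[of False]] by (simp add: ex_bool_eq)

lemma dpred_ex_finite:
  assumes "finite S" "\<And>s. s \<in> S \<Longrightarrow> dpred \<R> (P s)" shows "dpred \<R> (\<lambda>e. \<exists>s\<in>S. P s e)"
  using assms by (induction S) (auto intro: dp)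

lemma dpred_all_finite:
  assumes "finite S" "\<And>s. s \<in> S \<Longrightarrow> dpred \<R> (P s)" shows "dpred \<R> (\<lambda>e. \<forall>s\<in>S. P s e)"
  using assms by (induction S) (auto intro: dp)

lemma dpred_subst:
  assumes "dpred \<R> P" shows "dpred \<R> (\<lambda>e. P (\<lambda>i. var_val e (\<kappa> i)))"
proof -
  obtain \<phi> \<sigma> where P: "\<And>e. P e = sat \<R> (\<lambda>i. var_val e (\<sigma> i)) \<phi>"
    using assms by (rule dpredE) (rule that)
  have "var_val (\<lambda>i. var_val e (\<kappa> i)) v = var_val e (case v of Inl j \<Rightarrow> \<kappa> j | Inr a \<Rightarrow> Inr a)"
    for e v by (simp split: sum.split)
  then show ?thesis
    by (intro dpredI[of _ \<R> "\<lambda>i. case \<sigma> i of Inl j \<Rightarrow> \<kappa> j | Inr a \<Rightarrow> Inr a" \<phi>]) (simp add: P)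
qed

lemma dpred_rename:
  assumes "dpred \<R> P" shows "dpred \<R> (\<lambda>e. P (\<lambda>i. e (\<kappa> i)))"
  using dpred_subst[OF assms, of "\<lambda>i. Inl (\<kappa> i)"] by simp

lemma dterm_var [dp]: "dterm \<R> (\<lambda>e. e i)"
  unfolding dterm_def dpred_def
  by (intro exI[of _ "Eq (Var 0) (Var 1)"] exI[of _ "\<lambda>j. if j = 0 then Inl 0 else Inl (Suc i)"]) simp

lemma dterm_const [dp]: "dterm \<R> (\<lambda>e. a)"
  unfolding dterm_def dpred_def
  by (intro exI[of _ "Eq (Var 0) (Var 1)"] exI[of _ "\<lambda>j. if j = 0 then Inl 0 else Inr a"]) simp

lemma dpred_let:
  assumes "dpred \<R> (\<lambda>e. P (\<lambda>i. e (Suc i)) (e 0))" "dterm \<R> \<tau>"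
  shows "dpred \<R> (\<lambda>e. P e (\<tau> e))"
proof -
  have "dpred \<R> (\<lambda>e. \<exists>y. y = \<tau> e \<and> P e y)"
    using assms unfolding dterm_def by (intro dpred_ex dpred_conj)
  then show ?thesis by simp
qed

lemma dterm_shift:
  assumes "dterm \<R> \<tau>" shows "dterm \<R> (\<lambda>e. \<tau> (\<lambda>i. e (Suc i)))"
  using dpred_rename[OF assms[unfolded dterm_def], of "\<lambda>i. case i of 0 \<Rightarrow> 0 | Suc j \<Rightarrow> Suc (Suc j)"]
  unfolding dterm_def by simp

lemma dpred_app1:
  assumes "dpred1 \<R> Q" "dterm \<R> \<tau>" shows "dpred \<R> (\<lambda>e. Q (\<tau> e))"
  using assms by (rule dpred_let[where P = "\<lambda>e. Q"])

lemma dpred_app2: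
  assumes "dpred2 \<R> Q" "dterm \<R> \<sigma>" "dterm \<R> \<tau>" shows "dpred \<R> (\<lambda>e. Q (\<sigma> e) (\<tau> e))"
proof -
  have "dpred \<R> (\<lambda>e. Q (e 0) (e (Suc i)))" for i
    using dpred_rename[OF assms(1), of "case_nat 0 (\<lambda>_. Suc i)"] by simp
  from this[of 0] have "dpred \<R> (\<lambda>e. Q (\<sigma> (\<lambda>i. e (Suc i))) (e 0))"
    using dpred_let[where P = "\<lambda>e x. Q x (e 0)", OF _ dterm_shift[OF assms(2)]] by simp
  then show ?thesis using assms(3) by (rule dpred_let[where P = "\<lambda>e y. Q (\<sigma> e) y"])
qed

lemma dpred_eq [dp]:
  assumes "dterm \<R> \<sigma>" "dterm \<R> \<tau>" shows "dpred \<R> (\<lambda>e. \<sigma> e = \<tau> e)"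
proof -
  have "dpred2 \<R> (=)" unfolding dpred_def
    by (intro exI[of _ "Eq (Var 0) (Var 1)"] exI[of _ Inl]) simp
  from dpred_app2[OF this assms] show ?thesis .
qed

lemma dpred_less [dp]:
  assumes "dterm \<R> \<sigma>" "dterm \<R> \<tau>" shows "dpred \<R> (\<lambda>e. \<sigma> e < \<tau> e)"
proof -
  have "dpred2 \<R> (<)" unfolding dpred_def
    by (intro exI[of _ "Less (Var 0) (Var 1)"] exI[of _ Inl]) simp
  from dpred_app2[OF this assms] show ?thesis .
qed

lemma dpred_le [dp]:
  assumes "dterm \<R> \<sigma>" "dterm \<R> \<tau>" shows "dpred \<R> (\<lambda>e. \<sigma> e \<le> \<tau> e)"
  using dpred_not[OF dpred_less[OF assms(2,1)]] by (simp add: not_less)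

lemma dterm_fun:
  assumes "dfun1 \<R> f" "dterm \<R> \<tau>" shows "dterm \<R> (\<lambda>e. f (\<tau> e))"
proof -
  have "dpred \<R> (\<lambda>e. f (\<tau> (\<lambda>i. e (Suc i))) = e 0)"
    by (rule dpred_app2[OF assms(1) dterm_shift[OF assms(2)] dterm_var])
  then show ?thesis unfolding dterm_def by (simp add: eq_commute)
qed

text \<open>For quantifiers over a basis, whose members are indexed by tuples. The tuple occupies
  the first \<open>m\<close> positions and the old environment is shifted by
  \<open>m\<close>.\<close>

lemma dpred_ex_list:
  fixes P :: "(nat \<Rightarrow> 'a::linorder) \<Rightarrow> 'a list \<Rightarrow> bool"
  assumes "dpred \<R> (\<lambda>e. P (\<lambda>i. e (i + m)) (map e [0..<m]))"
  shows "dpred \<R> (\<lambda>e. \<exists>u. length u = m \<and> P e u)"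
  using assms
proof (induction m arbitrary: P)
  case (Suc m)
  have "dpred \<R> (\<lambda>e. \<exists>u. length u = m \<and> (\<exists>y. P e (y # u)))"
  proof (rule Suc.IH, rule dpred_ex)
    have "[0..<Suc m] = 0 # map Suc [0..<m]" by (simp only: upt_conv_Cons map_Suc_upt zero_less_Suc)
    then have "map e [0..<Suc m] = e 0 # map (\<lambda>i. e (Suc i)) [0..<m]" for e :: "nat \<Rightarrow> 'a"
      by (simp del: upt_Suc add: comp_def)
    moreover note Suc.prems
    ultimately    show "dpred \<R> (\<lambda>e. P (\<lambda>i. e (Suc (i + m))) (e 0 # map (\<lambda>i. e (Suc i)) [0..<m]))"
      by (simp del: upt_Suc)
  qed
  moreover have "(\<exists>u. length u = m \<and> (\<exists>y. P e (y # u))) = (\<exists>u. length u = Suc m \<and> P e u)" for e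
    by (auto simp: length_Suc_conv)
  ultimately show ?case by simp
qed simp

lemma dpred_all_list:
  assumes "dpred \<R> (\<lambda>e. P (\<lambda>i. e (i + m)) (map e [0..<m]))"
  shows "dpred \<R> (\<lambda>e. \<forall>u. length u = m \<longrightarrow> P e u)"
  using dpred_not[OF dpred_ex_list[of \<R> "\<lambda>e u. \<not> P e u", OF dpred_not[OF assms]]] by simp

section \<open>Translation between \<open>definable\<close> and \<open>dpred\<close>\<close>

lemma dpred_definable:
  assumes "definable \<R> n A" "length js = n"
  shows "dpred \<R> (\<lambda>e. map e js \<in> A)"
proof -
  obtain \<phi> p where A: "A = {xs. length xs = n \<and> sat \<R> (\<lambda>i. if i < n then xs ! i else p i) \<phi>}"
    using assms(1) unfolding definable_def by (elim exE) (rule that)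
  have "(\<lambda>i. if i < n then map e js ! i else p i)
      = (\<lambda>i. var_val e (if i < n then Inl (js ! i) else Inr (p i)))" for e
    using assms(2) by auto
  then show ?thesis using assms(2)
    by (intro dpredI[of _ \<R> "\<lambda>i. if i < n then Inl (js ! i) else Inr (p i)" \<phi>]) (simp add: A)
qed

text \<open>Variables of \<open>P\<close> beyond the tuple take the default value \<open>d\<close>.
  They and the parameters hidden in the instantiation become parameters at the positions
  \<open>n + i\<close>, out of reach of the tuple.\<close>

lemma definable_dpred:
  fixes \<R> :: "('a::linorder, 'f, 'r) fo_structure"
  assumes "dpred \<R> P" "A = {xs. length xs = n \<and> P (\<lambda>i. if i < n then xs ! i else d)}"
  shows "definable \<R> n A"
proof -
  obtain \<phi> \<sigma> where P: "\<And>e. P e = sat \<R> (\<lambda>i. var_val e (\<sigma> i)) \<phi>"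
    using assms(1) by (rule dpredE) (rule that)
  define \<rho> where "\<rho> i = (case \<sigma> i of Inl j \<Rightarrow> if j < n then j else n + i | Inr a \<Rightarrow> n + i)" for i
  define p where "p i = (case \<sigma> (i - n) of Inl j \<Rightarrow> d | Inr a \<Rightarrow> a)" for i
  obtain \<psi> where \<psi>: "\<And>e. sat \<R> e \<psi> = sat \<R> (e \<circ> \<rho>) \<phi>" using sat_rename by blast
  have "((\<lambda>i. if i < n then xs ! i else p i) \<circ> \<rho>)
      = (\<lambda>i. var_val (\<lambda>i. if i < n then xs ! i else d) (\<sigma> i))" for xs
    by (auto simp: fun_eq_iff \<rho>_def p_def split: sum.splits)
  then show ?thesis unfolding definable_def assms(2) P
    by (intro exI[of _ \<psi>] exI[of _ p]) (simp add: \<psi>)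
qed

section \<open>One-sided germs and definable sets in an o-minimal structure\<close>

text \<open>The order or its reverse. With the interpretation \<open>dir\<close> below, one argument
  covers both sides of a point and both ends of the line.\<close>

definition lt :: "bool \<Rightarrow> 'a::unbounded_dense_linorder \<Rightarrow> 'a \<Rightarrow> bool" where
  "lt s x y \<longleftrightarrow> (if s then x < y else y < x)"

definition le :: "bool \<Rightarrow> 'a::unbounded_dense_linorder \<Rightarrow> 'a \<Rightarrow> bool" where
  "le s x y \<longleftrightarrow> (if s then x \<le> y else y \<le> x)"

interpretation dir: unbounded_dense_linorder "le s" "lt s" for s
  using dense[where 'a='a] gt_ex[where 'a='a] lt_ex[where 'a='a]
  by unfold_locales (cases s; fastforce simp: lt_def le_def)+

lemma lt_simps [simp]: "lt True x y \<longleftrightarrow> x < y" "lt False x y \<longleftrightarrow> y < x" "lt (\<not> s) x y \<longleftrightarrow> lt s y x"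
  by (auto simp: lt_def)

lemma le_simps [simp]: "le True x y \<longleftrightarrow> x \<le> y" "le False x y \<longleftrightarrow> y \<le> x" "le (\<not> s) x y \<longleftrightarrow> le s y x"
  by (auto simp: le_def)

section \<open>Germs as filters\<close>

datatype 'a germ = At bool 'a | Inf bool

text \<open>
  \<open>At s y\<close> is the one-sided germ at \<open>y\<close>, from the right if \<open>s\<close> is true; \<open>Inf s\<close> is the germ
  at \<open>\<plusminus>\<infinity>\<close>.
\<close>

primrec near :: "'a::unbounded_dense_linorder germ \<Rightarrow> ('a \<Rightarrow> bool) \<Rightarrow> bool" where
  "near (At s y) P \<longleftrightarrow> (\<exists>t. lt s y t \<and> (\<forall>z. lt s y z \<and> lt s z t \<longrightarrow> P z))"
| "near (Inf s) P \<longleftrightarrow> (\<exists>t. \<forall>z. lt s t z \<longrightarrow> P z)"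

lemma near_mono: "near g P \<Longrightarrow> (\<And>z. P z \<Longrightarrow> Q z) \<Longrightarrow> near g Q"
  by (cases g) auto

lemma near_conj: "near g P \<Longrightarrow> near g Q \<Longrightarrow> near g (\<lambda>z. P z \<and> Q z)"
proof (cases g)
  case (At s y)
  assume "near g P" "near g Q"
  then obtain t u where t: "lt s y t" "\<And>z. lt s y z \<and> lt s z t \<Longrightarrow> P z"
    and u: "lt s y u" "\<And>z. lt s y z \<and> lt s z u \<Longrightarrow> Q z" using At by auto
  show ?thesis
  proof (cases "lt s t u")
    case True
    then show ?thesis using t u dir.less_trans unfolding At near.simps by blast
  next
    case False
    then have "le s u t" by (simp add: dir.not_less)
    then show ?thesis using t u dir.less_le_trans unfolding At near.simps by blast
  qed
next
  case (Inf s)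
  assume "near g P" "near g Q"
  then obtain t u where t: "\<And>z. lt s t z \<Longrightarrow> P z" and u: "\<And>z. lt s u z \<Longrightarrow> Q z" using Inf by auto
  show ?thesis
  proof (cases "lt s t u")
    case True
    then show ?thesis using t u dir.less_trans unfolding Inf near.simps by blast
  next
    case False
    then have "le s u t" by (simp add: dir.not_less)
    then show ?thesis using t u dir.le_less_trans unfolding Inf near.simps by blast
  qed
qed

lemma near_ex: "near g P \<Longrightarrow> \<exists>z. P z"
  using dir.dense dir.gt_ex by (cases g) (simp; blast)+

lemma near_not_both: "near g P \<Longrightarrow> near g (\<lambda>z. \<not> P z) \<Longrightarrow> False"
  using near_ex[OF near_conj] by blast

lemma near_always: "(\<And>z. P z) \<Longrightarrow> near g P"
  using dir.gt_ex by (cases g) auto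

lemma near_between: "lt s y t \<Longrightarrow> near (At s y) (\<lambda>z. lt s y z \<and> lt s z t)"
  by auto

lemma near_beyond: "near (At s y) (lt s y)"
  using dir.gt_ex by auto

lemma near_ne: "near (At s y) (\<lambda>z. z \<noteq> a)"
proof (cases "lt s y a")
  case True
  then show ?thesis by (intro near_mono[OF near_between]) auto
next
  case False
  then show ?thesis by (intro near_mono[OF near_beyond]) auto
qed

lemma near_ne': "near g (\<lambda>z. z \<noteq> a)"
proof (cases g)
  case (Inf s)
  then show ?thesis by (auto intro!: exI[of _ a])
qed (simp only: near_ne)

lemma near_notin_finite: "finite A \<Longrightarrow> near g (\<lambda>z. z \<notin> A)"
  by (induction A rule: finite_induct) (auto intro: near_always near_conj near_ne')

lemma near_side:
  assumes "lt s a y" shows "near (At r y) (\<lambda>z. lt s a z)"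
proof (cases "r = s")
  case True
  then show ?thesis using assms by (intro near_mono[OF near_beyond]) auto
next
  case False
  then have r: "r = (\<not> s)" by auto
  show ?thesis using assms unfolding r by auto
qed

text \<open>An open interval contains both germs at each of its points. This is how a germ at a
  point is compared with limits of germs at neighbouring points.\<close>

lemma near_near: "near (At s y) P \<Longrightarrow> near (At s y) (\<lambda>z. \<forall>r. near (At r z) P)"
proof -
  assume "near (At s y) P"
  then obtain t where t: "lt s y t" "\<And>z. lt s y z \<Longrightarrow> lt s z t \<Longrightarrow> P z" by auto
  have "near (At r z) P" if "lt s y z" "lt s z t" for r z
    using near_conj[OF near_side[OF that(1), of r] near_side[of "\<not> s" t z r]] that(2) t(2)
    by (auto elim: near_mono)
  with t(1) show ?thesis by auto
qed

text \<open>\<open>f\<close> maps the germ \<open>g\<close> to the germ \<open>At s v\<close>.\<close>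

definition push :: "('a \<Rightarrow> 'a) \<Rightarrow> 'a::unbounded_dense_linorder germ \<Rightarrow> bool \<Rightarrow> 'a \<Rightarrow> bool" where
  "push f g s v \<longleftrightarrow> (\<forall>t. lt s v t \<longrightarrow> near g (\<lambda>z. lt s v (f z) \<and> lt s (f z) t))"

lemma near_push: "push f g s v \<Longrightarrow> near (At s v) P \<Longrightarrow> near g (\<lambda>z. P (f z))"
proof -
  assume "push f g s v" "near (At s v) P"
  then obtain t where "near g (\<lambda>z. lt s v (f z) \<and> lt s (f z) t)"
    and "\<And>z. lt s v z \<and> lt s z t \<Longrightarrow> P z" unfolding push_def near.simps by blast
  then show ?thesis by (blast intro: near_mono)
qed

lemma push_unique:
  assumes "push f g s v" "push f g s' v'" shows "s = s' \<and> v = v'"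
proof (rule ccontr)
  assume ne: "\<not> ?thesis"
  \<comment> \<open>Distinct one-sided germs live on disjoint sets, and the preimages of these sets
    would both hold along \<open>g\<close>.\<close>
  obtain P where "near (At s v) P" "near (At s' v') (\<lambda>z. \<not> P z)"
  proof (cases "v = v'")
    case True
    then have "s' = (\<not> s)" using ne by auto
    then have "near (At s' v') (\<lambda>z. \<not> lt s v z)"
      using True by (intro near_mono[OF near_beyond]) auto
    with near_beyond that show ?thesis by blast
  next
    case False
    then obtain r where "lt r v v'" by (metis lt_simps(1,2) linorder_neqE)
    then obtain w where w: "lt r v w" "lt r w v'" using dir.dense by blast
    have "near (At s v) (\<lambda>z. lt r z w)" using near_side[of "\<not> r" w v s] w by simp
    moreover have "near (At s' v') (\<lambda>z. \<not> lt r z w)"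
      by (rule near_mono[OF near_side[OF w(2)]]) auto
    ultimately show ?thesis using that by blast
  qed
  from near_push[OF assms(1) this(1)] near_push[OF assms(2) this(2)] show False
    by (rule near_not_both)
qed

lemma dpred_lt [dp]:
  "dterm \<R> \<sigma> \<Longrightarrow> dterm \<R> \<tau> \<Longrightarrow> dpred \<R> (\<lambda>e. lt s (\<sigma> e) (\<tau> e))"
  by (cases s) (simp_all add: dp)

lemma dpred_near [dp]:
  assumes "dterm \<R> \<tau>" "dpred \<R> (\<lambda>e. P (\<lambda>i. e (Suc i)) (e 0))"
  shows "dpred \<R> (\<lambda>e. near (At s (\<tau> e)) (P e))"
proof -
  have "dpred \<R> (\<lambda>e. P (\<lambda>i. e (Suc (Suc i))) (e 0))"
    using dpred_rename[OF assms(2), of "\<lambda>i. case i of 0 \<Rightarrow> 0 | Suc j \<Rightarrow> Suc (Suc j)"] by simp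
  then show ?thesis
    unfolding near.simps by (intro dp dterm_shift assms(1) dterm_shift[OF dterm_shift[OF assms(1)]])
qed

section \<open>Convexity and suprema of intervals, read in either direction\<close>

definition dir_interval :: "bool \<Rightarrow> 'a::unbounded_dense_linorder set \<Rightarrow> bool" where
  "dir_interval s I \<longleftrightarrow> (\<exists>a. I = {a}) \<or> (\<exists>a b. I = {z. lt s a z \<and> lt s z b}) \<or>
     (\<exists>a. I = {z. lt s z a}) \<or> (\<exists>a. I = {z. lt s a z}) \<or> I = UNIV"

lemma dir_interval_convex:
  "dir_interval s I \<Longrightarrow> x \<in> I \<Longrightarrow> z \<in> I \<Longrightarrow> lt s x y \<Longrightarrow> lt s y z \<Longrightarrow> y \<in> I"
  unfolding dir_interval_def using dir.less_trans dir.less_asym by blast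

text \<open>If the germ does not avoid \<open>I\<close>, then \<open>I\<close> has points
  arbitrarily far along the germ, and by convexity it contains everything between them and a fixed
  one of them.\<close>

lemma near_interval:
  assumes "\<And>r. dir_interval r I" shows "near g (\<lambda>z. z \<in> I) \<or> near g (\<lambda>z. z \<notin> I)"
proof (rule disjCI)
  assume *: "\<not> near g (\<lambda>z. z \<notin> I)"
  show "near g (\<lambda>z. z \<in> I)"
  proof (cases g)
    case (At s y)
    have k: "\<exists>k. lt s y k \<and> lt s k t \<and> k \<in> I" if "lt s y t" for t using * that At by auto
    obtain t where "lt s y t" using dir.gt_ex by blast
    from k[OF this] obtain k0 where "lt s y k0" "k0 \<in> I" by blast
    then show ?thesis unfolding At near.simps using k dir_interval_convex[OF assms] by blast
  next
    case (Inf s)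
    have k: "\<exists>k. lt s t k \<and> k \<in> I" for t using * Inf by auto
    from k obtain k0 where "k0 \<in> I" by blast
    then show ?thesis unfolding Inf near.simps using k dir_interval_convex[OF assms] by blast
  qed
qed

text \<open>A bounded convex set may lack a supremum in an incomplete order. The shapes allowed here
  have their endpoints in the structure, and the unbounded ones are excluded by
  \<open>b\<close>.\<close>

lemma interval_lub:
  assumes "dir_interval s I" "I \<noteq> {}" "\<forall>z\<in>I. lt s z b"
  shows "\<exists>d. (\<forall>z\<in>I. le s z d) \<and> (\<forall>w. lt s w d \<longrightarrow> (\<exists>z\<in>I. le s w z))"
proof -
  have ub: "\<exists>z. lt s a z \<and> \<not> lt s z b" for a
  proof (cases "lt s a b")
    case True
    then show ?thesis using dir.gt_ex[of s b] dir.less_trans dir.less_asym by blast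
  next
    case False
    then show ?thesis using dir.gt_ex[of s a] dir.less_trans by blast
  qed
  consider a where "I = {a}" | a c where "I = {z. lt s a z \<and> lt s z c}" | a where "I = {z. lt s z a}"
    | a where "I = {z. lt s a z}" | "I = UNIV"
    using assms(1) unfolding dir_interval_def by blast
  then show ?thesis
  proof cases
    case 1
    then show ?thesis by (auto intro!: exI[of _ a])
  next
    case (2 a c)
    have "\<exists>z. lt s a z \<and> lt s z c \<and> le s w z" if "lt s w c" for w
    proof (cases "lt s a w")
      case True
      then show ?thesis using that by auto
    next
      case False
      obtain z where "lt s a z" "lt s z c" using assms(2) 2 by blast
      moreover from this False have "le s w z"
        by (meson dir.not_less dir.le_less_trans dir.less_imp_le)
      ultimately show ?thesis by blast
    qed
    then show ?thesis unfolding 2 mem_Collect_eq Ball_def Bex_def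
      by (intro exI[of _ c]) (blast intro: dir.less_imp_le)
  next
    case 3
    then show ?thesis unfolding 3 mem_Collect_eq Ball_def Bex_def
      by (intro exI[of _ a]) (blast intro: dir.less_imp_le dir.order_refl)
  next
    case 4
    then show ?thesis using assms(3) ub by blast
  next
    case 5
    then show ?thesis using assms(3) by blast
  qed
qed

lemma finite_union_lub:
  assumes "finite \<I>" "\<And>I. I \<in> \<I> \<Longrightarrow> dir_interval s I" "\<Union>\<I> \<noteq> {}" "\<forall>z\<in>\<Union>\<I>. lt s z b"
  shows "\<exists>d. (\<forall>z\<in>\<Union>\<I>. le s z d) \<and> (\<forall>w. lt s w d \<longrightarrow> (\<exists>z\<in>\<Union>\<I>. le s w z))"
  using assms
proof (induction \<I> rule: finite_induct)
  case (insert I \<I>)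
  show ?case
  proof (cases "I = {} \<or> \<Union>\<I> = {}")
    case True
    then consider "\<Union>(insert I \<I>) = \<Union>\<I>" | "\<Union>(insert I \<I>) = I" by auto
    then show ?thesis
    proof cases
      case 1
      show ?thesis unfolding 1 using insert.prems unfolding 1 by (intro insert.IH) auto
    next
      case 2
      show ?thesis unfolding 2 using insert.prems unfolding 2 by (intro interval_lub) auto
    qed
  next
    case False
    then obtain d where d: "\<forall>z\<in>\<Union>\<I>. le s z d" "\<forall>w. lt s w d \<longrightarrow> (\<exists>z\<in>\<Union>\<I>. le s w z)"
      using insert.IH insert.prems by auto
    obtain c where c: "\<forall>z\<in>I. le s z c" "\<forall>w. lt s w c \<longrightarrow> (\<exists>z\<in>I. le s w z)"
      using interval_lub[of s I b] insert.prems False by auto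
    show ?thesis
    proof (cases "le s c d")
      case True
      then have "\<forall>z\<in>I. le s z d" using c(1) dir.order_trans by blast
      then show ?thesis using d by (intro exI[of _ d]) (simp, blast)
    next
      case False
      then have "le s d c" by (simp add: dir.not_le dir.less_imp_le)
      then have "\<forall>z\<in>\<Union>\<I>. le s z c" using d(1) dir.order_trans by blast
      then show ?thesis using c by (intro exI[of _ c]) (simp, blast)
    qed
  qed
qed simp

section \<open>Definable subsets of the line: finiteness, suprema, compactness and
  connectedness\<close>

locale omin =
  fixes \<R> :: "('a::unbounded_dense_linorder, 'f, 'r) fo_structure"
  assumes omin: "o_minimal \<R>"
begin

lemma dpred1_intervals:
  assumes "dpred1 \<R> P"
  obtains \<I> where "finite \<I>" "{x. P x} = \<Union>\<I>" "\<And>I s. I \<in> \<I> \<Longrightarrow> dir_interval s I"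
proof -
  have "definable \<R> 1 {xs. length xs = 1 \<and> P (xs ! 0)}"
    by (rule definable_dpred[OF assms]) simp
  from omin[unfolded o_minimal_def, rule_format, OF this]
  obtain \<I> where I: "finite \<I>" "{x. P x} = \<Union>\<I>"
    "\<forall>I\<in>\<I>. (\<exists>a. I = {a}) \<or> (\<exists>a b. I = {a<..<b}) \<or> (\<exists>a. I = {..<a}) \<or> (\<exists>a. I = {a<..}) \<or> I = UNIV"
    by auto
  have "dir_interval s I" if "I \<in> \<I>" for I s
  proof -
    from I(3)[rule_format, OF that] show ?thesis unfolding dir_interval_def
    proof (elim disjE exE)
      fix a b assume "I = {a<..<b}"
      then have "I = {z. lt s (if s then a else b) z \<and> lt s z (if s then b else a)}" by auto
      then show "(\<exists>a. I = {a}) \<or> (\<exists>a b. I = {z. lt s a z \<and> lt s z b}) \<or>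
        (\<exists>a. I = {z. lt s z a}) \<or> (\<exists>a. I = {z. lt s a z}) \<or> I = UNIV" by blast
    next
      fix a assume "I = {..<a}"
      then have "I = (if s then {z. lt s z a} else {z. lt s a z})" by auto
      then show "(\<exists>a. I = {a}) \<or> (\<exists>a b. I = {z. lt s a z \<and> lt s z b}) \<or>
        (\<exists>a. I = {z. lt s z a}) \<or> (\<exists>a. I = {z. lt s a z}) \<or> I = UNIV" by (metis (full_types))
    next
      fix a assume "I = {a<..}"
      then have "I = (if s then {z. lt s a z} else {z. lt s z a})" by auto
      then show "(\<exists>a. I = {a}) \<or> (\<exists>a b. I = {z. lt s a z \<and> lt s z b}) \<or>
        (\<exists>a. I = {z. lt s z a}) \<or> (\<exists>a. I = {z. lt s a z}) \<or> I = UNIV" by (metis (full_types))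
    qed blast+
  qed
  with I(1,2) show ?thesis by (rule that)
qed

text \<open>O-minimality turns germs into ultrafilters on the definable sets: this holds for the
  finitely many intervals and passes to their union.\<close>

lemma near_ultra:
  assumes "dpred1 \<R> P" shows "near g P \<or> near g (\<lambda>z. \<not> P z)"
proof -
  obtain \<I> where I: "finite \<I>" "{x. P x} = \<Union>\<I>" "\<And>I s. I \<in> \<I> \<Longrightarrow> dir_interval s I"
    using dpred1_intervals[OF assms] by blast
  have "near g (\<lambda>z. z \<in> \<Union>\<I>) \<or> near g (\<lambda>z. z \<notin> \<Union>\<I>)" using I(1,3)
  proof (induction \<I> rule: finite_induct)
    case empty
    then show ?case by (simp add: near_always)
  next
    case (insert I \<I>)
    consider "near g (\<lambda>z. z \<in> I)" | "near g (\<lambda>z. z \<in> \<Union>\<I>)"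
      | "near g (\<lambda>z. z \<notin> I)" "near g (\<lambda>z. z \<notin> \<Union>\<I>)"
      using near_interval[of I g] insert by blast
    then show ?case
    proof cases
      case 3
      then show ?thesis using near_conj[OF 3] by (auto elim: near_mono)
    qed (auto elim: near_mono)
  qed
  then show ?thesis using I(2) by (metis (mono_tags, lifting) mem_Collect_eq near_mono)
qed

lemma not_near: "dpred1 \<R> P \<Longrightarrow> \<not> near g P \<longleftrightarrow> near g (\<lambda>z. \<not> P z)"
  using near_ultra near_not_both by blast

lemma push_near:
  assumes "dpred1 \<R> P" "push f g s v" "near g (\<lambda>z. P (f z))" shows "near (At s v) P"
  using near_ultra[OF assms(1), of "At s v"] near_push[OF assms(2)] assms(3) near_not_both by blast

lemma infinite_interval:
  assumes "dpred1 \<R> P" "infinite {x. P x}"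
  obtains a b where "a < b" "\<And>x. a < x \<Longrightarrow> x < b \<Longrightarrow> P x"
proof -
  obtain \<I> where I: "finite \<I>" "{x. P x} = \<Union>\<I>" "\<And>I s. I \<in> \<I> \<Longrightarrow> dir_interval s I"
    using dpred1_intervals[OF assms(1)] by blast
  obtain J where J: "J \<in> \<I>" "infinite J" using I(1,2) assms(2) finite_Union by metis
  have "\<exists>a b. a < b \<and> (\<forall>x. a < x \<and> x < b \<longrightarrow> x \<in> J)"
    using I(3)[OF J(1), of True] unfolding dir_interval_def lt_simps
  proof (elim disjE exE)
    fix a assume "J = {a}"
    then show ?thesis using J(2) by simp
  next
    fix a b assume J': "J = {z. a < z \<and> z < b}"
    obtain x where "x \<in> J" using J(2) infinite_imp_nonempty by blast
    then have "a < b" using J' by auto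
    then show ?thesis using J' by blast
  next
    fix a assume "J = {z. z < a}"
    then show ?thesis using lt_ex[of a] by blast
  next
    fix a assume "J = {z. a < z}"
    then show ?thesis using gt_ex[of a] by blast
  next
    assume "J = UNIV"
    then show ?thesis using gt_ex by blast
  qed
  then show ?thesis using that I(2) J(1) by blast
qed

text \<open>Reduces genericity to finding one witness in each interval, since an infinite definable
  set of exceptions would contain an interval.\<close>

lemma finite_exceptions:
  assumes "dpred1 \<R> P" "\<And>a b. a < b \<Longrightarrow> \<exists>y. a < y \<and> y < b \<and> P y"
  shows "finite {y. \<not> P y}"
proof (rule ccontr)
  assume "\<not> ?thesis"
  then obtain a b where "a < b" "\<And>x. a < x \<Longrightarrow> x < b \<Longrightarrow> \<not> P x"
    using infinite_interval[OF dpred_not[OF assms(1)]] by blast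
  with assms(2) show False by blast
qed

text \<open>Pigeonhole: one of the finitely many definable cases occurs infinitely often in the
  interval, hence on a whole subinterval.\<close>

lemma subinterval_cases:
  assumes "a < b" "finite S" "\<And>s. s \<in> S \<Longrightarrow> dpred1 \<R> (P s)"
    and "\<And>x. a < x \<Longrightarrow> x < b \<Longrightarrow> \<exists>s\<in>S. P s x"
  obtains c d s where "s \<in> S" "a \<le> c" "c < d" "d \<le> b" "\<And>x. c < x \<Longrightarrow> x < d \<Longrightarrow> P s x"
proof -
  have "{a<..<b} \<subseteq> (\<Union>s\<in>S. {x. P s x \<and> a < x \<and> x < b})" using assms(4) by auto
  then have "infinite (\<Union>s\<in>S. {x. P s x \<and> a < x \<and> x < b})"
    using infinite_super infinite_Ioo[OF assms(1)] by blast
  then obtain s where s: "s \<in> S" "infinite {x. P s x \<and> a < x \<and> x < b}" using assms(2) by auto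
  have "dpred1 \<R> (\<lambda>x. P s x \<and> a < x \<and> x < b)" by (intro dp assms s(1))
  from infinite_interval[OF this s(2)] obtain c d
    where cd: "c < d" "\<And>x. c < x \<Longrightarrow> x < d \<Longrightarrow> P s x \<and> a < x \<and> x < b" by blast
  have "a \<le> c" using cd by (meson dense dual_order.strict_trans less_asym not_le)
  moreover have "d \<le> b" using cd by (meson dense dual_order.strict_trans less_asym not_le)
  ultimately show ?thesis using that s(1) cd by blast
qed

lemma finite_boundary:
  assumes "dpred1 \<R> P" shows "finite {y. \<not> (\<forall>s. near (At s y) (\<lambda>z. P z = P y))}"
proof (rule finite_exceptions)
  show "dpred \<R> (\<lambda>e. \<forall>s. near (At s (e 0)) (\<lambda>z. P z = P (e 0)))"
    by (intro dp dpred_app1[OF assms])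
  fix a b :: 'a assume "a < b"
  then obtain c d s where cd: "a \<le> c" "c < d" "d \<le> b" and s: "\<And>x. c < x \<Longrightarrow> x < d \<Longrightarrow> P x = s"
    by (rule subinterval_cases[of a b UNIV "\<lambda>s x. P x = s"]) (auto intro!: dp assms)
  obtain y where y: "c < y" "y < d" using cd dense by blast
  have "near (At r y) (\<lambda>z. P z = P y)" for r
    using near_conj[OF near_side[of True c y r] near_side[of False d y r]] y s
    by (auto elim: near_mono)
  then show "\<exists>y. a < y \<and> y < b \<and> (\<forall>s. near (At s y) (\<lambda>z. P z = P y))"
    using y cd by (meson le_less_trans less_le_trans)
qed

lemma definable_lub:
  assumes "dpred1 \<R> P" "P x" "\<And>z. P z \<Longrightarrow> lt s z b"
  obtains d where "\<And>z. P z \<Longrightarrow> le s z d" "\<And>w. lt s w d \<Longrightarrow> \<exists>z. P z \<and> lt s w z"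
proof -
  obtain \<I> where I: "finite \<I>" "{x. P x} = \<Union>\<I>" "\<And>I s. I \<in> \<I> \<Longrightarrow> dir_interval s I"
    using dpred1_intervals[OF assms(1)] by blast
  then have P: "z \<in> \<Union>\<I> \<longleftrightarrow> P z" for z by blast
  have "\<exists>d. (\<forall>z\<in>\<Union>\<I>. le s z d) \<and> (\<forall>w. lt s w d \<longrightarrow> (\<exists>z\<in>\<Union>\<I>. le s w z))"
    by (intro finite_union_lub[of \<I> s b] I) (use P assms(2,3) in blast)+
  then obtain d where d: "\<And>z. P z \<Longrightarrow> le s z d" "\<And>w. lt s w d \<Longrightarrow> \<exists>z. P z \<and> le s w z"
    using P by metis
  have "\<exists>z. P z \<and> lt s w z" if w: "lt s w d" for w
  proof -
    obtain w' where "lt s w w'" "lt s w' d" using dir.dense[OF w] by blast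
    then show ?thesis using d(2)[of w'] dir.less_le_trans by blast
  qed
  with d(1) that show ?thesis by blast
qed

text \<open>Definable compactness in dimension one.\<close>

lemma directed_family:
  assumes "J \<noteq> {}" and S: "\<And>j. j \<in> J \<Longrightarrow> dpred1 \<R> (S j)" and ne: "\<And>j. j \<in> J \<Longrightarrow> \<exists>x. S j x"
    and dir: "\<And>i j. i \<in> J \<Longrightarrow> j \<in> J \<Longrightarrow> \<exists>k\<in>J. \<forall>x. S k x \<longrightarrow> S i x \<and> S j x"
    and def: "dpred1 \<R> (\<lambda>y. \<exists>j\<in>J. \<forall>z. S j z \<longrightarrow> y < z)"
  shows "(\<exists>y. \<forall>j\<in>J. S j y) \<or> (\<exists>g. \<forall>j\<in>J. near g (S j))"
proof -
  \<comment> \<open>\<open>?I\<close> is the initial segment of points lying strictly below some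
    member of the family. Its end, possibly infinite, is where the family accumulates.\<close>
  let ?I = "\<lambda>y. \<exists>j\<in>J. \<forall>z. S j z \<longrightarrow> y < z"
  consider "\<forall>y. \<not> ?I y" | "\<forall>y. ?I y" | x b where "?I x" "\<not> ?I b" by blast
  then show ?thesis
  proof cases
    case 1
    have "near (Inf False) (S j)" if j: "j \<in> J" for j
    proof (rule ccontr)
      assume "\<not> ?thesis"
      then have "near (Inf False) (\<lambda>z. \<not> S j z)" using not_near[OF S[OF j]] by blast
      then obtain t where t: "\<And>z. z < t \<Longrightarrow> \<not> S j z" by auto
      obtain y where "y < t" using lt_ex by blast
      then show False using 1 j t by (meson not_less le_less_trans)
    qed
    then show ?thesis by blast
  next
    case 2
    have "near (Inf True) (S j)" if j: "j \<in> J" for j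
    proof (rule ccontr)
      assume "\<not> ?thesis"
      then have "near (Inf True) (\<lambda>z. \<not> S j z)" using not_near[OF S[OF j]] by blast
      then obtain t where t: "\<And>z. z > t \<Longrightarrow> \<not> S j z" by auto
      obtain i where "i \<in> J" "\<forall>z. S i z \<longrightarrow> t < z" using 2 by blast
      then show False using dir[OF j, of i] ne t by blast
    qed
    then show ?thesis by blast
  next
    case (3 x b)
    have "lt True z b" if "?I z" for z
    proof (rule ccontr)
      assume "\<not> lt True z b"
      then have "b \<le> z" by simp
      then show False using that 3(2) by (meson le_less_trans)
    qed
    from definable_lub[OF def 3(1) this] obtain d
      where d1: "\<And>z. ?I z \<Longrightarrow> z \<le> d" and d2: "\<And>w. w < d \<Longrightarrow> \<exists>z. ?I z \<and> w < z"
      unfolding le_simps lt_simps by metis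
    show ?thesis
    proof (rule ccontr)
      \<comment> \<open>If neither alternative holds, there are members missing \<open>d\<close>,
        the germ on its right and the germ on its left, and by the choice of \<open>d\<close> a
        member lying entirely above some \<open>w > t2\<close>. A common refinement still has a
        point not above \<open>t\<close>, for which no place is left.\<close>
      assume *: "\<not> ?thesis"
      then obtain j0 where j0: "j0 \<in> J" "\<not> S j0 d" by blast
      obtain j1 where j1: "j1 \<in> J" "near (At True d) (\<lambda>z. \<not> S j1 z)" using * not_near[OF S] by blast
      obtain j2 where j2: "j2 \<in> J" "near (At False d) (\<lambda>z. \<not> S j2 z)" using * not_near[OF S] by blast
      obtain t1 where t1: "d < t1" "\<And>z. d < z \<Longrightarrow> z < t1 \<Longrightarrow> \<not> S j1 z" using j1 by auto
      obtain t2 where t2: "t2 < d" "\<And>z. t2 < z \<Longrightarrow> z < d \<Longrightarrow> \<not> S j2 z" using j2 by auto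
      obtain w j3 where j3: "j3 \<in> J" "\<And>z. S j3 z \<Longrightarrow> w < z" "t2 < w" using d2[OF t2(1)] by blast
      obtain k1 where k1: "k1 \<in> J" "\<And>x. S k1 x \<Longrightarrow> S j0 x \<and> S j1 x" using dir[OF j0(1) j1(1)] by blast
      obtain k2 where k2: "k2 \<in> J" "\<And>x. S k2 x \<Longrightarrow> S j2 x \<and> S j3 x" using dir[OF j2(1) j3(1)] by blast
      obtain k where k: "k \<in> J" "\<And>x. S k x \<Longrightarrow> S k1 x \<and> S k2 x" using dir[OF k1(1) k2(1)] by blast
      obtain t where t: "d < t" "t < t1" using dense[OF t1(1)] by blast
      have "\<not> ?I t" using d1 t(1) by (meson not_le)
      then obtain z where z: "S k z" "\<not> t < z" using k(1) by blast
      from z(1) have S: "S j0 z" "S j1 z" "S j2 z" "S j3 z" using k k1 k2 by auto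
      have "z < t1" using z(2) t by simp
      moreover have "t2 < z" using j3(2)[OF S(4)] j3(3) by simp
      ultimately show False using S j0(2) t1(2)[of z] t2(2)[of z] by (metis linorder_cases)
    qed
  qed
qed

text \<open>Real induction: at the infimum of the failures \<open>left\<close> gives
  \<open>P\<close>, and \<open>right\<close> then pushes the failures away from it.\<close>

lemma definable_connected:
  assumes P: "dpred1 \<R> P" and "P x" "x \<le> y"
    and right: "\<And>z. x \<le> z \<Longrightarrow> z < y \<Longrightarrow> P z \<Longrightarrow> near (At True z) P"
    and left: "\<And>z. x < z \<Longrightarrow> z \<le> y \<Longrightarrow> near (At False z) P \<Longrightarrow> P z"
  shows "P y"
proof (rule ccontr)
  assume "\<not> P y"
  let ?Q = "\<lambda>z. x \<le> z \<and> z \<le> y \<and> \<not> P z"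
  have Q: "dpred1 \<R> ?Q" by (intro dp P)
  obtain b where "b < x" using lt_ex by blast
  then have "lt False z b" if "?Q z" for z using that by auto
  moreover have "?Q y" using \<open>\<not> P y\<close> assms by auto
  ultimately obtain d where d1: "\<And>z. ?Q z \<Longrightarrow> d \<le> z" and d2: "\<And>w. d < w \<Longrightarrow> \<exists>z. ?Q z \<and> z < w"
    using definable_lub[OF Q, of y False b] unfolding le_simps lt_simps by metis
  have xd: "x \<le> d" using d2[of x] by (meson not_le)
  have dy: "d \<le> y" using d1 \<open>?Q y\<close> by blast
  have Pd: "P d"
  proof (cases "x = d")
    case False
    then have "x < d" using xd by simp
    moreover have "P z" if "x < z" "z < d" for z using d1[of z] that dy by (meson less_imp_le not_le order_trans)
    ultimately have "near (At False d) P" by auto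
    then show ?thesis using left \<open>x < d\<close> dy by blast
  qed (use assms in auto)
  then have "d < y" using dy \<open>\<not> P y\<close> by (metis le_less)
  then obtain t where "d < t" "\<And>z. d < z \<Longrightarrow> z < t \<Longrightarrow> P z" using right[OF xd _ Pd] by auto
  then show False using d2[of t] d1 Pd by (metis le_less)
qed

end

section \<open>The monotonicity theorem\<close>

declare near.simps [simp del]

context omin
begin

text \<open>Real induction along the interval. Here and below \<open>e\<close> is an orientation:
  side \<open>s\<close> of the argument is sent to side \<open>s = e\<close> of the value, so
  \<open>e\<close> is true for an increasing function.\<close>

lemma locally_monotone:
  assumes f: "dfun1 \<R> f" and "x < y"
    and mono: "\<And>z s. x \<le> z \<Longrightarrow> z \<le> y \<Longrightarrow> near (At s z) (\<lambda>w. lt (s = e) (f z) (f w))"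
  shows "lt e (f x) (f y)"
proof -
  let ?P = "\<lambda>z. z = x \<or> lt e (f x) (f z)"
  have "?P y"
  proof (rule definable_connected[where P = ?P and x = x])
    show "dpred1 \<R> ?P" by (intro dp dterm_fun[OF f])
    show "near (At True z) ?P" if "x \<le> z" "z < y" "?P z" for z
    proof (rule near_mono)
      show "near (At True z) (\<lambda>w. lt e (f z) (f w))" using mono[of z True] that by simp
    qed (use that(3) dir.less_trans in blast)
    show "?P z" if "x < z" "z \<le> y" "near (At False z) ?P" for z
    proof -
      have "near (At False z) (\<lambda>w. lt e (f w) (f z))"
        using mono[of z False] that by (cases e) (auto elim: near_mono)
      from near_ex[OF near_conj[OF near_conj[OF this that(3)] near_ne']]
      show ?thesis by (meson dir.less_trans)
    qed
  qed (use assms in auto)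
  then show ?thesis using \<open>x < y\<close> by auto
qed

text \<open>
  If every point of an interval were a strict local minimum, then the following lemma, applied to
  both ends of the interval, would give a point at which \<open>f\<close> jumps both down and up.
\<close>

definition jump :: "('a \<Rightarrow> 'a) \<Rightarrow> bool \<Rightarrow> bool \<Rightarrow> 'a \<Rightarrow> bool" where
  "jump f r s x \<longleftrightarrow> (\<exists>c d. lt s c x \<and> lt s x d \<and>
     (\<forall>y y'. lt s c y \<and> lt s y x \<and> lt s x y' \<and> lt s y' d \<longrightarrow> lt r (f y') (f y)))"

lemma local_min_jump:
  assumes f: "dfun1 \<R> f" and ab: "lt s a b"
    and inj: "\<And>x y. lt s a x \<Longrightarrow> lt s x b \<Longrightarrow> lt s a y \<Longrightarrow> lt s y b \<Longrightarrow> f x = f y \<Longrightarrow> x = y"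
    and min: "\<And>x q. lt s a x \<Longrightarrow> lt s x b \<Longrightarrow> near (At q x) (\<lambda>z. lt r (f x) (f z))"
  obtains c where "lt s a c" "lt s c b" "\<And>x. lt s c x \<Longrightarrow> lt s x b \<Longrightarrow> jump f r s x"
proof -
  note dpf = dp dterm_fun[OF f]
  \<comment> \<open>On an interval of such points \<open>f\<close> would be monotone in the sense of
    \<open>lt r\<close>, against the local minima. So \<open>B\<close> is finite, and every point
    close to \<open>b\<close> is followed by a point of smaller value. Smaller and larger refer to
    \<open>lt r\<close>.\<close>
  define B where "B = {x. lt s a x \<and> lt s x b \<and> (\<forall>y. lt s x y \<and> lt s y b \<longrightarrow> lt r (f x) (f y))}"
  have dB: "dpred1 \<R> (\<lambda>x. x \<in> B)" unfolding B_def mem_Collect_eq by (intro dpf)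
  have "finite {x. x \<in> B}"
  proof (rule ccontr)
    assume "infinite {x. x \<in> B}"
    from infinite_interval[OF dB this] obtain p q where pq: "p < q" "\<And>x. p < x \<Longrightarrow> x < q \<Longrightarrow> x \<in> B"
      by metis
    obtain x where x: "p < x" "x < q" using dense pq(1) by blast
    have xB: "x \<in> B" using pq x by blast
    have "near (At (\<not> s) x) (\<lambda>z. z \<in> B)"
      by (rule near_mono[OF near_conj[OF near_side[of True p x] near_side[of False q x]]])
        (use x pq in auto)
    moreover have "near (At (\<not> s) x) (\<lambda>z. lt r (f x) (f z))" using min xB B_def by blast
    moreover have "near (At (\<not> s) x) (lt (\<not> s) x)" by (rule near_beyond)
    ultimately obtain z where "z \<in> B" "lt r (f x) (f z)" "lt s z x"
      using near_ex[OF near_conj[OF near_conj]] by (metis lt_simps(3))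
    then show False using xB unfolding B_def by (blast dest: dir.less_asym)
  qed
  then have "near (At (\<not> s) b) (\<lambda>z. z \<notin> B)" using near_notin_finite by simp
  moreover have "near (At (\<not> s) b) (\<lambda>z. lt s a z)" using near_side[OF ab] .
  ultimately have "near (At (\<not> s) b) (\<lambda>z. z \<notin> B \<and> lt s a z)" by (rule near_conj)
  then obtain t where tb: "lt s t b" and t: "\<And>z. lt s t z \<Longrightarrow> lt s z b \<Longrightarrow> z \<notin> B \<and> lt s a z"
    by (auto simp: near.simps)
  have after: "\<exists>y. lt s x y \<and> lt s y b \<and> lt r (f y) (f x)" if x: "lt s t x" "lt s x b" for x
  proof -
    have "x \<notin> B" "lt s a x" using t x by blast+
    then obtain y where y: "lt s x y" "lt s y b" "\<not> lt r (f x) (f y)" using x unfolding B_def by blast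
    have "f x \<noteq> f y" using inj[of x y] y x \<open>lt s a x\<close> dir.less_trans by blast
    with y show ?thesis by (meson dir.linorder_cases)
  qed
  \<comment> \<open>Otherwise the points after \<open>c\<close> with values below \<open>f c\<close>
    have a supremum \<open>d\<close> before \<open>b\<close>. A point after \<open>d\<close> has
    value below \<open>f d\<close> but not below \<open>f c\<close>, so \<open>f c\<close> lies
    below \<open>f d\<close>; now the local minimum at \<open>d\<close> forbids such points just
    before \<open>d\<close>.\<close>
  have evb: "near (At (\<not> s) b) (\<lambda>y. lt r (f y) (f c))" if c: "lt s t c" "lt s c b" for c
  proof (rule ccontr)
    assume n: "\<not> ?thesis"
    have "dpred1 \<R> (\<lambda>y. lt r (f y) (f c))" by (intro dpf)
    from n[unfolded not_near[OF this]] obtain u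
      where u: "lt s u b" "\<And>y. lt s u y \<Longrightarrow> lt s y b \<Longrightarrow> \<not> lt r (f y) (f c)" by (auto simp: near.simps)
    define D where "D y \<longleftrightarrow> lt s c y \<and> lt s y b \<and> lt r (f y) (f c)" for y
    have dD: "dpred1 \<R> D" unfolding D_def by (intro dpf)
    obtain y0 where y0: "D y0" using after[OF c] unfolding D_def by blast
    have "lt s z b" if "D z" for z using that unfolding D_def by blast
    from definable_lub[OF dD y0 this] obtain d
      where d: "\<And>z. D z \<Longrightarrow> le s z d" "\<And>w. lt s w d \<Longrightarrow> \<exists>z. D z \<and> lt s w z" by metis
    have cd: "lt s c d" using d(1)[OF y0] y0 unfolding D_def by (meson dir.less_le_trans)
    have db: "lt s d b"
    proof (rule ccontr)
      assume "\<not> lt s d b"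
      then have "lt s u d" using u(1) by (meson dir.not_less dir.less_le_trans)
      then show False using d(2) u(2) unfolding D_def by blast
    qed
    obtain y where y: "lt s d y" "lt s y b" "lt r (f y) (f d)"
      using after[OF dir.less_trans[OF c(1) cd] db] by blast
    have "\<not> D y" using d(1)[of y] y(1) by (meson dir.not_le)
    then have "\<not> lt r (f y) (f c)" using y cd dir.less_trans unfolding D_def by blast
    then have fcd: "lt r (f c) (f d)" using y(3) by (meson dir.not_less dir.le_less_trans)
    have "lt s a d" using t[OF dir.less_trans[OF c(1) cd] db] by blast
    then have "near (At (\<not> s) d) (\<lambda>z. lt r (f d) (f z))" using min db by blast
    then obtain w where w: "lt s w d" "\<And>z. lt s w z \<Longrightarrow> lt s z d \<Longrightarrow> lt r (f d) (f z)" by (auto simp: near.simps)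
    obtain z where z: "D z" "lt s w z" using d(2)[OF w(1)] by blast
    have "z \<noteq> d" using z(1) fcd unfolding D_def by (blast dest: dir.less_asym)
    then have "lt s z d" using d(1)[OF z(1)] by (meson dir.le_neq_trans)
    then have "lt r (f d) (f z)" using w z by blast
    then show False using fcd z(1) unfolding D_def by (meson dir.less_asym dir.less_trans)
  qed
  have "near (At (\<not> s) b) (jump f r s)"
  proof (rule ccontr)
    assume n: "\<not> ?thesis"
    have "dpred1 \<R> (jump f r s)" unfolding jump_def by (intro dpf)
    from n[unfolded not_near[OF this]] have "near (At (\<not> s) b) (\<lambda>z. \<not> jump f r s z \<and> lt s t z)"
      using near_conj near_side[OF tb] by blast
    then obtain u where ub: "lt s u b"
      and u: "\<And>z. lt s u z \<Longrightarrow> lt s z b \<Longrightarrow> \<not> jump f r s z \<and> lt s t z" by (auto simp: near.simps)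
    obtain c where c: "lt s u c" "lt s c b" using dir.dense[OF ub] by blast
    then have tc: "lt s t c" using u by blast
    have ac: "lt s a c" using t[OF tc c(2)] by blast
    \<comment> \<open>The supremum \<open>e\<close> of the points whose values are not below
      \<open>f c\<close> is a jump: later values are below \<open>f c\<close>, values just before
      \<open>e\<close> are not. Local minimality at \<open>e\<close> excludes that \<open>e\<close>
      alone reaches the level.\<close>
    define E where "E y \<longleftrightarrow> lt s u y \<and> lt s y b \<and> \<not> lt r (f y) (f c)" for y
    have dE: "dpred1 \<R> E" unfolding E_def by (intro dpf)
    have Ec: "E c" using c unfolding E_def by blast
    have "lt s z b" if "E z" for z using that unfolding E_def by blast
    from definable_lub[OF dE Ec this] obtain e
      where e: "\<And>z. E z \<Longrightarrow> le s z e" "\<And>w. lt s w e \<Longrightarrow> \<exists>z. E z \<and> lt s w z" by metis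
    obtain v where v: "lt s v b" "\<And>y. lt s v y \<Longrightarrow> lt s y b \<Longrightarrow> lt r (f y) (f c)"
      using evb[OF tc c(2)] by (auto simp: near.simps)
    have eb: "lt s e b"
    proof (rule ccontr)
      assume "\<not> lt s e b"
      then have "lt s v e" using v(1) by (meson dir.not_less dir.less_le_trans)
      then show False using e(2) v(2) unfolding E_def by blast
    qed
    from near_ex[OF near_conj[OF min[OF ac c(2), of s] near_between[OF c(2)]]]
    obtain z where z: "lt r (f c) (f z)" "lt s c z" "lt s z b" by blast
    have "E z" unfolding E_def using z c(1) by (meson dir.less_trans dir.less_asym)
    then have ce: "lt s c e" using e(1) z(2) by (meson dir.less_le_trans)
    have ue: "lt s u e" using c(1) ce by (rule dir.less_trans)
    have ae: "lt s a e" using ac ce by (rule dir.less_trans)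
    have right: "lt r (f y) (f c)" if "lt s e y" "lt s y b" for y
      using e(1)[of y] that ue unfolding E_def by (meson dir.not_le dir.less_trans)
    have "near (At (\<not> s) e) (\<lambda>y. \<not> lt r (f y) (f c))"
    proof (rule ccontr)
      assume n: "\<not> ?thesis"
      have "dpred1 \<R> (\<lambda>y. lt r (f y) (f c))" by (intro dpf)
      from near_ultra[OF this, of "At (\<not> s) e"] n
      have n': "near (At (\<not> s) e) (\<lambda>y. lt r (f y) (f c))" by blast
      then obtain w where w: "lt s w e" "\<And>z. lt s w z \<Longrightarrow> lt s z e \<Longrightarrow> lt r (f z) (f c)" by (auto simp: near.simps)
      obtain z where z: "E z" "lt s w z" using e(2)[OF w(1)] by blast
      have "z = e" using w(2)[OF z(2)] e(1)[OF z(1)] z(1) unfolding E_def by (meson dir.le_neq_trans)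
      then have "\<not> lt r (f e) (f c)" using z(1) unfolding E_def by blast
      moreover have "f e \<noteq> f c" using inj[OF ae eb ac c(2)] ce by auto
      ultimately have "lt r (f c) (f e)" by (meson dir.linorder_cases)
      moreover obtain y where "lt r (f e) (f y)" "lt r (f y) (f c)"
        using near_ex[OF near_conj[OF min[OF ae eb] n']] by blast
      ultimately show False by (meson dir.less_asym dir.less_trans)
    qed
    then obtain w where w: "lt s w e" "\<And>z. lt s w z \<Longrightarrow> lt s z e \<Longrightarrow> \<not> lt r (f z) (f c)" by (auto simp: near.simps)
    have "lt r (f y') (f y)" if "lt s w y" "lt s y e" "lt s e y'" "lt s y' b" for y y'
      using w(2)[OF that(1,2)] right[OF that(3,4)] by (meson dir.not_less dir.less_le_trans)
    then have "jump f r s e" unfolding jump_def using w(1) eb by blast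
    then show False using u[OF ue eb] by blast
  qed
  then have "near (At (\<not> s) b) (\<lambda>z. jump f r s z \<and> lt s a z)"
    using near_conj near_side[OF ab] by blast
  then obtain c where c: "lt s c b" "\<And>x. lt s c x \<Longrightarrow> lt s x b \<Longrightarrow> jump f r s x \<and> lt s a x" by (auto simp: near.simps)
  obtain c' where c': "lt s c c'" "lt s c' b" using dir.dense[OF c(1)] by blast
  show ?thesis using that[of c'] c c' dir.less_trans by blast
qed

lemma no_local_min:
  assumes f: "dfun1 \<R> f" and ab: "a < b"
    and inj: "\<And>x y. a < x \<Longrightarrow> x < b \<Longrightarrow> a < y \<Longrightarrow> y < b \<Longrightarrow> f x = f y \<Longrightarrow> x = y"
    and min: "\<And>x q. a < x \<Longrightarrow> x < b \<Longrightarrow> near (At q x) (\<lambda>z. lt r (f x) (f z))"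
  shows False
proof -
  obtain c where c: "a < c" "c < b" "\<And>x. c < x \<Longrightarrow> x < b \<Longrightarrow> jump f r True x"
    using local_min_jump[OF f, of True a b r] ab inj min by (auto simp only: lt_simps)
  have bc: "lt False b c" using c by simp
  have inj': "x = y"
    if "lt False b x" "lt False x c" "lt False b y" "lt False y c" "f x = f y" for x y
    using inj[of x y] that c by auto
  have min': "near (At q x) (\<lambda>z. lt r (f x) (f z))" if "lt False b x" "lt False x c" for x q
    using min[of x q] that c by auto
  \<comment> \<open>The second application runs from \<open>b\<close> down to \<open>c\<close>, so
    its jumps lie near \<open>c\<close> and inside the interval on which the first application
    already gives jumps of the opposite sense.\<close>
  obtain c' where c': "c < c'" "c' < b" "\<And>x. c < x \<Longrightarrow> x < c' \<Longrightarrow> jump f r False x"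
  proof (rule local_min_jump[OF f bc inj' min'])
    fix c' assume "lt False b c'" "lt False c' c"
      and "\<And>x. lt False c' x \<Longrightarrow> lt False x c \<Longrightarrow> jump f r False x"
    then show thesis using that[of c'] by simp
  qed
  obtain x where x: "c < x" "x < c'" using dense[OF c'(1)] by blast
  then have "jump f r True x" "jump f r False x" using c c' by auto
  then obtain p q p' q' where *: "p < x" "x < q" "q' < x" "x < p'"
    "\<And>y y'. p < y \<Longrightarrow> y < x \<Longrightarrow> x < y' \<Longrightarrow> y' < q \<Longrightarrow> lt r (f y') (f y)"
    "\<And>y y'. y < p' \<Longrightarrow> x < y \<Longrightarrow> y' < x \<Longrightarrow> q' < y' \<Longrightarrow> lt r (f y') (f y)"
    unfolding jump_def lt_simps by metis
  obtain y where "p < y" "q' < y" "y < x" using dense[of "max p q'" x] * by auto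
  moreover obtain y' where "y' < q" "y' < p'" "x < y'" using dense[of x "min q p'"] * by auto
  ultimately show False using *(5)[of y y'] *(6)[of y' y] by (meson dir.less_asym)
qed

text \<open>By injectivity \<open>f\<close> stays strictly on one side of \<open>f x\<close> along
  each germ at \<open>x\<close>, and the pair of these sides is constant on a subinterval. Equal
  sides would make every point a strict local extremum, so the sides differ and
  \<open>locally_monotone\<close> applies.\<close>

lemma injective_imp_monotone:
  assumes f: "dfun1 \<R> f" and ab: "a < b"
    and inj: "\<And>x y. a < x \<Longrightarrow> x < b \<Longrightarrow> a < y \<Longrightarrow> y < b \<Longrightarrow> f x = f y \<Longrightarrow> x = y"
  obtains c d e where "a \<le> c" "c < d" "d \<le> b"
    "\<And>x y. c < x \<Longrightarrow> x < y \<Longrightarrow> y < d \<Longrightarrow> lt e (f x) (f y)"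
proof -
  let ?P = "\<lambda>(p, q) x. near (At True x) (\<lambda>z. lt p (f x) (f z)) \<and> near (At False x) (\<lambda>z. lt q (f x) (f z))"
  have "\<exists>p. near (At s x) (\<lambda>z. lt p (f x) (f z))" if x: "a < x" "x < b" for s x
  proof (rule ccontr)
    assume *: "\<not> ?thesis"
    have d: "dpred1 \<R> (\<lambda>z. lt p (f x) (f z))" for p by (intro dp dterm_fun[OF f])
    have "near (At s x) (\<lambda>z. \<not> lt p (f x) (f z))" for p
      using near_ultra[OF d, of "At s x" p] * by blast
    note n = this[of True] this[of False]
    have "near (At s x) (\<lambda>z. a < z \<and> z < b)"
      using near_conj[OF near_side[of True a x s] near_side[of False b x s]] x by simp
    from near_ex[OF near_conj[OF near_conj[OF n] near_conj[OF this near_ne'[of _ x]]]]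
    obtain z where "\<not> f x < f z" "\<not> f z < f x" "a < z" "z < b" "z \<noteq> x" by auto
    then show False using inj[OF x, of z] by auto
  qed
  note ex1 = this
  have ex: "\<exists>s\<in>UNIV. ?P s x" if x: "a < x" "x < b" for x
  proof -
    obtain p where "near (At True x) (\<lambda>z. lt p (f x) (f z))" using ex1[OF x] by blast
    moreover obtain q where "near (At False x) (\<lambda>z. lt q (f x) (f z))" using ex1[OF x] by blast
    ultimately show ?thesis by (intro bexI[of _ "(p, q)"]) auto
  qed
  have d: "dpred1 \<R> (?P s)" for s by (cases s) (simp, intro dp dterm_fun[OF f])
  obtain c d s where "a \<le> c" "c < d" "d \<le> b" "\<And>x. c < x \<Longrightarrow> x < d \<Longrightarrow> ?P s x"
    by (rule subinterval_cases[OF ab finite d ex]) (assumption, assumption, rule that)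
  moreover obtain p q where "s = (p, q)" by (cases s)
  ultimately have cd: "a \<le> c" "c < d" "d \<le> b"
    and p: "\<And>x. c < x \<Longrightarrow> x < d \<Longrightarrow> near (At True x) (\<lambda>z. lt p (f x) (f z))"
    and q: "\<And>x. c < x \<Longrightarrow> x < d \<Longrightarrow> near (At False x) (\<lambda>z. lt q (f x) (f z))" by auto
  have inj': "x = y" if "c < x" "x < d" "c < y" "y < d" "f x = f y" for x y
    using inj[of x y] that cd by auto
  have "p \<noteq> q"
  proof
    assume "p = q"
    then have "near (At s x) (\<lambda>z. lt p (f x) (f z))" if "c < x" "x < d" for x s
      using p q that by (cases s) auto
    with no_local_min[OF f cd(2) inj'] show False by blast
  qed
  then have "near (At s x) (\<lambda>z. lt (s = p) (f x) (f z))" if "c < x" "x < d" for x s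
    using p q that by (cases s; cases p; cases q) auto
  then have "lt p (f x) (f y)" if "c < x" "x < y" "y < d" for x y
    using that by (intro locally_monotone[OF f]) auto
  with cd that show ?thesis by blast
qed

section \<open>Behaviour at generic points and infinite fibres\<close>

definition locally_constant :: "('a \<Rightarrow> 'a) \<Rightarrow> 'a \<Rightarrow> bool" where
  "locally_constant f y \<longleftrightarrow> (\<forall>s. near (At s y) (\<lambda>z. f z = f y))"

text \<open>Stated through germs, so that continuity and the direction in which values leave
  \<open>f y\<close> are recorded together; \<open>e\<close> is the orientation.\<close>

definition locally_homeo :: "('a \<Rightarrow> 'a) \<Rightarrow> 'a \<Rightarrow> bool" where
  "locally_homeo f y \<longleftrightarrow> (\<exists>e. \<forall>s. push f (At s y) (s = e) (f y))"

lemma dpred_locally_constant: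
  assumes "dfun1 \<R> f" shows "dpred1 \<R> (locally_constant f)"
  unfolding locally_constant_def by (intro dp dterm_fun[OF assms])

lemma dpred_locally_homeo:
  assumes "dfun1 \<R> f" shows "dpred1 \<R> (locally_homeo f)"
  unfolding locally_homeo_def push_def by (intro dp dterm_fun[OF assms])

lemma monotonicity_point:
  assumes f: "dfun1 \<R> f" and ab: "a < b"
  shows "\<exists>y. a < y \<and> y < b \<and> (locally_constant f y \<or> locally_homeo f y)"
proof (cases "\<exists>v. infinite {z. a < z \<and> z < b \<and> f z = v}")
  case True
  then obtain v where v: "infinite {z. a < z \<and> z < b \<and> f z = v}" by blast
  have "dpred1 \<R> (\<lambda>z. a < z \<and> z < b \<and> f z = v)" by (intro dp dterm_fun[OF f])
  from infinite_interval[OF this v] obtain p q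
    where pq: "p < q" "\<And>x. p < x \<Longrightarrow> x < q \<Longrightarrow> a < x \<and> x < b \<and> f x = v" by metis
  obtain y where y: "p < y" "y < q" using dense pq by blast
  have "near (At s y) (\<lambda>z. f z = f y)" for s
    by (rule near_mono[OF near_conj[OF near_side[of True p y] near_side[of False q y]]])
      (use pq y in auto)
  then show ?thesis using y pq unfolding locally_constant_def by blast
next
  case False
  then have fin: "finite {z. a < z \<and> z < b \<and> f z = v}" for v by blast
  \<comment> \<open>The least points of the fibres. With finite fibres this definable transversal is
    infinite, so it contains an interval, on which \<open>f\<close> is injective.\<close>
  let ?P = "\<lambda>x. a < x \<and> x < b \<and> (\<forall>z. a < z \<and> z < x \<longrightarrow> f z \<noteq> f x)"
  have dP: "dpred1 \<R> ?P" by (intro dp dterm_fun[OF f])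
  have "infinite {x. ?P x}"
  proof
    assume "finite {x. ?P x}"
    then have "finite (\<Union>v\<in>f ` {x. ?P x}. {z. a < z \<and> z < b \<and> f z = v})" using fin by blast
    moreover have "{a<..<b} \<subseteq> (\<Union>v\<in>f ` {x. ?P x}. {z. a < z \<and> z < b \<and> f z = v})"
    proof
      fix x assume x: "x \<in> {a<..<b}"
      let ?M = "{z. a < z \<and> z < b \<and> f z = f x}"
      have "?M \<noteq> {}" using x by auto
      then have "Min ?M \<in> ?M" by (rule Min_in[OF fin])
      then obtain m where m: "m = Min ?M" "a < m" "m < b" "f m = f x" by auto
      have "f z \<noteq> f m" if "a < z" "z < m" for z
      proof
        assume "f z = f m"
        then have "z \<in> ?M" using that m by auto
        then show False using Min_le[OF fin] that(2) m(1) by (meson not_le)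
      qed
      then have "?P m" using m by blast
      moreover have "x \<in> {z. a < z \<and> z < b \<and> f z = f m}" using x m by auto
      ultimately show "x \<in> (\<Union>v\<in>f ` {x. ?P x}. {z. a < z \<and> z < b \<and> f z = v})" by blast
    qed
    ultimately show False using infinite_Ioo[OF ab] finite_subset by blast
  qed
  from infinite_interval[OF dP this] obtain a' b'
    where ab': "a' < b'" "\<And>x. a' < x \<Longrightarrow> x < b' \<Longrightarrow> ?P x" by metis
  have inj: "x = y" if "a' < x" "x < b'" "a' < y" "y < b'" "f x = f y" for x y
    using ab'(2)[of x] ab'(2)[of y] that by (metis linorder_neqE)
  obtain c d e
    where cd: "a' \<le> c" "c < d" "d \<le> b'" and mono: "\<And>x y. c < x \<Longrightarrow> x < y \<Longrightarrow> y < d \<Longrightarrow> lt e (f x) (f y)"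
  proof (rule injective_imp_monotone[OF f ab'(1)])
    note * = that
    show "x = y" if "a' < x" "x < b'" "a' < y" "y < b'" "f x = f y" for x y
      using that by (rule inj)
    show thesis if "a' \<le> c" "c < d" "d \<le> b'"
      "\<And>x y. c < x \<Longrightarrow> x < y \<Longrightarrow> y < d \<Longrightarrow> lt e (f x) (f y)" for c d e
      using that by (rule *)
  qed
  have mono': "lt (s = e) (f x) (f y)" if "c < x" "x < d" "c < y" "y < d" "lt s x y" for x y s
    using mono[of x y] mono[of y x] that by (cases s; cases e) auto
  have mono_rev: "lt s x y" if "c < x" "x < d" "c < y" "y < d" "lt (s = e) (f x) (f y)" for x y s
    using mono'[of y x s] that by (metis dir.less_asym dir.less_irrefl dir.linorder_cases)
  \<comment> \<open>The image of \<open>(c, d)\<close> is infinite and definable and therefore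
    contains an interval. A monotone function has no gap at a value inside it, which yields
    continuity there.\<close>
  let ?Q = "\<lambda>v. \<exists>x. c < x \<and> x < d \<and> f x = v"
  have dQ: "dpred1 \<R> ?Q" by (intro dp dterm_fun[OF f])
  have "inj_on f {c<..<d}" using inj cd by (auto intro!: inj_onI)
  then have "infinite (f ` {c<..<d})" using infinite_Ioo[OF cd(2)] finite_imageD by blast
  moreover have "f ` {c<..<d} = {v. ?Q v}" by auto
  ultimately have "infinite {v. ?Q v}" by simp
  from infinite_interval[OF dQ this] obtain p q where pq: "p < q" "\<And>v. p < v \<Longrightarrow> v < q \<Longrightarrow> ?Q v"
    by metis
  obtain v where v: "p < v" "v < q" using dense pq by blast
  obtain y where y: "c < y" "y < d" "f y = v" using pq v by blast
  have "push f (At s y) (s = e) v" for s unfolding push_def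
  proof (intro allI impI)
    fix t assume t: "lt (s = e) v t"
    have "near (At (s = e) v) (\<lambda>u. p < u \<and> u < q)"
      using near_conj[OF near_side[of True p v "s = e"] near_side[of False q v "s = e"]] v by simp
    from near_ex[OF near_conj[OF this near_between[OF t]]]
    obtain u where u: "p < u" "u < q" "lt (s = e) v u" "lt (s = e) u t" by blast
    obtain w where w: "c < w" "w < d" "f w = u" using pq u by blast
    have yw: "lt s y w" using mono_rev y w u by blast
    have "near (At s y) (\<lambda>z. c < z \<and> z < d)"
      using near_conj[OF near_side[of True c y s] near_side[of False d y s]] y by simp
    from near_conj[OF this near_between[OF yw]]
    show "near (At s y) (\<lambda>z. lt (s = e) v (f z) \<and> lt (s = e) (f z) t)"
    proof (rule near_mono)
      fix z assume z: "(c < z \<and> z < d) \<and> lt s y z \<and> lt s z w"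
      then show "lt (s = e) v (f z) \<and> lt (s = e) (f z) t"
        using mono'[of y z s] mono'[of z w s] y w u(4) by (metis dir.less_trans)
    qed
  qed
  then have "locally_homeo f y" unfolding locally_homeo_def using y(3) by blast
  moreover have "a < y" "y < b" using ab'(2)[of y] y cd by auto
  ultimately show ?thesis by blast
qed

text \<open>The last clause makes a function injective between consecutive exceptional points; for
  \<open>base\<close> this allows the points of a class to be numbered by intervals.\<close>

lemma monotonicity:
  assumes f: "dfun1 \<R> f"
  obtains F where "finite F" "\<And>y. y \<notin> F \<Longrightarrow> locally_constant f y \<or> locally_homeo f y"
    "\<And>x y. x < y \<Longrightarrow> (\<And>z. x \<le> z \<Longrightarrow> z \<le> y \<Longrightarrow> z \<notin> F \<and> \<not> locally_constant f z) \<Longrightarrow> f x \<noteq> f y"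
proof -
  define P where "P e y \<longleftrightarrow> (\<forall>s. near (At s y) (\<lambda>z. lt (s = e) (f y) (f z)))" for e y
  have dP: "dpred1 \<R> (P e)" for e unfolding P_def by (intro dp dterm_fun[OF f])
  \<comment> \<open>The second part makes the orientation locally constant outside \<open>F\<close>,
    so that by connectedness it cannot change along an interval avoiding \<open>F\<close>.\<close>
  define F where "F = {y. \<not> (locally_constant f y \<or> locally_homeo f y)} \<union>
    (\<Union>e. {y. \<not> (\<forall>s. near (At s y) (\<lambda>z. P e z = P e y))})"
  have "finite {y. \<not> (locally_constant f y \<or> locally_homeo f y)}"
    by (intro finite_exceptions dp dpred_locally_constant dpred_locally_homeo f monotonicity_point)
  then have "finite F" unfolding F_def by (intro finite_UnI finite_UN_I finite finite_boundary dP)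
  moreover have "locally_constant f y \<or> locally_homeo f y" if "y \<notin> F" for y
    using that unfolding F_def by blast
  moreover have "f x \<noteq> f y"
    if xy: "x < y" and z: "\<And>z. x \<le> z \<Longrightarrow> z \<le> y \<Longrightarrow> z \<notin> F \<and> \<not> locally_constant f z" for x y
  proof -
    have P: "near (At s w) (\<lambda>z. P e z = P e w)" if "x \<le> w" "w \<le> y" for w s e
      using z[OF that] unfolding F_def by blast
    have "locally_homeo f x" using z[OF order_refl less_imp_le[OF xy]] unfolding F_def by auto
    then obtain e where e: "\<And>s. push f (At s x) (s = e) (f x)" unfolding locally_homeo_def by blast
    have "P e x" unfolding P_def
      using near_push[OF e near_beyond] by blast
    have "P e w" if w: "x \<le> w" "w \<le> y" for w
    proof (rule definable_connected[OF dP \<open>P e x\<close> w(1)])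
      show "near (At True z) (P e)" if "x \<le> z" "z < w" "P e z" for z
        using P[of z True e] that w by (auto elim: near_mono)
      show "P e z" if "x < z" "z \<le> w" "near (At False z) (P e)" for z
        using near_ex[OF near_conj[OF that(3) P[OF less_imp_le[OF that(1)] order_trans[OF that(2) w(2)]]]]
        by auto
    qed
    then have "lt e (f x) (f y)" using xy unfolding P_def by (intro locally_monotone[OF f]) auto
    then show ?thesis by auto
  qed
  ultimately show ?thesis by (rule that)
qed

text \<open>An infinite fibre contains an interval. Following it to the left, either the value
  persists to minus infinity or the constancy ends at a point of \<open>?E\<close>. There are
  finitely many such ends, because points to the right of one are locally constant, and each end
  determines its value.\<close>

lemma finite_infinite_fibres:
  assumes f: "dfun1 \<R> f" shows "finite {v. infinite {y. f y = v}}"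
proof -
  let ?E = "\<lambda>y. \<not> locally_constant f y \<and> (\<exists>v. near (At True y) (\<lambda>z. f z = v))"
  have dE: "dpred1 \<R> ?E" by (intro dp dterm_fun[OF f] dpred_app1[OF dpred_locally_constant[OF f]])
  have "finite {y. ?E y}"
  proof (rule ccontr)
    assume "infinite {y. ?E y}"
    from infinite_interval[OF dE this] obtain p q where pq: "p < q" "\<And>y. p < y \<Longrightarrow> y < q \<Longrightarrow> ?E y"
      by metis
    obtain y where y: "p < y" "y < q" using dense pq by blast
    then obtain v where v: "near (At True y) (\<lambda>z. f z = v)" using pq by blast
    have "near (At True y) (\<lambda>z. lt True y z \<and> lt True z q)" using y by (intro near_between) simp
    from near_ex[OF near_conj[OF near_conj[OF v near_near[OF v]] this]]
    obtain z where "\<forall>s. near (At s z) (\<lambda>z. f z = v)" "f z = v" "y < z" "z < q" by auto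
    moreover have "p < z" using y(1) \<open>y < z\<close> by (rule less_trans)
    ultimately show False using pq(2)[of z] unfolding locally_constant_def by auto
  qed
  moreover have sub: "{v. infinite {y. f y = v}} \<subseteq> {v. near (Inf False) (\<lambda>z. f z = v)} \<union>
      (\<Union>y\<in>{y. ?E y}. {v. near (At True y) (\<lambda>z. f z = v)})"
  proof
    fix v assume "v \<in> {v. infinite {y. f y = v}}"
    then have inf: "infinite {y. f y = v}" by simp
    have "dpred1 \<R> (\<lambda>y. f y = v)" by (intro dp dterm_fun[OF f])
    from infinite_interval[OF this inf] obtain a b
      where ab: "a < b" "\<And>x. a < x \<Longrightarrow> x < b \<Longrightarrow> f x = v" by metis
    obtain x where x: "a < x" "x < b" using dense ab by blast
    let ?N = "\<lambda>z. z < x \<and> f z \<noteq> v"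
    show "v \<in> {v. near (Inf False) (\<lambda>z. f z = v)} \<union> (\<Union>y\<in>{y. ?E y}. {v. near (At True y) (\<lambda>z. f z = v)})"
    proof (cases "\<exists>z. ?N z")
      case False
      then have "near (Inf False) (\<lambda>z. f z = v)" by (auto simp: near.simps)
      then show ?thesis by blast
    next
      case True
      then obtain z0 where z0: "?N z0" by blast
      have dN: "dpred1 \<R> ?N" by (intro dp dterm_fun[OF f])
      have Na: "z \<le> a" if "?N z" for z using ab(2)[of z] that x by (meson not_le less_trans)
      then have "lt True z x" if "?N z" for z using that by auto
      from definable_lub[OF dN z0 this] obtain d
        where d: "\<And>z. ?N z \<Longrightarrow> z \<le> d" "\<And>w. w < d \<Longrightarrow> \<exists>z. ?N z \<and> w < z"
        unfolding lt_simps le_simps by metis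
      have "d \<le> a" using d(2)[of a] Na by (meson not_le)
      then have dx: "d < x" using x by simp
      have "f z = v" if "d < z" "z < x" for z using d(1)[of z] that by (meson not_le)
      then have r: "near (At True d) (\<lambda>z. f z = v)" using dx by (auto simp: near.simps)
      have "\<not> locally_constant f d"
      proof
        assume lc: "locally_constant f d"
        then have "near (At True d) (\<lambda>z. f z = f d)" unfolding locally_constant_def by blast
        from near_ex[OF near_conj[OF r this]] have "f d = v" by auto
        then have "near (At False d) (\<lambda>z. f z = v)" using lc unfolding locally_constant_def by blast
        then obtain w where w: "w < d" "\<And>z. w < z \<Longrightarrow> z < d \<Longrightarrow> f z = v" by (auto simp: near.simps)
        obtain z where z: "?N z" "w < z" using d(2)[OF w(1)] by blast
        then have "z < d" using d(1)[OF z(1)] \<open>f d = v\<close> by (metis le_less)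
        then show False using w(2) z by blast
      qed
      with r show ?thesis by blast
    qed
  qed
  moreover have "finite {v. near g (\<lambda>z. f z = v)}" for g
  proof (cases "\<exists>v. near g (\<lambda>z. f z = v)")
    case True
    then obtain v where v: "near g (\<lambda>z. f z = v)" by blast
    have "v' = v" if "near g (\<lambda>z. f z = v')" for v' using near_ex[OF near_conj[OF v that]] by blast
    then have "{v. near g (\<lambda>z. f z = v)} \<subseteq> {v}" by blast
    then show ?thesis by (rule finite_subset) simp
  qed simp
  ultimately show ?thesis by (meson finite_UN_I finite_Un finite_subset)
qed

end

section \<open>Convergence of germs in a definable topology on the line\<close>

lemma dpred_le_dir [dp]:
  "dterm \<R> \<sigma> \<Longrightarrow> dterm \<R> \<tau> \<Longrightarrow> dpred \<R> (\<lambda>e. le s (\<sigma> e) (\<tau> e))"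
  by (cases s) (simp_all add: dp)

lemma dpred_notin_finite:
  assumes "finite A" "dterm \<R> \<tau>" shows "dpred \<R> (\<lambda>e. \<tau> e \<notin> A)"
proof -
  have "dpred \<R> (\<lambda>e. \<forall>a\<in>A. \<tau> e \<noteq> a)" using assms by (intro dpred_all_finite dp)
  moreover have "(\<forall>a\<in>A. x \<noteq> a) \<longleftrightarrow> x \<notin> A" for x by blast
  ultimately show ?thesis by simp
qed

lemma near_infinite: "near g P \<Longrightarrow> infinite {z. P z}"
  using near_notin_finite[of "{z. P z}" g] near_not_both[of g P] by auto

text \<open>
  A regular Hausdorff definable topology on \<open>X\<close> with basis \<open>B\<close>; the last two assumptions are the
  only consequences of the definability of the family \<open>B\<close> that are needed.
\<close>

locale def_space = omin \<R> for \<R> :: "('a::unbounded_dense_linorder, 'f, 'r) fo_structure" +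
  fixes X :: "'a set" and I :: "'i set" and B :: "'i \<Rightarrow> 'a set"
  assumes dpred_X: "dpred1 \<R> (\<lambda>x. x \<in> X)"
    and dpred_B: "u \<in> I \<Longrightarrow> dpred1 \<R> (\<lambda>x. x \<in> B u)"
    and B_subset: "u \<in> I \<Longrightarrow> B u \<subseteq> X"
    and B_cover: "x \<in> X \<Longrightarrow> \<exists>u\<in>I. x \<in> B u"
    and B_inter: "u \<in> I \<Longrightarrow> v \<in> I \<Longrightarrow> x \<in> B u \<Longrightarrow> x \<in> B v \<Longrightarrow> \<exists>w\<in>I. x \<in> B w \<and> B w \<subseteq> B u \<inter> B v"
    and hausdorff: "x \<in> X \<Longrightarrow> y \<in> X \<Longrightarrow> x \<noteq> y \<Longrightarrow> \<exists>u\<in>I. \<exists>v\<in>I. x \<in> B u \<and> y \<in> B v \<and> B u \<inter> B v = {}"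
    and regular: "u \<in> I \<Longrightarrow> x \<in> B u \<Longrightarrow>
      \<exists>v\<in>I. x \<in> B v \<and> (\<forall>z\<in>X - B u. \<exists>w\<in>I. z \<in> B w \<and> B w \<inter> B v = {})"
    and dpred_conv: "dpred2 \<R> (\<lambda>y x. \<forall>u\<in>I. x \<in> B u \<longrightarrow> near (At s y) (\<lambda>z. z \<in> B u))"
    and dpred_lower: "dpred1 \<R> A \<Longrightarrow> dpred1 \<R> (\<lambda>y. \<exists>u\<in>I. x \<in> B u \<and> (\<forall>z. z \<in> B u \<and> \<not> A z \<longrightarrow> y < z))"
begin

definition conv :: "'a germ \<Rightarrow> 'a \<Rightarrow> bool" where
  "conv g x \<longleftrightarrow> x \<in> X \<and> (\<forall>u\<in>I. x \<in> B u \<longrightarrow> near g (\<lambda>z. z \<in> B u))"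

lemma dpred2_conv: "dpred2 \<R> (\<lambda>y x. conv (At s y) x)"
proof -
  have "dpred \<R> (\<lambda>e. e (Suc 0) \<in> X)"
    by (rule dpred_app1[where Q = "\<lambda>x. x \<in> X", OF dpred_X dterm_var])
  from dpred_conj[OF this dpred_conv[of s]] show ?thesis unfolding conv_def .
qed

lemma dpred_conv_at: "dterm \<R> \<sigma> \<Longrightarrow> dterm \<R> \<tau> \<Longrightarrow> dpred \<R> (\<lambda>e. conv (At s (\<sigma> e)) (\<tau> e))"
  by (rule dpred_app2[OF dpred2_conv])

lemma conv_near: "conv g x \<Longrightarrow> u \<in> I \<Longrightarrow> x \<in> B u \<Longrightarrow> near g (\<lambda>z. z \<in> B u)"
  unfolding conv_def by blast

lemma conv_X: "conv g x \<Longrightarrow> x \<in> X"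
  unfolding conv_def by blast

lemma conv_near_X:
  assumes "conv g x" shows "near g (\<lambda>z. z \<in> X)"
proof -
  obtain u where u: "u \<in> I" "x \<in> B u" using B_cover[OF conv_X[OF assms]] by blast
  from conv_near[OF assms u] show ?thesis by (rule near_mono) (use B_subset u in blast)
qed

lemma conv_unique:
  assumes "conv g x" "conv g y" shows "x = y"
proof (rule ccontr)
  assume "x \<noteq> y"
  then obtain u v where uv: "u \<in> I" "v \<in> I" "x \<in> B u" "y \<in> B v" "B u \<inter> B v = {}"
    using hausdorff conv_X assms by blast
  from near_ex[OF near_conj[OF conv_near[OF assms(1) uv(1,3)] conv_near[OF assms(2) uv(2,4)]]] uv(5)
  show False by blast
qed

text \<open>The topology is determined, on definable sets, by the convergence of germs.\<close>

lemma definable_nbhd: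
  assumes A: "dpred1 \<R> A" and x: "x \<in> X" "A x" and g: "\<And>g. conv g x \<Longrightarrow> near g A"
  shows "\<exists>u\<in>I. x \<in> B u \<and> (\<forall>z\<in>B u. A z)"
proof (rule ccontr)
  assume no: "\<not> ?thesis"
  let ?J = "{u \<in> I. x \<in> B u}"
  \<comment> \<open>The parts of the basic neighbourhoods outside \<open>A\<close>. A common point
    contradicts the Hausdorff property, and a common germ would converge to \<open>x\<close> while
    avoiding \<open>A\<close>.\<close>
  let ?S = "\<lambda>u z. z \<in> B u \<and> \<not> A z"
  have "(\<exists>y. \<forall>u\<in>?J. ?S u y) \<or> (\<exists>g. \<forall>u\<in>?J. near g (?S u))"
  proof (rule directed_family)
    show "?J \<noteq> {}" using B_cover[OF x(1)] by blast
    show "dpred1 \<R> (?S u)" if "u \<in> ?J" for u using that by (intro dp dpred_B A) simp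
    show "\<exists>z. ?S u z" if "u \<in> ?J" for u using that no by blast
    show "\<exists>w\<in>?J. \<forall>z. ?S w z \<longrightarrow> ?S u z \<and> ?S v z" if "u \<in> ?J" "v \<in> ?J" for u v
      using that B_inter[of u v x] by blast
    show "dpred1 \<R> (\<lambda>y. \<exists>u\<in>?J. \<forall>z. ?S u z \<longrightarrow> y < z)"
      using dpred_lower[OF A, of x] by (simp add: conj_ac Bex_def)
  qed
  then show False
  proof (elim disjE exE)
    fix y assume y: "\<forall>u\<in>?J. ?S u y"
    obtain u0 where "u0 \<in> I" "x \<in> B u0" using B_cover[OF x(1)] by blast
    then have "y \<in> X" "y \<noteq> x" using y B_subset x by blast+
    then obtain u v where "u \<in> I" "v \<in> I" "x \<in> B u" "y \<in> B v" "B u \<inter> B v = {}"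
      using hausdorff x by metis
    then show False using y by blast
  next
    fix g assume g': "\<forall>u\<in>?J. near g (?S u)"
    have "conv g x" unfolding conv_def
    proof (intro conjI x(1) ballI impI)
      fix u assume "u \<in> I" "x \<in> B u"
      then have "near g (?S u)" using g' by blast
      then show "near g (\<lambda>z. z \<in> B u)" by (rule near_mono) blast
    qed
    then have "near g A" by (rule g)
    obtain u where "u \<in> ?J" using B_cover[OF x(1)] by blast
    then have "near g (?S u)" using g' by blast
    from near_ex[OF near_conj[OF this \<open>near g A\<close>]] show False by blast
  qed
qed

text \<open>
  Regularity gives the implication from left to right: a closed neighbourhood of \<open>v\<close> on which the
  germ holds contains the limits of all germs at nearby points.
\<close>

lemma conv_push:
  assumes f: "push f (At s y) r w"
    and sel: "near (At s y) (\<lambda>z. \<exists>q. conv (At q z) (f z))"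
  shows "conv (At s y) v \<longleftrightarrow> conv (At r w) v"
proof
  assume v: "conv (At s y) v"
  show "conv (At r w) v" unfolding conv_def
  proof (intro conjI ballI impI)
    show "v \<in> X" using v by (rule conv_X)
    fix u assume u: "u \<in> I" "v \<in> B u"
    obtain u' where u': "u' \<in> I" "v \<in> B u'"
      "\<And>z. z \<in> X \<Longrightarrow> z \<notin> B u \<Longrightarrow> \<exists>w\<in>I. z \<in> B w \<and> B w \<inter> B u' = {}"
      using regular[OF u] by blast
    from near_conj[OF sel near_near[OF conv_near[OF v u'(1,2)]]]
    have "near (At s y) (\<lambda>z. f z \<in> B u)"
    proof (rule near_mono)
      fix z assume z: "(\<exists>q. conv (At q z) (f z)) \<and> (\<forall>r. near (At r z) (\<lambda>z. z \<in> B u'))"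
      then obtain q where q: "conv (At q z) (f z)" by blast
      show "f z \<in> B u"
      proof (rule ccontr)
        assume "f z \<notin> B u"
        then obtain w where w: "w \<in> I" "f z \<in> B w" "B w \<inter> B u' = {}" using u'(3) conv_X[OF q] by blast
        from z have "near (At q z) (\<lambda>z. z \<in> B u')" by blast
        from near_ex[OF near_conj[OF this conv_near[OF q w(1,2)]]] w(3) show False by blast
      qed
    qed
    then show "near (At r w) (\<lambda>z. z \<in> B u)" by (rule push_near[OF dpred_B[OF u(1)] f])
  qed
next
  assume v: "conv (At r w) v"
  show "conv (At s y) v" unfolding conv_def
  proof (intro conjI ballI impI)
    show "v \<in> X" using v by (rule conv_X)
    fix u assume u: "u \<in> I" "v \<in> B u"
    \<comment> \<open>This direction uses that \<open>B u\<close> is open: close to \<open>y\<close>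
      it contains \<open>f z\<close>, the limit of a germ at \<open>z\<close>, hence also that germ.
      By the dichotomy for definable sets the germ at \<open>y\<close> cannot then avoid
      \<open>B u\<close>.\<close>
    have fu: "near (At s y) (\<lambda>z. f z \<in> B u)" by (rule near_push[OF f conv_near[OF v u]])
    show "near (At s y) (\<lambda>z. z \<in> B u)"
    proof (rule ccontr)
      assume "\<not> ?thesis"
      then have "near (At s y) (\<lambda>z. z \<notin> B u)" unfolding not_near[OF dpred_B[OF u(1)]] .
      from near_ex[OF near_conj[OF near_conj[OF fu sel] near_near[OF this]]]
      obtain z q where z: "f z \<in> B u" "conv (At q z) (f z)" "\<And>q. near (At q z) (\<lambda>z. z \<notin> B u)" by blast
      from near_ex[OF near_conj[OF conv_near[OF z(2) u(1) z(1)] z(3)]] show False by blast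
    qed
  qed
qed

section \<open>Limits of the germs at a point and their selectors\<close>

definition lims :: "'a set \<Rightarrow> 'a \<Rightarrow> 'a set" where
  "lims C y = {v. v \<notin> C \<and> (\<exists>s. conv (At s y) v)}"

text \<open>
  At a generic point \<open>y\<close> all limits of germs at \<open>y\<close> have the same limits as \<open>y\<close> itself, so that the
  least limit is a canonical representative of the finite class of \<open>y\<close>.
\<close>

definition sel :: "bool \<Rightarrow> 'a set \<Rightarrow> 'a \<Rightarrow> 'a" where
  "sel e C y = (if lims C y = {} then y else (THE v. v \<in> lims C y \<and> (\<forall>w\<in>lims C y. le e v w)))"

lemma lims_two: "v \<in> lims C y \<Longrightarrow> w \<in> lims C y \<Longrightarrow> v \<noteq> w \<Longrightarrow> x \<in> lims C y \<Longrightarrow> x = v \<or> x = w"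
proof -
  assume "v \<in> lims C y" "w \<in> lims C y" "v \<noteq> w" "x \<in> lims C y"
  then obtain a b c where *: "conv (At a y) v" "conv (At b y) w" "conv (At c y) x" "v \<noteq> w"
    unfolding lims_def by blast
  then have "a \<noteq> b" using conv_unique by blast
  then have "c = a \<or> c = b" by auto
  then show ?thesis using * conv_unique by blast
qed

lemma sel_props:
  assumes "lims C y \<noteq> {}"
  shows "sel e C y \<in> lims C y \<and> (\<forall>w\<in>lims C y. le e (sel e C y) w)"
proof -
  have "\<exists>v. v \<in> lims C y \<and> (\<forall>w\<in>lims C y. le e v w)"
  proof -
    obtain v where v: "v \<in> lims C y" using assms by blast
    show ?thesis
    proof (cases "\<forall>w\<in>lims C y. le e v w")
      case False
      then obtain w where w: "w \<in> lims C y" "lt e w v" by (auto simp: dir.not_le)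
      have "le e w x" if "x \<in> lims C y" for x
        using lims_two[OF v w(1) _ that] w(2) dir.less_imp_le by auto
      then show ?thesis using w by blast
    qed (use v in blast)
  qed
  then obtain v where v: "v \<in> lims C y" "\<And>w. w \<in> lims C y \<Longrightarrow> le e v w" by blast
  have "(THE v. v \<in> lims C y \<and> (\<forall>w\<in>lims C y. le e v w)) = v"
    by (rule the_equality) (use v dir.order_antisym in blast)+
  then show ?thesis using v assms unfolding sel_def by simp
qed

lemma sel_empty: "lims C y = {} \<Longrightarrow> sel e C y = y"
  unfolding sel_def by simp

lemma sel_eq: "sel e C y = v \<longleftrightarrow>
    (lims C y = {} \<and> v = y) \<or> (v \<in> lims C y \<and> (\<forall>w. w \<in> lims C y \<longrightarrow> le e v w))"
  using sel_props[of C y e] sel_empty[of C y e] dir.order_antisym by (cases "lims C y = {}") auto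

text \<open>There are at most two limits, one for each germ, so the least and the greatest are all
  of them.\<close>

lemma lims_sel: "v \<in> lims C y \<Longrightarrow> \<exists>e. v = sel e C y"
proof -
  assume v: "v \<in> lims C y"
  then have "lims C y \<noteq> {}" by blast
  from sel_props[OF this, of True] sel_props[OF this, of False] v
  have *: "sel True C y \<in> lims C y" "sel False C y \<in> lims C y" "sel True C y \<le> v" "v \<le> sel False C y"
    by auto
  then show ?thesis using lims_two[OF *(1,2) _ v] by (metis order_antisym)
qed

lemma sel_cong: "lims C y = lims C z \<Longrightarrow> lims C y \<noteq> {} \<Longrightarrow> sel e C y = sel e C z"
  unfolding sel_def by simp

lemma dpred_lims:
  assumes "finite C" "dterm \<R> \<sigma>" "dterm \<R> \<tau>" shows "dpred \<R> (\<lambda>e. \<sigma> e \<in> lims C (\<tau> e))"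
  unfolding lims_def mem_Collect_eq
  by (intro dp dpred_notin_finite dpred_conv_at assms)

lemma dpred_lims_empty:
  assumes "finite C" shows "dpred1 \<R> (\<lambda>y. lims C y = {})"
proof -
  have "dpred1 \<R> (\<lambda>y. \<not> (\<exists>v. v \<in> lims C y))" by (intro dp dpred_lims assms)
  then show ?thesis by (simp add: ex_in_conv)
qed

lemma dfun_sel: "finite C \<Longrightarrow> dfun1 \<R> (sel e C)"
  unfolding sel_eq
  by (intro dp dpred_lims dpred_app1[where Q = "\<lambda>y. lims C y = {}", OF dpred_lims_empty])

text \<open>The values that are excluded from all later limit sets. Every remaining value is a limit
  at finitely many points and at neither infinity, which keeps the selectors from being constant on
  intervals.\<close>

definition cluster :: "'a set" where
  "cluster = {v. infinite {y. v \<in> lims {} y}} \<union> {v. \<exists>s. conv (Inf s) v}"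

text \<open>By \<open>lims_sel\<close>, a value that is a limit at infinitely many points has an
  infinite fibre under one of the two selectors.\<close>

lemma finite_cluster: "finite cluster"
proof -
  have "{v. infinite {y. v \<in> lims {} y}} \<subseteq> (\<Union>e. {v. infinite {y. sel e {} y = v}})"
  proof
    fix v assume "v \<in> {v. infinite {y. v \<in> lims {} y}}"
    then have "infinite {y. v \<in> lims {} y}" by simp
    moreover have "{y. v \<in> lims {} y} \<subseteq> (\<Union>e. {y. sel e {} y = v})" using lims_sel by blast
    ultimately have "infinite (\<Union>e. {y. sel e {} y = v})" by (rule contrapos_nn[OF _ finite_subset])
    then show "v \<in> (\<Union>e. {v. infinite {y. sel e {} y = v}})" by auto
  qed
  moreover have "finite (\<Union>e. {v. infinite {y. sel e {} y = v}})"
    by (intro finite_UN_I finite finite_infinite_fibres dfun_sel) simp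
  moreover have "finite {v. conv (Inf s) v}" for s
  proof (cases "\<exists>v. conv (Inf s) v")
    case True
    then obtain v where "conv (Inf s) v" by blast
    then have "{v. conv (Inf s) v} \<subseteq> {v}" using conv_unique by blast
    then show ?thesis by (rule finite_subset) simp
  qed simp
  then have "finite {v. \<exists>s. conv (Inf s) v}" by (simp add: Collect_ex_eq)
  ultimately show ?thesis unfolding cluster_def using finite_subset by blast
qed

abbreviation "limits \<equiv> lims cluster"
abbreviation "select e \<equiv> sel e cluster"
abbreviation "base \<equiv> select True"

lemmas dfun_select = dfun_sel[OF finite_cluster]

lemma finite_limit_points: "finite {y. v \<in> limits y}"
proof (cases "v \<in> cluster")
  case True
  then show ?thesis unfolding lims_def by simp
next
  case False
  then have "finite {y. v \<in> lims {} y}" unfolding cluster_def by blast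
  moreover have "{y. v \<in> limits y} \<subseteq> {y. v \<in> lims {} y}" unfolding lims_def by blast
  ultimately show ?thesis by (rule finite_subset[rotated])
qed

text \<open>Along a germ the selector is either the identity or picks actual limits. In the second
  case a constant value would be a limit at infinitely many points and so belong to
  \<open>cluster\<close>.\<close>

lemma select_not_const: "\<not> near g (\<lambda>z. select e z = v)"
proof
  assume n: "near g (\<lambda>z. select e z = v)"
  from near_ultra[OF dpred_lims_empty[OF finite_cluster], of g] show False
  proof
    assume "near g (\<lambda>z. limits z = {})"
    from near_ex[OF near_conj[OF near_conj[OF this n] near_ne'[of _ v]]]
    show False using sel_empty by metis
  next
    assume "near g (\<lambda>z. limits z \<noteq> {})"
    from near_conj[OF this n] have "near g (\<lambda>z. v \<in> limits z)"
      by (rule near_mono) (use sel_props in blast)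
    from near_infinite[OF this] show False using finite_limit_points by blast
  qed
qed

lemma select_not_locally_constant: "\<not> locally_constant (select e) y"
  unfolding locally_constant_def using select_not_const by blast

lemma finite_select_fibre: "finite {y. select e y = v}"
proof (rule ccontr)
  assume inf: "infinite {y. select e y = v}"
  have "dpred1 \<R> (\<lambda>y. select e y = v)" by (intro dp dterm_fun[OF dfun_select])
  from infinite_interval[OF this inf] obtain a b where ab: "a < b" "\<And>x. a < x \<Longrightarrow> x < b \<Longrightarrow> select e x = v"
    by metis
  have "near (At True a) (\<lambda>z. select e z = v)"
    using near_between[of True a b] ab by (auto elim!: near_mono)
  then show False using select_not_const by blast
qed

section \<open>Two-sided points and generic points\<close>

definition two_sided :: "'a \<Rightarrow> bool" where
  "two_sided y \<longleftrightarrow> (\<exists>v. v \<notin> cluster \<and> (\<forall>s. conv (At s y) v))"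

lemma dpred_two_sided: "dpred1 \<R> two_sided"
  unfolding two_sided_def
  by (intro dp dpred_notin_finite[OF finite_cluster] dpred_conv_at)

definition constant_near :: "('a \<Rightarrow> bool) \<Rightarrow> 'a \<Rightarrow> bool" where
  "constant_near P y \<longleftrightarrow> (\<forall>s. near (At s y) (\<lambda>z. P z = P y))"

text \<open>Both selectors have to be local homeomorphisms, since each limit is a value of one of
  them. Injectivity is asked only of \<open>base\<close>, the one that labels classes.\<close>

definition generic :: "'a set \<Rightarrow> bool" where
  "generic F \<longleftrightarrow> finite F \<and> (\<forall>y e. y \<notin> F \<longrightarrow> locally_homeo (select e) y) \<and>
    (\<forall>y. y \<notin> F \<longrightarrow> constant_near (\<lambda>z. limits z = {}) y \<and> constant_near (\<lambda>z. z \<in> X) y \<and>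
      constant_near two_sided y) \<and>
    (\<forall>x y. x < y \<and> (\<forall>z. x \<le> z \<and> z \<le> y \<longrightarrow> z \<notin> F) \<longrightarrow> base x \<noteq> base y)"

lemma finite_constant_near: "dpred1 \<R> P \<Longrightarrow> finite {y. \<not> constant_near P y}"
  unfolding constant_near_def by (rule finite_boundary)

lemma generic_exists: "\<exists>F. generic F"
proof -
  have "\<exists>F. finite F \<and> (\<forall>y. y \<notin> F \<longrightarrow> locally_homeo (select e) y) \<and>
    (\<forall>x y. x < y \<and> (\<forall>z. x \<le> z \<and> z \<le> y \<longrightarrow> z \<notin> F) \<longrightarrow> select e x \<noteq> select e y)" for e
  proof (rule monotonicity[OF dfun_select[of e]])
    fix F assume F: "finite F" "\<And>y. y \<notin> F \<Longrightarrow> locally_constant (select e) y \<or> locally_homeo (select e) y"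
      "\<And>x y. x < y \<Longrightarrow> (\<And>z. x \<le> z \<Longrightarrow> z \<le> y \<Longrightarrow> z \<notin> F \<and> \<not> locally_constant (select e) z) \<Longrightarrow>
        select e x \<noteq> select e y"
    show ?thesis
    proof (intro exI[of _ F] conjI allI impI F(1))
      show "locally_homeo (select e) y" if "y \<notin> F" for y
        using F(2)[OF that] select_not_locally_constant by blast
      show "select e x \<noteq> select e y" if "x < y \<and> (\<forall>z. x \<le> z \<and> z \<le> y \<longrightarrow> z \<notin> F)" for x y
        by (rule F(3)) (use that select_not_locally_constant in blast)+
    qed
  qed
  then have "\<exists>F. \<forall>e. finite (F e) \<and> (\<forall>y. y \<notin> F e \<longrightarrow> locally_homeo (select e) y) \<and>
    (\<forall>x y. x < y \<and> (\<forall>z. x \<le> z \<and> z \<le> y \<longrightarrow> z \<notin> F e) \<longrightarrow> select e x \<noteq> select e y)"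
    by (intro choice allI)
  then obtain F where F': "\<forall>e. finite (F e) \<and> (\<forall>y. y \<notin> F e \<longrightarrow> locally_homeo (select e) y) \<and>
    (\<forall>x y. x < y \<and> (\<forall>z. x \<le> z \<and> z \<le> y \<longrightarrow> z \<notin> F e) \<longrightarrow> select e x \<noteq> select e y)" ..
  have F: "finite (F e)" "y \<notin> F e \<Longrightarrow> locally_homeo (select e) y"
    "x < y \<Longrightarrow> (\<forall>z. x \<le> z \<and> z \<le> y \<longrightarrow> z \<notin> F e) \<Longrightarrow> select e x \<noteq> select e y" for e x y
    using F'[rule_format, of e] by blast+
  define G where "G = F True \<union> F False \<union> {y. \<not> constant_near (\<lambda>z. limits z = {}) y} \<union>
    {y. \<not> constant_near (\<lambda>z. z \<in> X) y} \<union> {y. \<not> constant_near two_sided y}"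
  have "finite G" unfolding G_def
    by (intro finite_UnI F finite_constant_near dpred_lims_empty finite_cluster dpred_X dpred_two_sided)
  moreover have "locally_homeo (select e) y" if "y \<notin> G" for e y
    using F(2)[where e = e and y = y] that unfolding G_def by (cases e) auto
  moreover have "base x \<noteq> base y" if "x < y" "\<forall>z. x \<le> z \<and> z \<le> y \<longrightarrow> z \<notin> G" for x y
    using F(3)[OF that(1), where e = True] that(2) unfolding G_def by blast
  moreover have "constant_near (\<lambda>z. limits z = {}) y \<and> constant_near (\<lambda>z. z \<in> X) y \<and>
      constant_near two_sided y" if "y \<notin> G" for y
    using that unfolding G_def by blast
  ultimately show ?thesis unfolding generic_def by (intro exI[of _ G]) simp
qed

definition exc :: "'a set" where
  "exc = (SOME F. generic F)"

lemma generic_exc: "generic exc"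
  unfolding exc_def using generic_exists by (rule someI_ex)

lemma finite_exc: "finite exc"
  using generic_exc unfolding generic_def by blast

lemma generic_homeo: "y \<notin> exc \<Longrightarrow> locally_homeo (select e) y"
  using generic_exc unfolding generic_def by simp

lemma generic_limits: "y \<notin> exc \<Longrightarrow> near (At s y) (\<lambda>z. (limits z = {}) = (limits y = {}))"
  using generic_exc unfolding generic_def constant_near_def by simp

lemma generic_X: "y \<notin> exc \<Longrightarrow> near (At s y) (\<lambda>z. (z \<in> X) = (y \<in> X))"
  using generic_exc unfolding generic_def constant_near_def by simp

lemma generic_two_sided: "y \<notin> exc \<Longrightarrow> near (At s y) (\<lambda>z. two_sided z = two_sided y)"
  using generic_exc unfolding generic_def constant_near_def by simp

lemma generic_inj: "x < y \<Longrightarrow> (\<And>z. x \<le> z \<Longrightarrow> z \<le> y \<Longrightarrow> z \<notin> exc) \<Longrightarrow> base x \<noteq> base y"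
  using generic_exc unfolding generic_def by simp

text \<open>Where limits exist this is \<open>conv_push\<close>; where they do not, the selector is
  the identity near \<open>y\<close>. It allows germs at any point of a class to be replaced by
  germs at the base point, with \<open>d\<close> telling whether left and right are
  exchanged.\<close>

lemma select_conv:
  assumes y: "y \<notin> exc"
  shows "\<exists>d. \<forall>s. push (select e) (At s y) (s = d) (select e y) \<and>
    (\<forall>v. conv (At s y) v \<longleftrightarrow> conv (At (s = d) (select e y)) v)"
proof -
  obtain d where d: "\<And>s. push (select e) (At s y) (s = d) (select e y)"
    using generic_homeo[OF y] unfolding locally_homeo_def by blast
  have "conv (At s y) v \<longleftrightarrow> conv (At (s = d) (select e y)) v" for s v
  proof (cases "limits y = {}")
    case True
    have id: "near (At s y) (\<lambda>z. select e z = z)"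
      using generic_limits[OF y, of s] by (rule near_mono) (use True sel_empty in blast)
    have "near (At s y) (\<lambda>z. lt s y (select e z) \<and> lt s (select e z) t)" if "lt s y t" for t
      using near_conj[OF id near_between[OF that]] by (rule near_mono) simp
    then have "push (select e) (At s y) s y" unfolding push_def by blast
    then have "(s = d) = s" using push_unique[OF d] by blast
    then show ?thesis using sel_empty[OF True] by simp
  next
    case False
    have "near (At s y) (\<lambda>z. \<exists>q. conv (At q z) (select e z))"
      using generic_limits[OF y, of s]
      by (rule near_mono) (use False sel_props lims_def in blast)
    with d show ?thesis by (rule conv_push)
  qed
  with d show ?thesis by blast
qed

lemma limits_select: "y \<notin> exc \<Longrightarrow> limits (select e y) = limits y"
proof -
  assume "y \<notin> exc"
  from select_conv[OF this, of e] obtain d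
    where d: "\<And>s v. conv (At s y) v \<longleftrightarrow> conv (At (s = d) (select e y)) v" by blast
  have "(\<exists>s. conv (At s y) v) \<longleftrightarrow> (\<exists>s. conv (At s (select e y)) v)" for v
    unfolding d by (cases d) (simp_all add: ex_bool_eq disj_commute)
  then show ?thesis unfolding lims_def by blast
qed

lemma two_sided_base: "y \<notin> exc \<Longrightarrow> two_sided (base y) = two_sided y"
proof -
  assume "y \<notin> exc"
  from select_conv[OF this, of True] obtain d
    where d: "\<And>s v. conv (At s y) v \<longleftrightarrow> conv (At (s = d) (base y)) v" by blast
  have "(\<forall>s. conv (At s y) v) \<longleftrightarrow> (\<forall>s. conv (At s (base y)) v)" for v
    unfolding d by (cases d) (simp_all add: all_bool_eq conj_commute)
  then show ?thesis unfolding two_sided_def by blast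
qed

text \<open>Each limit is a selector value, and selectors preserve limit sets, so \<open>y\<close>
  and its limits share one label.\<close>

lemma base_limit:
  assumes "y \<notin> exc" "v \<in> limits y" shows "limits v = limits y" "base v = base y"
proof -
  obtain e where "v = select e y" using lims_sel[OF assms(2)] by blast
  then show 1: "limits v = limits y" using limits_select[OF assms(1)] by simp
  show "base v = base y" using sel_cong[OF 1] 1 assms(2) by blast
qed

lemma base_in_limits: "limits y \<noteq> {} \<Longrightarrow> base y \<in> limits y"
  using sel_props by blast

text \<open>
  The bad base points are removed together with their classes: germs at exceptional points and at
  infinity then do not interfere with the remaining points.
\<close>

definition bad :: "'a set" where
  "bad = base ` (exc \<union> cluster \<union> (\<Union>y\<in>exc. limits y)) \<union> {t. \<exists>s r. push base (Inf s) r t} \<union>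
     (\<Union>y\<in>exc. {t. \<exists>s r. push base (At s y) r t})"

lemma finite_bad: "finite bad"
proof -
  have *: "finite {t. \<exists>r. push f g r t}" for f and g :: "'a germ"
  proof (cases "\<exists>t. \<exists>r. push f g r t")
    case True
    then obtain t r where "push f g r t" by blast
    then have "{t. \<exists>r. push f g r t} \<subseteq> {t}" using push_unique by blast
    then show ?thesis by (rule finite_subset) simp
  qed simp
  have "finite {t. \<exists>s r. push f (G s) r t}" for f and G :: "bool \<Rightarrow> 'a germ"
    using *[of f "G True"] *[of f "G False"] by (simp add: ex_bool_eq Collect_disj_eq)
  moreover have "finite (limits y)" for y
  proof -
    have "limits y \<subseteq> (\<Union>e. {select e y})" using lims_sel by blast
    then show ?thesis by (rule finite_subset) simp
  qed
  ultimately show ?thesis unfolding bad_def using finite_exc finite_cluster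
    by (intro finite_UnI finite_imageI finite_UN_I) auto
qed

section \<open>Good points and the germs converging to them\<close>

definition good :: "'a set" where
  "good = {x \<in> X. x \<notin> cluster \<and> x \<notin> exc \<and> base x \<notin> bad}"

lemma good_props: "x \<in> good \<Longrightarrow> x \<in> X \<and> x \<notin> cluster \<and> x \<notin> exc \<and> base x \<notin> bad"
  unfolding good_def by blast

lemma finite_not_good: "finite (X - good)"
proof -
  have "X - good \<subseteq> cluster \<union> exc \<union> (\<Union>t\<in>bad. {x. base x = t})" unfolding good_def by blast
  moreover have "finite (cluster \<union> exc \<union> (\<Union>t\<in>bad. {x. base x = t}))"
    by (intro finite_UnI finite_UN_I finite_cluster finite_exc finite_bad finite_select_fibre)
  ultimately show ?thesis by (rule finite_subset)
qed

lemma dpred_good: "dpred1 \<R> (\<lambda>x. x \<in> good)"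
proof -
  have "dpred1 \<R> (\<lambda>x. x \<in> X \<and> x \<notin> X - good)"
    by (intro dp dpred_X dpred_notin_finite finite_not_good)
  moreover have "(x \<in> X \<and> x \<notin> X - good) = (x \<in> good)" for x using good_def by blast
  ultimately show ?thesis by simp
qed

lemma near_good: "y \<in> good \<Longrightarrow> near (At s y) (\<lambda>z. z \<in> good)"
proof -
  assume "y \<in> good"
  then have y: "y \<in> X" "y \<notin> exc" using good_props by blast+
  from near_conj[OF generic_X[OF y(2)] near_notin_finite[OF finite_not_good]]
  show ?thesis by (rule near_mono) (use y in blast)
qed

text \<open>What the removals achieve: a germ converging to a good point can sit neither at
  infinity, by \<open>cluster\<close>, nor at an exceptional point, by \<open>bad\<close>. At a
  generic point \<open>select_conv\<close> carries it to the base point.\<close>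

lemma good_conv:
  assumes x: "x \<in> good" and g: "conv g x"
  obtains s y r where "g = At s y" "y \<in> good" "base y = base x" "push base (At s y) r (base x)"
    "conv (At r (base x)) x"
proof (cases g)
  case (Inf s)
  then show ?thesis using g good_props[OF x] unfolding cluster_def by blast
next
  case (At s y)
  have xl: "x \<in> limits y" using g good_props[OF x] unfolding At lims_def by blast
  have "y \<notin> exc"
  proof
    assume "y \<in> exc"
    then have "base x \<in> bad" using xl unfolding bad_def by blast
    then show False using good_props[OF x] by blast
  qed
  have b: "base x = base y" using base_limit(2)[OF \<open>y \<notin> exc\<close> xl] .
  then have "base y \<notin> bad" using good_props[OF x] by simp
  then have "y \<notin> cluster" unfolding bad_def by blast
  have "near (At s y) (\<lambda>z. z \<in> X)" using conv_near_X[OF g] unfolding At .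
  from near_ex[OF near_conj[OF this generic_X[OF \<open>y \<notin> exc\<close>]]] have "y \<in> X" by blast
  have "y \<in> good" unfolding good_def
    using \<open>y \<in> X\<close> \<open>y \<notin> cluster\<close> \<open>y \<notin> exc\<close> \<open>base y \<notin> bad\<close> by blast
  moreover obtain d where "push base (At s y) (s = d) (base y)"
    "conv (At s y) x \<longleftrightarrow> conv (At (s = d) (base y)) x" using select_conv[OF \<open>y \<notin> exc\<close>] by blast
  ultimately show ?thesis using that[of s y "s = d"] At b g by simp
qed

lemma good_conv_two_sided:
  assumes x: "x \<in> good" and g: "conv g x" shows "near g (\<lambda>z. z \<in> good \<and> two_sided z = two_sided x)"
proof -
  obtain s y where y: "g = At s y" "y \<in> good" "base y = base x" using good_conv[OF x g] by metis
  have "two_sided y = two_sided x"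
    using two_sided_base[of y] two_sided_base[of x] y good_props[OF x] good_props[OF y(2)] by simp
  then show ?thesis
    using near_conj[OF near_good[OF y(2), of s] generic_two_sided[of y s]] y good_props[OF y(2)] by simp
qed

text \<open>The converse transport. If no interval at the base point worked,
  \<open>directed_family\<close> would give a germ outside \<open>A\<close> that \<open>base\<close>
  pushes to the side \<open>s\<close> of \<open>base x\<close>; by \<open>select_conv\<close> it
  would converge to \<open>x\<close>, although such germs lie in \<open>A\<close>.\<close>

lemma good_nbhd:
  assumes x: "x \<in> good" and t: "conv (At s (base x)) x" and A: "dpred1 \<R> A"
    and nbhd: "\<And>g. conv g x \<Longrightarrow> near g A"
  shows "\<exists>t. lt s (base x) t \<and> (\<forall>z\<in>good. lt s (base x) (base z) \<and> lt s (base z) t \<longrightarrow> A z)"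
proof (rule ccontr)
  assume no: "\<not> ?thesis"
  let ?J = "{t. lt s (base x) t}"
  let ?S = "\<lambda>t z. z \<in> good \<and> lt s (base x) (base z) \<and> lt s (base z) t \<and> \<not> A z"
  note df = dterm_fun[OF dfun_select]
  have "(\<exists>y. \<forall>t\<in>?J. ?S t y) \<or> (\<exists>g. \<forall>t\<in>?J. near g (?S t))"
  proof (rule directed_family)
    show "?J \<noteq> {}" using dir.gt_ex by blast
    show "dpred1 \<R> (?S u)" if "u \<in> ?J" for u by (intro dp dpred_good A df)
    show "\<exists>z. ?S u z" if "u \<in> ?J" for u using that no by blast
    show "\<exists>w\<in>?J. \<forall>z. ?S w z \<longrightarrow> ?S u z \<and> ?S v z" if "u \<in> ?J" "v \<in> ?J" for u v
    proof (cases "lt s u v")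
      case True
      then show ?thesis using that dir.less_trans by blast
    next
      case False
      then have "le s v u" by (simp add: dir.not_less)
      then show ?thesis using that dir.less_le_trans by blast
    qed
    have "dpred1 \<R> (\<lambda>y. \<exists>t. lt s (base x) t \<and> (\<forall>z. ?S t z \<longrightarrow> y < z))"
      by (intro dp df dpred_app1[where Q = "\<lambda>x. x \<in> good", OF dpred_good] dpred_app1[OF A])
    then show "dpred1 \<R> (\<lambda>y. \<exists>t\<in>?J. \<forall>z. ?S t z \<longrightarrow> y < z)" by (simp add: Bex_def)
  qed
  then show False
  proof (elim disjE exE)
    \<comment> \<open>For a common point \<open>y\<close> one may take \<open>t = base y\<close>,
      and then \<open>base y\<close> is not before \<open>t\<close>.\<close>
    fix y assume y: "\<forall>t\<in>?J. ?S t y"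
    obtain t where "t \<in> ?J" using dir.gt_ex by blast
    then have "base y \<in> ?J" using y by blast
    then show False using y by blast
  next
    fix g assume g: "\<forall>t\<in>?J. near g (?S t)"
    have pg: "push base g s (base x)" unfolding push_def
    proof (intro allI impI)
      fix t assume "lt s (base x) t"
      then have "near g (?S t)" using g by blast
      then show "near g (\<lambda>z. lt s (base x) (base z) \<and> lt s (base z) t)" by (rule near_mono) blast
    qed
    have nb: "base x \<notin> bad" using good_props[OF x] by blast
    \<comment> \<open>Base values to which a germ at infinity or at an exceptional point is pushed
      were put into \<open>bad\<close> for this purpose.\<close>
    obtain r y where gy: "g = At r y" using pg nb unfolding bad_def by (cases g) blast+
    have y: "y \<notin> exc" using pg nb unfolding gy bad_def by blast
    obtain d where d: "push base (At r y) (r = d) (base y)"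
      "conv (At r y) x \<longleftrightarrow> conv (At (r = d) (base y)) x" using select_conv[OF y] by blast
    have "(r = d) = s" "base y = base x" using push_unique[OF d(1) pg[unfolded gy]] by blast+
    then have "conv g x" using d(2) t gy by simp
    then have "near g A" by (rule nbhd)
    obtain t where "t \<in> ?J" using dir.gt_ex by blast
    then have "near g (?S t)" using g by blast
    from near_ex[OF near_conj[OF this \<open>near g A\<close>]] show False by blast
  qed
qed

lemma two_sided_limit:
  assumes "x \<in> good" "two_sided x" shows "conv (At s (base x)) (base x)" "limits x = {base x}"
proof -
  have x: "x \<notin> exc" using good_props[OF assms(1)] by blast
  obtain v where v: "v \<notin> cluster" "\<And>s. conv (At s x) v" using assms(2) unfolding two_sided_def by blast
  then have l: "limits x = {v}" unfolding lims_def using conv_unique by blast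
  then have b: "base x = v" using base_in_limits[of x] by blast
  then show "limits x = {base x}" using l by simp
  obtain d where "\<And>s. conv (At s x) v \<longleftrightarrow> conv (At (s = d) (base x)) v" using select_conv[OF x] by blast
  from this[of "s = d"] v show "conv (At s (base x)) (base x)" using b by (cases d) auto
qed

end

section \<open>The two embeddings\<close>

abbreviation points :: "'a set \<Rightarrow> 'a list set" where
  "points A \<equiv> (\<lambda>x. [x]) ` A"

lemma embedding_map_pointwise:
  assumes f: "continuous_map S T f" "inj_on f (topspace S)"
    and nbhd: "\<And>U x. openin S U \<Longrightarrow> x \<in> U \<Longrightarrow>
      \<exists>V. openin T V \<and> f x \<in> V \<and> (\<forall>z\<in>topspace S. f z \<in> V \<longrightarrow> z \<in> U)"
  shows "embedding_map S T f"
  unfolding embedding_map_def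
proof (rule bijective_open_imp_homeomorphic_map)
  show "continuous_map S (subtopology T (f ` topspace S)) f"
    using f(1) by (rule continuous_map_into_subtopology) auto
  show "f ` topspace S = topspace (subtopology T (f ` topspace S))"
    using continuous_map_image_subset_topspace[OF f(1)] by auto
  show "inj_on f (topspace S)" by (rule f(2))
  show "open_map S (subtopology T (f ` topspace S)) f" unfolding open_map_def
  proof (intro allI impI)
    fix U assume U: "openin S U"
    show "openin (subtopology T (f ` topspace S)) (f ` U)"
    proof (subst openin_subopen, intro ballI)
      fix y assume "y \<in> f ` U"
      then obtain x where x: "x \<in> U" "y = f x" by blast
      obtain V where V: "openin T V" "f x \<in> V" "\<And>z. z \<in> topspace S \<Longrightarrow> f z \<in> V \<Longrightarrow> z \<in> U"
        using nbhd[OF U x(1)] by blast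
      have "openin (subtopology T (f ` topspace S)) (V \<inter> f ` topspace S)"
        using V(1) openin_subtopology by blast
      moreover have "y \<in> V \<inter> f ` topspace S" using V(2) x openin_subset[OF U] by blast
      moreover have "V \<inter> f ` topspace S \<subseteq> f ` U" using V(3) by blast
      ultimately show "\<exists>W. openin (subtopology T (f ` topspace S)) W \<and> y \<in> W \<and> W \<subseteq> f ` U" by blast
    qed
  qed
qed

text \<open>The count is expressed by a finite disjunction over the possible sets \<open>G\<close>
  of elements of \<open>F\<close> below \<open>x\<close>.\<close>

lemma dpred_card_less:
  assumes "finite F" shows "dpred1 \<R> (\<lambda>x. card {a \<in> F. a < x} = i)"
proof -
  have "dpred \<R> (\<lambda>e. \<exists>G\<in>{G \<in> Pow F. card G = i}. \<forall>a\<in>F. (a < e 0 \<longleftrightarrow> a \<in> G))"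
    using assms by (intro dpred_ex_finite dpred_all_finite dp) auto
  moreover have "(\<exists>G\<in>{G \<in> Pow F. card G = i}. \<forall>a\<in>F. (a < x \<longleftrightarrow> a \<in> G)) \<longleftrightarrow>
      card {a \<in> F. a < x} = i" for x
  proof
    assume "\<exists>G\<in>{G \<in> Pow F. card G = i}. \<forall>a\<in>F. (a < x \<longleftrightarrow> a \<in> G)"
    then obtain G where "G \<subseteq> F" "card G = i" "\<forall>a\<in>F. (a < x \<longleftrightarrow> a \<in> G)" by blast
    moreover from this have "{a \<in> F. a < x} = G" by blast
    ultimately show "card {a \<in> F. a < x} = i" by simp
  qed (intro bexI[of _ "{a \<in> F. a < x}"]; auto)
  ultimately show ?thesis by simp
qed

lemma card_less_eq:
  assumes "finite F" "card {a \<in> F. a < x} = card {a \<in> F. a < y}" "x < y" "y \<notin> F"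
  shows "\<forall>z. x \<le> z \<and> z \<le> y \<longrightarrow> z \<notin> (F :: 'a::linorder set)"
proof -
  have "{a \<in> F. a < x} \<subseteq> {a \<in> F. a < y}" using assms(3) by auto
  then have "{a \<in> F. a < x} = {a \<in> F. a < y}" using assms(1,2) by (intro card_subset_eq) auto
  then show ?thesis using assms(4) by (metis (mono_tags, lifting) le_less mem_Collect_eq not_le)
qed

lemma definable_points:
  assumes "dpred1 \<R> (\<lambda>x. x \<in> A)" shows "definable \<R> 1 (points A)"
proof (rule definable_dpred[OF assms, where d = undefined])
  show "points A = {xs. length xs = 1 \<and> (if 0 < (1::nat) then xs ! 0 else undefined) \<in> A}"
    by (auto simp: length_Suc_conv)
qed

text \<open>As \<open>k\<close> is bounded on \<open>A\<close>, the level is described by a finite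
  disjunction with the values \<open>c i\<close> as parameters.\<close>

lemma definable_map_strip:
  fixes k :: "'a::linorder \<Rightarrow> nat"
  assumes "dpred1 \<R> (\<lambda>x. x \<in> A)" "dfun1 \<R> f" "\<And>i. dpred1 \<R> (\<lambda>x. k x = i)" "\<And>x. x \<in> A \<Longrightarrow> k x \<le> n"
  shows "definable_map \<R> 1 2 (points A) (\<lambda>xs. [f (hd xs), c (k (hd xs))])"
  unfolding definable_map_def
proof
  let ?P = "\<lambda>e. e 0 \<in> A \<and> f (e 0) = e (Suc 0) \<and> (\<exists>i\<in>{..n}. k (e 0) = i \<and> e (Suc (Suc 0)) = c i)"
  have k: "dpred \<R> (\<lambda>e. k (e 0) = i \<and> e (Suc (Suc 0)) = c i)" for i
    by (intro dpred_conj assms(3) dpred_eq dterm_var dterm_const)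
  have "dpred \<R> (\<lambda>e. \<exists>i\<in>{..n}. k (e 0) = i \<and> e (Suc (Suc 0)) = c i)"
    by (rule dpred_ex_finite[OF finite_atMost k])
  with assms(1,2) have "dpred \<R> ?P" by (intro dpred_conj)
  then show "definable \<R> (1 + 2) ((\<lambda>x. x @ [f (hd x), c (k (hd x))]) ` points A)"
  proof (rule definable_dpred[where d = undefined])
    have "(xs \<in> (\<lambda>x. x @ [f (hd x), c (k (hd x))]) ` points A) \<longleftrightarrow>
        length xs = 3 \<and> ?P (\<lambda>i. if i < 3 then xs ! i else undefined)" for xs
    proof
      assume "length xs = 3 \<and> ?P (\<lambda>i. if i < 3 then xs ! i else undefined)"
      moreover from this obtain x y z where "xs = [x, y, z]"
        by (auto simp: length_Suc_conv numeral_3_eq_3)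
      ultimately have "x \<in> A" "xs = (\<lambda>x. x @ [f (hd x), c (k (hd x))]) [x]" by auto
      then show "xs \<in> (\<lambda>x. x @ [f (hd x), c (k (hd x))]) ` points A" by blast
    qed (use assms(4) in auto)
    then show "(\<lambda>x. x @ [f (hd x), c (k (hd x))]) ` points A =
        {xs. length xs = 1 + 2 \<and> ?P (\<lambda>i. if i < 1 + 2 then xs ! i else undefined)}"
      by (simp only: set_eq_iff mem_Collect_eq) (simp add: numeral_3_eq_3)
  qed
qed auto

locale def_top = def_space \<R> X I B
  for \<R> :: "('a::unbounded_dense_linorder, 'f, 'r) fo_structure" and X :: "'a set" and I :: "'i set" and B +
  fixes T :: "'a list topology" and c :: "nat \<Rightarrow> 'a"
  assumes topspace_T: "topspace T = points X"
    and openin_B: "u \<in> I \<Longrightarrow> openin T (points (B u))"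
    and openin_nbhd: "openin T S \<Longrightarrow> [x] \<in> S \<Longrightarrow> \<exists>u\<in>I. x \<in> B u \<and> points (B u) \<subseteq> S"
    and mono_c: "strict_mono c"
begin

lemma openin_definable:
  assumes "dpred1 \<R> (\<lambda>x. x \<in> A)" "A \<subseteq> X" "\<And>x g. x \<in> A \<Longrightarrow> conv g x \<Longrightarrow> near g (\<lambda>z. z \<in> A)"
  shows "openin T (points A)"
proof (subst openin_subopen, intro ballI)
  fix y assume "y \<in> points A"
  then obtain x where x: "x \<in> A" "y = [x]" by blast
  then obtain u where "u \<in> I" "x \<in> B u" "\<forall>z\<in>B u. z \<in> A"
    using definable_nbhd[OF assms(1), of x] assms(2,3) by blast
  then show "\<exists>W. openin T W \<and> y \<in> W \<and> W \<subseteq> points A"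
    using openin_B x by (intro exI[of _ "points (B u)"]) auto
qed

lemma embedding_map_points:
  assumes A: "A \<subseteq> X" and inj: "inj_on h A"
    and cont: "continuous_map (subtopology T (points A)) T' (\<lambda>xs. h (hd xs))"
    and nbhd: "\<And>x u. x \<in> A \<Longrightarrow> u \<in> I \<Longrightarrow> x \<in> B u \<Longrightarrow>
      \<exists>V. openin T' V \<and> h x \<in> V \<and> (\<forall>z\<in>A. h z \<in> V \<longrightarrow> z \<in> B u)"
  shows "embedding_map (subtopology T (points A)) T' (\<lambda>xs. h (hd xs))"
proof (rule embedding_map_pointwise[OF cont])
  have ts: "topspace (subtopology T (points A)) = points A" using A topspace_T by auto
  show "inj_on (\<lambda>xs. h (hd xs)) (topspace (subtopology T (points A)))"
    unfolding ts using inj by (auto simp: inj_on_def)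
  fix U xs assume "openin (subtopology T (points A)) U" and xs: "xs \<in> U"
  then obtain S where S: "openin T S" "U = S \<inter> points A" unfolding openin_subtopology by blast
  then obtain x where x: "xs = [x]" "x \<in> A" "[x] \<in> S" using xs by blast
  obtain u where u: "u \<in> I" "x \<in> B u" "points (B u) \<subseteq> S" using openin_nbhd[OF S(1) x(3)] by blast
  obtain V where V: "openin T' V" "h x \<in> V" "\<And>z. z \<in> A \<Longrightarrow> h z \<in> V \<Longrightarrow> z \<in> B u"
    using nbhd[OF x(2) u(1,2)] by blast
  then show "\<exists>V. openin T' V \<and> h (hd xs) \<in> V \<and>
      (\<forall>z\<in>topspace (subtopology T (points A)). h (hd z) \<in> V \<longrightarrow> z \<in> U)"
    unfolding ts using x u S by (intro exI[of _ V]) auto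
qed

text \<open>By \<open>openin_definable\<close> it is enough to test preimages of generators, and
  these only along convergent germs.\<close>

lemma continuous_map_generated:
  assumes A: "A \<subseteq> X" and img: "\<And>x. x \<in> A \<Longrightarrow> h x \<in> \<Union>\<S>"
    and dG: "\<And>G. G \<in> \<S> \<Longrightarrow> dpred1 \<R> (\<lambda>x. x \<in> A \<and> h x \<in> G)"
    and G: "\<And>G x g. G \<in> \<S> \<Longrightarrow> x \<in> A \<Longrightarrow> h x \<in> G \<Longrightarrow> conv g x \<Longrightarrow> near g (\<lambda>z. z \<in> A \<and> h z \<in> G)"
  shows "continuous_map (subtopology T (points A)) (topology_generated_by \<S>) (\<lambda>xs. h (hd xs))"
proof (rule continuous_on_generated_topo)
  have ts: "topspace (subtopology T (points A)) = points A" using A topspace_T by auto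
  show "(\<lambda>xs. h (hd xs)) ` topspace (subtopology T (points A)) \<subseteq> \<Union>\<S>" unfolding ts using img by auto
  fix U assume U: "U \<in> \<S>"
  have "openin T (points {x. x \<in> A \<and> h x \<in> U})"
    by (rule openin_definable) (use A dG[OF U] G[OF U] in auto)
  moreover have "points {x. x \<in> A \<and> h x \<in> U} = (\<lambda>xs. h (hd xs)) -` U \<inter> points A" by auto
  ultimately show "openin (subtopology T (points A)) ((\<lambda>xs. h (hd xs)) -` U \<inter> topspace (subtopology T (points A)))"
    unfolding ts by (metis inf.right_idem openin_subtopology)
qed

section \<open>The two open parts and the numbering of the points of a class\<close>

definition part :: "bool \<Rightarrow> 'a set" where
  "part q = {x \<in> good. two_sided x = q}"

text \<open>The successor keeps level 0 free for limit points.\<close>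

abbreviation piece :: "'a \<Rightarrow> nat" where
  "piece x \<equiv> Suc (card {a \<in> exc. a < x})"

lemma dpred_part: "dpred1 \<R> (\<lambda>x. x \<in> part q)"
  unfolding part_def mem_Collect_eq
  by (cases q) (simp_all add: dpred_conj dpred_not dpred_good dpred_two_sided)

lemma part_good: "x \<in> part q \<Longrightarrow> x \<in> good"
  unfolding part_def by blast

lemma part_subset: "part q \<subseteq> X"
  using part_good good_props by blast

lemma near_part: "x \<in> part q \<Longrightarrow> conv g x \<Longrightarrow> near g (\<lambda>z. z \<in> part q)"
  unfolding part_def using good_conv_two_sided by (fastforce elim: near_mono)

lemma openin_part: "openin T (points (part q))"
  by (rule openin_definable[OF dpred_part part_subset near_part])

lemma piece_le: "piece x \<le> Suc (card exc)"
  using finite_exc by (auto intro: card_mono)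

lemma piece_inj:
  assumes "x \<in> good" "y \<in> good" "base x = base y" "piece x = piece y" shows "x = y"
proof -
  have "\<not> u < v" if "u \<in> good" "v \<in> good" "base u = base v" "piece u = piece v" for u v
  proof
    assume "u < v"
    have "\<forall>z. u \<le> z \<and> z \<le> v \<longrightarrow> z \<notin> exc"
      using that good_props \<open>u < v\<close> by (intro card_less_eq finite_exc) auto
    then show False using generic_inj[OF \<open>u < v\<close>] that(3) by blast
  qed
  from this[OF assms] this[OF assms(2,1) assms(3,4)[symmetric]] show ?thesis
    using less_linear by blast
qed

lemma c_inject [simp]: "c i = c j \<longleftrightarrow> i = j"
  using mono_c by (simp add: strict_mono_eq)

lemma c_less [simp]: "c i < c j \<longleftrightarrow> i < j"
  using mono_c by (rule strict_mono_less)

lemma part_conv: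
  assumes "x \<in> part q" "conv g x"
  obtains r where "push base g r (base x)" "conv (At r (base x)) x"
  using good_conv[OF part_good[OF assms(1)] assms(2)] by metis

section \<open>The lexicographic part\<close>

text \<open>
  In the class of \<open>base x\<close> the limit of the left germ goes to the bottom of the strip, the limit of the
  right germ to the top, and the other points, which are isolated, in between.
\<close>

definition lex_index :: "'a \<Rightarrow> nat" where
  "lex_index x = (if conv (At False (base x)) x then 0
     else if conv (At True (base x)) x then Suc (Suc (card exc)) else piece x)"

lemma dpred_lex_index: "dpred1 \<R> (\<lambda>x. lex_index x = i)"
proof -
  have c: "dpred1 \<R> (\<lambda>x. conv (At s (base x)) x)" for s
    by (intro dpred_conv_at dterm_fun[OF dfun_select] dterm_var)
  have "dpred1 \<R> (\<lambda>x. piece x = i)"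
    using dpred_card_less[OF finite_exc, of \<R> "i - 1"] dpred_const[of \<R> False] by (cases i) auto
  then have "dpred1 \<R> (\<lambda>x. (conv (At False (base x)) x \<and> 0 = i) \<or> (\<not> conv (At False (base x)) x \<and>
      ((conv (At True (base x)) x \<and> Suc (Suc (card exc)) = i) \<or>
       (\<not> conv (At True (base x)) x \<and> piece x = i))))"
    by (intro dpred_disj dpred_conj dpred_not c dpred_const)
  moreover have "(lex_index x = i) \<longleftrightarrow> (conv (At False (base x)) x \<and> 0 = i) \<or> (\<not> conv (At False (base x)) x \<and>
      ((conv (At True (base x)) x \<and> Suc (Suc (card exc)) = i) \<or>
       (\<not> conv (At True (base x)) x \<and> piece x = i)))" for x
    unfolding lex_index_def by auto
  ultimately show ?thesis by simp
qed

lemma lex_index_le: "lex_index x \<le> Suc (Suc (card exc))"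
  using piece_le[of x] unfolding lex_index_def by auto

lemma lex_index_0: "lex_index x = 0 \<longleftrightarrow> conv (At False (base x)) x"
  unfolding lex_index_def by auto

lemma lex_index_top:
  "lex_index x = Suc (Suc (card exc)) \<longleftrightarrow> conv (At True (base x)) x \<and> \<not> conv (At False (base x)) x"
  using piece_le[of x] unfolding lex_index_def by auto

text \<open>Otherwise \<open>base x\<close> would be two-sided and so would \<open>x\<close>. Hence
  bottom and top of the strip do not compete for one point.\<close>

lemma not_both:
  assumes "x \<in> part False" shows "\<not> (conv (At True (base x)) x \<and> conv (At False (base x)) x)"
proof
  assume "conv (At True (base x)) x \<and> conv (At False (base x)) x"
  then have "conv (At s (base x)) x" for s by (cases s) auto
  then have "two_sided (base x)" unfolding two_sided_def
    using good_props[OF part_good[OF assms]] by blast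
  then show False using two_sided_base[of x] good_props[OF part_good[OF assms]] assms
    unfolding part_def by simp
qed

lemma lex_index_inj:
  assumes "x \<in> part False" "y \<in> part False" "base x = base y" "lex_index x = lex_index y"
  shows "x = y"
proof (cases "lex_index x = 0 \<or> lex_index x = Suc (Suc (card exc))")
  case True
  then show ?thesis using assms(3,4) lex_index_0 lex_index_top conv_unique by metis
next
  case False
  then have "lex_index x = piece x" unfolding lex_index_def by (metis (full_types))
  moreover have "lex_index y = piece y" using False assms(4) unfolding lex_index_def by (metis (full_types))
  ultimately have "piece x = piece y" using assms(4) by simp
  with assms(3) show ?thesis by (rule piece_inj[OF part_good[OF assms(1)] part_good[OF assms(2)]])
qed

definition lex_map :: "'a \<Rightarrow> 'a list" where
  "lex_map x = [base x, c (lex_index x)]"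

lemma lex_less_pair [simp]: "lex_less [a, x] [b, y] \<longleftrightarrow> a < b \<or> (a = b \<and> x < y)"
  unfolding lex_less_def by simp

abbreviation "lex_width \<equiv> Suc (Suc (card exc))"

lemma lex_map_strip: "lex_map x \<in> strip c lex_width"
  unfolding lex_map_def strip_def using lex_index_le by blast

lemma near_base_side:
  assumes "push base g r t" "lt s a t" shows "near g (\<lambda>z. lt s a (base z))"
  by (rule near_push[OF assms(1) near_side[OF assms(2)]])

lemma near_base_beyond:
  assumes "push base g r t" shows "near g (\<lambda>z. lt r t (base z))"
  by (rule near_push[OF assms near_beyond])

lemma dpred_lex_index_less: "dpred1 \<R> (\<lambda>x. lex_index x < j)"
proof -
  have "dpred \<R> (\<lambda>e. \<exists>i\<in>{..<j}. lex_index (e 0) = i)"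
    by (intro dpred_ex_finite dpred_lex_index) simp
  then show ?thesis by simp
qed

lemma continuous_lex_map:
  "continuous_map (subtopology T (points (part False))) (lex_topology (strip c lex_width)) (\<lambda>xs. lex_map (hd xs))"
  unfolding lex_topology_def
proof (rule continuous_map_generated[OF part_subset])
  show "lex_map x \<in> \<Union>({strip c lex_width} \<union> {{y \<in> strip c lex_width. lex_less y x} |x. x \<in> strip c lex_width} \<union>
    {{y \<in> strip c lex_width. lex_less x y} |x. x \<in> strip c lex_width})" for x
    using lex_map_strip by blast
  fix G assume "G \<in> {strip c lex_width} \<union> {{y \<in> strip c lex_width. lex_less y x} |x. x \<in> strip c lex_width} \<union>
    {{y \<in> strip c lex_width. lex_less x y} |x. x \<in> strip c lex_width}"
  then consider "G = strip c lex_width"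
    | a j where "j \<le> lex_width" "G = {y \<in> strip c lex_width. lex_less y [a, c j]}"
    | a j where "G = {y \<in> strip c lex_width. lex_less [a, c j] y}"
    unfolding strip_def by blast
  then have *: "(\<forall>x. lex_map x \<in> G) \<or>
    (\<exists>a j. j \<le> lex_width \<and> (\<forall>x. lex_map x \<in> G \<longleftrightarrow> base x < a \<or> (base x = a \<and> lex_index x < j))) \<or>
    (\<exists>a j. \<forall>x. lex_map x \<in> G \<longleftrightarrow> a < base x \<or> (a = base x \<and> j < lex_index x))"
  proof cases
    case 1
    then show ?thesis using lex_map_strip by blast
  next
    case (2 a j)
    then have "lex_map x \<in> G \<longleftrightarrow> base x < a \<or> (base x = a \<and> lex_index x < j)" for x
      using lex_map_strip[of x] by (simp add: lex_map_def)
    then show ?thesis using 2(1) by blast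
  next
    case (3 a j)
    then have "lex_map x \<in> G \<longleftrightarrow> a < base x \<or> (a = base x \<and> j < lex_index x)" for x
      using lex_map_strip[of x] by (simp add: lex_map_def)
    then show ?thesis by blast
  qed
  note db = dterm_fun[OF dfun_select dterm_var]
  have gt: "dpred1 \<R> (\<lambda>x. j < lex_index x)" for j
    using dpred_not[OF dpred_lex_index_less[of "Suc j"]] by (simp add: not_less Suc_le_eq)
  show "dpred1 \<R> (\<lambda>x. x \<in> part False \<and> lex_map x \<in> G)"
    using * by (elim disjE exE)
      (simp_all add: dpred_part dpred_conj dpred_disj dpred_less dpred_eq db dterm_const gt dpred_lex_index_less)
  fix x g assume x: "x \<in> part False" "lex_map x \<in> G" "conv g x"
  obtain r where r: "push base g r (base x)" "conv (At r (base x)) x" by (rule part_conv[OF x(1,3)])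
  have "near g (\<lambda>z. lex_map z \<in> G)"
    using *
  proof (elim disjE exE)
    assume "\<forall>x. lex_map x \<in> G"
    then show ?thesis by (intro near_always) blast
  next
    fix a j
    assume "j \<le> lex_width \<and> (\<forall>x. lex_map x \<in> G \<longleftrightarrow> base x < a \<or> (base x = a \<and> lex_index x < j))"
    then have j: "j \<le> lex_width"
      and G: "\<forall>x. lex_map x \<in> G \<longleftrightarrow> base x < a \<or> (base x = a \<and> lex_index x < j)" by blast+
    show ?thesis
    proof (cases "base x < a")
      case True
      then have "near g (\<lambda>z. lt False a (base z))" using r(1) by (intro near_base_side) auto
      then show ?thesis by (rule near_mono) (use G in simp)
    next
      case False
      then have b: "base x = a" "lex_index x < j" using x(2) G by auto
      show ?thesis
      \<comment> \<open>The ray cuts the column of \<open>base x\<close>. A right germ would put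
        \<open>x\<close> on the top level, which is not below any \<open>j\<close> of the strip; so
        the germ comes from the left and its base values lie below \<open>a\<close>.\<close>
      proof (cases r)
        case True
        then have "lex_index x = lex_width" using r(2) not_both[OF x(1)] lex_index_top[of x] by simp
        then show ?thesis using b(2) j by simp
      next
        case False
        then have "near g (\<lambda>z. lt False a (base z))" using near_base_beyond[OF r(1)] b by simp
        then show ?thesis by (rule near_mono) (use G in simp)
      qed
    qed
  next
    fix a j assume G: "\<forall>x. lex_map x \<in> G \<longleftrightarrow> a < base x \<or> (a = base x \<and> j < lex_index x)"
    show ?thesis
    proof (cases "a < base x")
      case True
      then have "near g (\<lambda>z. lt True a (base z))" using r(1) by (intro near_base_side) auto
      then show ?thesis by (rule near_mono) (use G in simp)
    next
      case False
      then have b: "base x = a" "j < lex_index x" using x(2) G by auto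
      \<comment> \<open>A left germ would put \<open>x\<close> on level 0, which is not above level
        \<open>j\<close>.\<close>
      have r: "r" "push base g r a" using r b lex_index_0[of x] by (cases r; auto)+
      then have "near g (\<lambda>z. lt True a (base z))" using near_base_beyond[OF r(2)] by simp
      then show ?thesis by (rule near_mono) (use G in simp)
    qed
  qed
  with near_part[OF x(1,3)] show "near g (\<lambda>z. z \<in> part False \<and> lex_map z \<in> G)" by (rule near_conj)
qed

lemma openin_lex_between:
  assumes "p \<in> S" "q \<in> S" shows "openin (lex_topology S) {y \<in> S. lex_less p y \<and> lex_less y q}"
proof -
  have "openin (lex_topology S) ({y \<in> S. lex_less p y} \<inter> {y \<in> S. lex_less y q})"
    unfolding lex_topology_def using assms
    by (intro openin_Int topology_generated_by_Basis) blast+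
  moreover have "{y \<in> S. lex_less p y} \<inter> {y \<in> S. lex_less y q} = {y \<in> S. lex_less p y \<and> lex_less y q}"
    by blast
  ultimately show ?thesis by simp
qed

lemma base_nbhd:
  assumes "x \<in> part q" "u \<in> I" "x \<in> B u" "conv (At s (base x)) x"
  obtains t where "lt s (base x) t"
    "\<And>z. z \<in> good \<Longrightarrow> lt s (base x) (base z) \<Longrightarrow> lt s (base z) t \<Longrightarrow> z \<in> B u"
  using good_nbhd[OF part_good[OF assms(1)] assms(4) dpred_B[OF assms(2)] conv_near[OF _ assms(2,3)]]
  by blast

text \<open>A bottom point is approached only by the columns to its left, a top point only by those
  to its right, and a point in between has neighbours above and below in its column and is
  isolated.\<close>

lemma lex_map_nbhd:
  assumes x: "x \<in> part False" and u: "u \<in> I" "x \<in> B u"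
  shows "\<exists>V. openin (lex_topology (strip c lex_width)) V \<and> lex_map x \<in> V \<and>
    (\<forall>z\<in>part False. lex_map z \<in> V \<longrightarrow> z \<in> B u)"
proof -
  let ?S = "strip c lex_width"
  have S: "[a, c j] \<in> ?S" if "j \<le> lex_width" for a j using that unfolding strip_def by blast
  have "\<exists>p\<in>?S. \<exists>q\<in>?S. lex_less p (lex_map x) \<and> lex_less (lex_map x) q \<and>
    (\<forall>z\<in>part False. lex_less p (lex_map z) \<and> lex_less (lex_map z) q \<longrightarrow> z \<in> B u)"
  proof -
    consider "conv (At False (base x)) x" | "conv (At True (base x)) x" "\<not> conv (At False (base x)) x"
      | "\<not> conv (At True (base x)) x" "\<not> conv (At False (base x)) x" by blast
    then show ?thesis
    proof cases
      case 1
      obtain t where t: "t < base x" "\<And>z. z \<in> good \<Longrightarrow> base z < base x \<Longrightarrow> t < base z \<Longrightarrow> z \<in> B u"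
        by (rule base_nbhd[OF x u 1]) (simp add: that)
      have 0: "lex_index x = 0" using 1 lex_index_0 by blast
      show ?thesis
      \<comment> \<open>Starting at the top of the column of \<open>t\<close> excludes that column,
        and ending at level 1 keeps only the bottom of the column of \<open>base x\<close>.\<close>
      proof (rule bexI[of _ "[t, c lex_width]"], rule bexI[of _ "[base x, c 1]"], intro conjI ballI impI)
        fix z assume z: "z \<in> part False"
          "lex_less [t, c lex_width] (lex_map z) \<and> lex_less (lex_map z) [base x, c 1]"
        then have "t < base z" "base z < base x \<or> (base z = base x \<and> lex_index z = 0)"
          using lex_index_le[of z] unfolding lex_map_def by auto
        then show "z \<in> B u" using t(2)[OF part_good[OF z(1)]] lex_index_inj[OF z(1) x] 0 u by auto
      qed (use 0 t S in \<open>auto simp: lex_map_def\<close>)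
    next
      case 2
      obtain t where t: "base x < t" "\<And>z. z \<in> good \<Longrightarrow> base x < base z \<Longrightarrow> base z < t \<Longrightarrow> z \<in> B u"
        by (rule base_nbhd[OF x u 2(1)]) (simp add: that)
      have 0: "lex_index x = lex_width" using 2 lex_index_top by blast
      show ?thesis
      proof (rule bexI[of _ "[base x, c (Suc (card exc))]"], rule bexI[of _ "[t, c 0]"], intro conjI ballI impI)
        fix z assume z: "z \<in> part False"
          "lex_less [base x, c (Suc (card exc))] (lex_map z) \<and> lex_less (lex_map z) [t, c 0]"
        then have "base z < t" "base x < base z \<or> (base z = base x \<and> lex_index z = lex_width)"
          using lex_index_le[of z] unfolding lex_map_def by auto
        then show "z \<in> B u" using t(2)[OF part_good[OF z(1)]] lex_index_inj[OF z(1) x] 0 u by auto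
      qed (use 0 t S in \<open>auto simp: lex_map_def\<close>)
    next
      case 3
      then have k: "lex_index x = piece x" unfolding lex_index_def by simp
      show ?thesis
      \<comment> \<open>The adjacent levels; both belong to the strip because \<open>piece x\<close>
        lies between 1 and \<open>card exc + 1\<close>.\<close>
      proof (rule bexI[of _ "[base x, c (piece x - 1)]"], rule bexI[of _ "[base x, c (Suc (piece x))]"], intro conjI ballI impI)
        fix z assume z: "z \<in> part False"
          "lex_less [base x, c (piece x - 1)] (lex_map z) \<and> lex_less (lex_map z) [base x, c (Suc (piece x))]"
        then have "base z = base x" "lex_index z = lex_index x" unfolding lex_map_def using k by auto
        then show "z \<in> B u" using lex_index_inj[OF z(1) x] u by auto
      qed (use k S piece_le[of x] in \<open>auto simp: lex_map_def\<close>)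
    qed
  qed
  then obtain p q where pq: "p \<in> ?S" "q \<in> ?S" "lex_less p (lex_map x)" "lex_less (lex_map x) q"
    "\<And>z. z \<in> part False \<Longrightarrow> lex_less p (lex_map z) \<Longrightarrow> lex_less (lex_map z) q \<Longrightarrow> z \<in> B u" by blast
  show ?thesis
    by (rule exI[of _ "{y \<in> ?S. lex_less p y \<and> lex_less y q}"])
      (use pq openin_lex_between[OF pq(1,2)] lex_map_strip in auto)
qed

lemma topspace_part: "topspace (subtopology T (points (part q))) = points (part q)"
  using part_subset topspace_T by auto

lemma lex_embedding:
  "definable_embedding \<R> 1 2 (subtopology T (points (part False))) (lex_topology (strip c lex_width))
     (\<lambda>xs. lex_map (hd xs))"
  unfolding definable_embedding_def topspace_part
proof
  show "definable_map \<R> 1 2 (points (part False)) (\<lambda>xs. lex_map (hd xs))"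
    unfolding lex_map_def by (rule definable_map_strip[OF dpred_part dfun_select dpred_lex_index lex_index_le])
  show "embedding_map (subtopology T (points (part False))) (lex_topology (strip c lex_width)) (\<lambda>xs. lex_map (hd xs))"
  proof (rule embedding_map_points[OF part_subset _ continuous_lex_map lex_map_nbhd])
    show "inj_on lex_map (part False)"
      by (rule inj_onI) (simp add: lex_map_def lex_index_inj)
  qed
qed

section \<open>The Alexandroff part\<close>

definition alex_index :: "'a \<Rightarrow> nat" where
  "alex_index x = (if base x = x then 0 else piece x)"

definition alex_map :: "'a \<Rightarrow> 'a list" where
  "alex_map x = [base x, c (alex_index x)]"

abbreviation "alex_width \<equiv> Suc (card exc)"

lemma alex_index_le: "alex_index x \<le> alex_width"
  using piece_le[of x] unfolding alex_index_def by simp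

lemma alex_map_strip: "alex_map x \<in> strip c alex_width"
  unfolding alex_map_def strip_def using alex_index_le by blast

lemma dpred_alex_index: "dpred1 \<R> (\<lambda>x. alex_index x = i)"
proof -
  have b: "dpred1 \<R> (\<lambda>x. base x = x)" by (intro dpred_eq dterm_fun[OF dfun_select] dterm_var)
  have "dpred1 \<R> (\<lambda>x. piece x = i)"
    using dpred_card_less[OF finite_exc, of \<R> "i - 1"] dpred_const[of \<R> False] by (cases i) auto
  then have "dpred1 \<R> (\<lambda>x. (base x = x \<and> 0 = i) \<or> (base x \<noteq> x \<and> piece x = i))"
    by (intro dpred_disj dpred_conj dpred_not b dpred_const)
  moreover have "(alex_index x = i) \<longleftrightarrow> (base x = x \<and> 0 = i) \<or> (base x \<noteq> x \<and> piece x = i)" for x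
    unfolding alex_index_def by auto
  ultimately show ?thesis by simp
qed

lemma alex_map_inj: "x \<in> part True \<Longrightarrow> y \<in> part True \<Longrightarrow> alex_map x = alex_map y \<Longrightarrow> x = y"
  using piece_inj[of x y] part_good unfolding alex_map_def alex_index_def
  by (auto split: if_splits)

lemma two_sided_conv: "x \<in> part True \<Longrightarrow> conv (At s (base x)) (base x)"
  using two_sided_limit(1) unfolding part_def by blast

text \<open>The germ is carried to a germ at \<open>base x\<close>, whose limit is
  \<open>base x\<close>. So the base point is the only limit point of its class and gets level 0,
  the level of the non-isolated points; the rest of the class goes to isolated points.\<close>

lemma two_sided_limit_base: "x \<in> part True \<Longrightarrow> conv g x \<Longrightarrow> base x = x"
  by (rule part_conv) (use two_sided_conv conv_unique in blast)+

lemma continuous_alex_map: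
  "continuous_map (subtopology T (points (part True))) (alex_topology (c 0)) (\<lambda>xs. alex_map (hd xs))"
  unfolding alex_topology_def
proof (rule continuous_map_generated[OF part_subset])
  let ?S = "{{[x, t]} | x t. t \<noteq> c 0} \<union>
      {{[x, c 0]} \<union> {[w, t] | w t. w \<in> {z<..<y} - {x}} | x y z. z < x \<and> x < y}"
  show "alex_map x \<in> \<Union>?S" for x
  proof (cases "alex_index x = 0")
    case True
    obtain z y where "z < base x" "base x < y" using lt_ex gt_ex by blast
    then have "{[base x, c 0]} \<union> {[w, t] | w t. w \<in> {z<..<y} - {base x}} \<in> ?S" by blast
    then show ?thesis by (rule UnionI) (simp add: alex_map_def True)
  next
    case False
    then have "{alex_map x} \<in> ?S" unfolding alex_map_def by simp
    then show ?thesis by (rule UnionI) simp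
  qed
  note db = dterm_fun[OF dfun_select dterm_var]
  fix G assume "G \<in> ?S"
  then consider a q where "q \<noteq> c 0" "G = {[a, q]}"
    | a y z where "z < a" "a < y" "G = {[a, c 0]} \<union> {[w, t] | w t. w \<in> {z<..<y} - {a}}" by blast
  \<comment> \<open>In a singleton generator the second coordinate \<open>q\<close> is any element
    other than \<open>c 0\<close> and need not name a level; \<open>J\<close> collects the levels
    named by it and may be empty.\<close>
  then have *: "(\<exists>a J. 0 \<notin> J \<and> (\<forall>x. alex_map x \<in> G \<longleftrightarrow> base x = a \<and> (\<exists>i\<in>J. alex_index x = i)) \<and> finite J) \<or>
    (\<exists>a y z. z < a \<and> a < y \<and> (\<forall>x. alex_map x \<in> G \<longleftrightarrow>
      (base x = a \<and> alex_index x = 0) \<or> (z < base x \<and> base x < y \<and> base x \<noteq> a)))"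
  proof cases
    case (1 a q)
    then have "alex_map x \<in> G \<longleftrightarrow> base x = a \<and> (\<exists>i\<in>{i. i \<le> alex_width \<and> c i = q}. alex_index x = i)" for x
      using alex_index_le[of x] unfolding alex_map_def by auto
    moreover have "0 \<notin> {i. i \<le> alex_width \<and> c i = q}" using 1 by auto
    moreover have "finite {i. i \<le> alex_width \<and> c i = q}" by simp
    ultimately show ?thesis
      by (intro disjI1 exI[of _ a] exI[of _ "{i. i \<le> alex_width \<and> c i = q}"] conjI allI)
  next
    case (2 a y z)
    then have "alex_map x \<in> G \<longleftrightarrow>
      (base x = a \<and> alex_index x = 0) \<or> (z < base x \<and> base x < y \<and> base x \<noteq> a)" for x
      unfolding alex_map_def by auto
    with 2(1,2) show ?thesis
      by (intro disjI2 exI[of _ a] exI[of _ y] exI[of _ z] conjI allI)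
  qed
  have d: "dpred1 \<R> (\<lambda>x. \<exists>i\<in>J. alex_index x = i)" if "finite J" for J
    by (intro dpred_ex_finite that dpred_alex_index)
  show "dpred1 \<R> (\<lambda>x. x \<in> part True \<and> alex_map x \<in> G)"
  proof (rule dpred_conj[OF dpred_part], use * in \<open>elim disjE exE conjE\<close>)
    fix a J assume "\<forall>x. alex_map x \<in> G \<longleftrightarrow> base x = a \<and> (\<exists>i\<in>J. alex_index x = i)" "finite J"
    then show "dpred1 \<R> (\<lambda>x. alex_map x \<in> G)"
      by (simp only:) (intro dpred_conj d dpred_eq db dterm_const)
  next
    fix a y z assume "\<forall>x. alex_map x \<in> G \<longleftrightarrow>
      (base x = a \<and> alex_index x = 0) \<or> (z < base x \<and> base x < y \<and> base x \<noteq> a)"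
    then show "dpred1 \<R> (\<lambda>x. alex_map x \<in> G)"
      by (simp only:) (intro dpred_conj dpred_disj dpred_not dpred_less dpred_alex_index dpred_eq db dterm_const)
  qed
  fix x g assume x: "x \<in> part True" "alex_map x \<in> G" "conv g x"
  \<comment> \<open>A point to which some germ converges is a base point, so singleton generators,
    which avoid level 0, cannot contain its image.\<close>
  have bx: "base x = x" using two_sided_limit_base x by blast
  then have k: "alex_index x = 0" unfolding alex_index_def by simp
  obtain r where r: "push base g r (base x)" by (rule part_conv[OF x(1,3)])
  have "near g (\<lambda>z. alex_map z \<in> G)"
    using *
  proof (elim disjE exE conjE)
    fix a J assume "0 \<notin> J" "\<forall>x. alex_map x \<in> G \<longleftrightarrow> base x = a \<and> (\<exists>i\<in>J. alex_index x = i)"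
    then show ?thesis using x(2) k by auto
  next
    fix a y z assume zy: "z < a" "a < y" and G: "\<forall>x. alex_map x \<in> G \<longleftrightarrow>
      (base x = a \<and> alex_index x = 0) \<or> (z < base x \<and> base x < y \<and> base x \<noteq> a)"
    then have "z < base x" "base x < y" using x(2) by auto
    then have "near (At r (base x)) (\<lambda>w. (lt True z w \<and> lt False y w) \<and> w \<noteq> a)"
      by (intro near_conj near_ne' near_side) auto
    then have "near g (\<lambda>w. (lt True z (base w) \<and> lt False y (base w)) \<and> base w \<noteq> a)"
      by (rule near_push[OF r])
    then show ?thesis by (rule near_mono) (use G in simp)
  qed
  with near_part[OF x(1,3)] show "near g (\<lambda>z. z \<in> part True \<and> alex_map z \<in> G)" by (rule near_conj)
qed

lemma alex_map_nbhd:
  assumes x: "x \<in> part True" and u: "u \<in> I" "x \<in> B u"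
  shows "\<exists>V. openin (subtopology (alex_topology (c 0)) (strip c alex_width)) V \<and> alex_map x \<in> V \<and>
    (\<forall>z\<in>part True. alex_map z \<in> V \<longrightarrow> z \<in> B u)"
proof -
  have "\<exists>V. openin (alex_topology (c 0)) V \<and> alex_map x \<in> V \<and>
    (\<forall>z\<in>part True. alex_map z \<in> V \<longrightarrow> z \<in> B u)"
  proof (cases "base x = x")
    case False
    then have "openin (alex_topology (c 0)) {alex_map x}"
      unfolding alex_topology_def alex_map_def alex_index_def
      by (intro topology_generated_by_Basis) auto
    then show ?thesis using alex_map_inj[OF _ x] u by (intro exI[of _ "{alex_map x}"]) auto
  next
    case True
    then have cv: "conv (At s (base x)) x" for s using two_sided_conv[OF x, of s] by simp
    obtain y where y: "base x < y" "\<And>z. z \<in> good \<Longrightarrow> base x < base z \<Longrightarrow> base z < y \<Longrightarrow> z \<in> B u"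
      by (rule base_nbhd[OF x u cv[of True]]) (simp add: that)
    obtain t where t: "t < base x" "\<And>z. z \<in> good \<Longrightarrow> base z < base x \<Longrightarrow> t < base z \<Longrightarrow> z \<in> B u"
      by (rule base_nbhd[OF x u cv[of False]]) (simp add: that)
    let ?V = "{[base x, c 0]} \<union> {[w, q] | w q. w \<in> {t<..<y} - {base x}}"
    have "openin (alex_topology (c 0)) ?V"
      unfolding alex_topology_def using t(1) y(1) by (intro topology_generated_by_Basis) blast
    moreover have mx: "alex_map x = [base x, c 0]" unfolding alex_map_def alex_index_def using True by simp
    moreover have "z \<in> B u" if z: "z \<in> part True" "alex_map z \<in> ?V" for z
    proof (cases "alex_map z = alex_map x")
      case True
      then show ?thesis using alex_map_inj[OF z(1) x] u by blast
    next
      case False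
      then have "t < base z" "base z < y" "base z \<noteq> base x"
        using z(2) mx unfolding alex_map_def by auto
      then show ?thesis using y(2) t(2) part_good[OF z(1)] by (meson linorder_neqE)
    qed
    ultimately show ?thesis by (intro exI[of _ ?V]) auto
  qed
  then obtain V where V: "openin (alex_topology (c 0)) V" "alex_map x \<in> V"
    "\<And>z. z \<in> part True \<Longrightarrow> alex_map z \<in> V \<Longrightarrow> z \<in> B u" by blast
  have "openin (subtopology (alex_topology (c 0)) (strip c alex_width)) (V \<inter> strip c alex_width)"
    using V(1) openin_subtopology by blast
  then show ?thesis using V alex_map_strip by (intro exI[of _ "V \<inter> strip c alex_width"]) blast
qed

lemma alex_embedding:
  "definable_embedding \<R> 1 2 (subtopology T (points (part True)))
     (subtopology (alex_topology (c 0)) (strip c alex_width)) (\<lambda>xs. alex_map (hd xs))"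
  unfolding definable_embedding_def topspace_part
proof
  show "definable_map \<R> 1 2 (points (part True)) (\<lambda>xs. alex_map (hd xs))"
    unfolding alex_map_def by (rule definable_map_strip[OF dpred_part dfun_select dpred_alex_index alex_index_le])
  show "embedding_map (subtopology T (points (part True)))
     (subtopology (alex_topology (c 0)) (strip c alex_width)) (\<lambda>xs. alex_map (hd xs))"
  proof (rule embedding_map_points[OF part_subset _ _ alex_map_nbhd])
    show "inj_on alex_map (part True)" by (rule inj_onI) (rule alex_map_inj)
    show "continuous_map (subtopology T (points (part True)))
      (subtopology (alex_topology (c 0)) (strip c alex_width)) (\<lambda>xs. alex_map (hd xs))"
      by (rule continuous_map_into_subtopology[OF continuous_alex_map]) (simp add: alex_map_strip)
  qed
qed

section \<open>The decomposition, and its application to the given topology\<close>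

lemma decomposition:
  "\<exists>Y Z nY nZ.
    definable \<R> 1 Y \<and> definable \<R> 1 Z \<and> openin T Y \<and> openin T Z \<and> Y \<inter> Z = {} \<and>
    finite (topspace T - (Y \<union> Z)) \<and> nY > 0 \<and> nZ > 0 \<and>
    (\<exists>hY. definable_embedding \<R> 1 2 (subtopology T Y) (lex_topology (strip c nY)) hY) \<and>
    (\<exists>hZ. definable_embedding \<R> 1 2 (subtopology T Z)
            (subtopology (alex_topology (c 0)) (strip c nZ)) hZ)"
proof (intro exI conjI)
  show "points (part False) \<inter> points (part True) = {}" unfolding part_def by auto
  have "part False \<union> part True = good" unfolding part_def by auto
  then have "topspace T - (points (part False) \<union> points (part True)) = points (X - good)"
    using topspace_T by (auto simp: image_Un[symmetric])
  then show "finite (topspace T - (points (part False) \<union> points (part True)))"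
    using finite_not_good by simp
  show "0 < lex_width" "0 < alex_width" by simp_all
qed (rule definable_points[OF dpred_part] openin_part lex_embedding alex_embedding)+

end

theorem theorem6p3:
  fixes \<R> :: "('a::unbounded_dense_linorder, 'f, 'r) fo_structure"
    and c :: "nat \<Rightarrow> 'a"
    and T :: "'a list topology"
  assumes "o_minimal \<R>"
    and "strict_mono c"
    and "definable_topological_space \<R> 1 T"
    and "regular_space T"
    and "Hausdorff_space T"
  shows "\<exists>Y Z nY nZ.
    definable \<R> 1 Y \<and> definable \<R> 1 Z \<and> openin T Y \<and> openin T Z \<and> Y \<inter> Z = {} \<and>
    finite (topspace T - (Y \<union> Z)) \<and> nY > 0 \<and> nZ > 0 \<and>
    (\<exists>hY. definable_embedding \<R> 1 2 (subtopology T Y) (lex_topology (strip c nY)) hY) \<and>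
    (\<exists>hZ. definable_embedding \<R> 1 2 (subtopology T Z)
            (subtopology (alex_topology (c 0)) (strip c nZ)) hZ)"
proof -
  from assms(3) obtain \<B> where dT: "definable \<R> 1 (topspace T)" and "definable_family \<R> 1 \<B>"
    and basis: "openin T = arbitrary union_of (\<lambda>B. B \<in> \<B>)"
    unfolding definable_topological_space_def by blast
  then obtain m U A where dU: "definable \<R> m U" and dA: "definable \<R> (1 + m) A"
    and \<B>: "\<B> = (\<lambda>u. {x. x @ u \<in> A}) ` U" unfolding definable_family_def by blast
  define X where "X = {x. [x] \<in> topspace T}"
  define B where "B u = {x. [x] @ u \<in> A}" for u
  have len_U: "length u = m" if "u \<in> U" for u using dU that unfolding definable_def by auto
  have len_A: "length xs = 1 + m" if "xs \<in> A" for xs using dA that unfolding definable_def by auto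
  have len_T: "length xs = 1" if "xs \<in> topspace T" for xs using dT that unfolding definable_def by auto
  have points_B: "points (B u) = {x. x @ u \<in> A}" if "u \<in> U" for u
  proof -
    have "x \<in> points (B u)" if x: "x @ u \<in> A" for x
    proof -
      obtain z where "x = [z]" using len_A[OF x] len_U[OF \<open>u \<in> U\<close>] by (auto simp: length_Suc_conv)
      with x show ?thesis unfolding B_def by simp
    qed
    then show ?thesis unfolding B_def by auto
  qed
  have topspace_T: "topspace T = points X"
    unfolding X_def using len_T by (force simp: length_Suc_conv)
  have openin_B: "openin T (points (B u))" if "u \<in> U" for u
    unfolding basis points_B[OF that] \<B> using that
    by (intro union_of_inc) (auto simp: arbitrary_def)
  have openin_nbhd: "\<exists>u\<in>U. x \<in> B u \<and> points (B u) \<subseteq> S" if "openin T S" "[x] \<in> S" for S x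
  proof -
    from that(1) obtain \<U> where "\<U> \<subseteq> \<B>" "\<Union>\<U> = S" unfolding basis union_of_def by auto
    with that(2) obtain W where W: "W \<in> \<B>" "[x] \<in> W" "W \<subseteq> S" by blast
    then obtain u where u: "u \<in> U" "W = points (B u)" unfolding \<B> using points_B by blast
    then show ?thesis using W by auto
  qed
  \<comment> \<open>Variable \<open>j\<close> holds the point, and the \<open>m\<close> variables
    from \<open>k\<close> on hold the index of a basic set.\<close>
  have list: "dpred \<R> (\<lambda>e. e j # map (\<lambda>i. e (i + k)) [0..<m] \<in> A)" for j k
    using dpred_definable[OF dA, of "j # map (\<lambda>i. i + k) [0..<m]"] by (simp add: comp_def)
  have list_U: "dpred \<R> (\<lambda>e. map e [0..<m] \<in> U)"
    by (rule dpred_definable[OF dU]) simp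
  have list_const: "dpred \<R> (\<lambda>e. a # map e [0..<m] \<in> A)" for a
  proof -
    have "dpred \<R> (\<lambda>e. e m # map e [0..<m] \<in> A)" using list[of m 0] by simp
    from dpred_subst[OF this, of "\<lambda>i. if i = m then Inr a else Inl i"]
    have "dpred \<R> (\<lambda>e. a # map (\<lambda>i. var_val e (if i = m then Inr a else Inl i)) [0..<m] \<in> A)" by simp
    moreover have "map (\<lambda>i. var_val e (if i = m then Inr a else Inl i)) [0..<m] = map e [0..<m]" for e
      by simp
    ultimately show ?thesis by simp
  qed
  interpret def_top \<R> X U B T c
  proof
    show "o_minimal \<R>" "strict_mono c" by fact+
    show "topspace T = points X" by (rule topspace_T)
    show "openin T (points (B u))" if "u \<in> U" for u using that by (rule openin_B)
    show "\<exists>u\<in>U. x \<in> B u \<and> points (B u) \<subseteq> S" if "openin T S" "[x] \<in> S" for S x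
      using that by (rule openin_nbhd)
    show "dpred1 \<R> (\<lambda>x. x \<in> X)"
      using dpred_definable[OF dT, of "[0]"] unfolding X_def by simp
    show "dpred1 \<R> (\<lambda>x. x \<in> B u)" if "u \<in> U" for u
    proof -
      have "dpred \<R> (\<lambda>e. map e [0..<Suc m] \<in> A)" by (rule dpred_definable[OF dA]) simp
      from dpred_subst[OF this, of "\<lambda>i. if i = 0 then Inl 0 else Inr (u ! (i - 1))"]
      have "dpred \<R> (\<lambda>e. map (\<lambda>i. if i = 0 then e 0 else u ! (i - 1)) [0..<Suc m] \<in> A)"
        by (simp add: if_distrib cong: if_cong)
      moreover have "map (\<lambda>i. if i = 0 then e 0 else u ! (i - 1)) [0..<Suc m] = e 0 # u" for e :: "nat \<Rightarrow> 'a"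
        using len_U[OF that] by (intro nth_equalityI) (auto simp del: upt_Suc simp: nth_Cons')
      ultimately show ?thesis unfolding B_def by simp
    qed
    show "B u \<subseteq> X" if "u \<in> U" for u
      using openin_subset[OF openin_B[OF that]] unfolding X_def by auto
    show "\<exists>u\<in>U. x \<in> B u" if "x \<in> X" for x
      using openin_nbhd[of "topspace T" x] that unfolding X_def by auto
    show "\<exists>w\<in>U. x \<in> B w \<and> B w \<subseteq> B u \<inter> B v" if "u \<in> U" "v \<in> U" "x \<in> B u" "x \<in> B v" for u v x
    proof -
      have "openin T (points (B u) \<inter> points (B v))" using that openin_B by blast
      from openin_nbhd[OF this, of x] that show ?thesis by auto
    qed
    show "\<exists>u\<in>U. \<exists>v\<in>U. x \<in> B u \<and> y \<in> B v \<and> B u \<inter> B v = {}"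
      if xy: "x \<in> X" "y \<in> X" "x \<noteq> y" for x y
    proof -
      obtain V W where VW: "openin T V" "openin T W" "[x] \<in> V" "[y] \<in> W" "disjnt V W"
        using assms(5) xy unfolding Hausdorff_space_def X_def by blast
      obtain u where u: "u \<in> U" "x \<in> B u" "points (B u) \<subseteq> V" using openin_nbhd[OF VW(1,3)] by blast
      obtain v where v: "v \<in> U" "y \<in> B v" "points (B v) \<subseteq> W" using openin_nbhd[OF VW(2,4)] by blast
      have "B u \<inter> B v = {}" using u(3) v(3) VW(5) unfolding disjnt_def by blast
      with u v show ?thesis by blast
    qed
    show "\<exists>v\<in>U. x \<in> B v \<and> (\<forall>z\<in>X - B u. \<exists>w\<in>U. z \<in> B w \<and> B w \<inter> B v = {})"
      if ux: "u \<in> U" "x \<in> B u" for u x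
    proof -
      have "closedin T (topspace T - points (B u))" using openin_B[OF ux(1)] by blast
      moreover have "[x] \<in> topspace T - (topspace T - points (B u))"
        using ux openin_subset[OF openin_B[OF ux(1)]] by blast
      ultimately obtain V W where VW: "openin T V" "openin T W" "[x] \<in> V"
        "topspace T - points (B u) \<subseteq> W" "disjnt V W"
        using assms(4)[unfolded regular_space_def, rule_format, OF conjI] by metis
      obtain v where v: "v \<in> U" "x \<in> B v" "points (B v) \<subseteq> V" using openin_nbhd[OF VW(1,3)] by blast
      have "\<exists>w\<in>U. z \<in> B w \<and> B w \<inter> B v = {}" if "z \<in> X - B u" for z
      proof -
        have "[z] \<in> W" using that VW(4) unfolding X_def by blast
        then obtain w where w: "w \<in> U" "z \<in> B w" "points (B w) \<subseteq> W" using openin_nbhd[OF VW(2)] by blast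
        have "B w \<inter> B v = {}" using v(3) w(3) VW(5) unfolding disjnt_def by blast
        with w show ?thesis by blast
      qed
      with v show ?thesis by blast
    qed
    show "dpred2 \<R> (\<lambda>y x. \<forall>u\<in>U. x \<in> B u \<longrightarrow> near (At s y) (\<lambda>z. z \<in> B u))" for s
    proof -
      have "dpred \<R> (\<lambda>e. \<forall>u. length u = m \<longrightarrow>
        (u \<in> U \<longrightarrow> e (Suc 0) # u \<in> A \<longrightarrow> near (At s (e 0)) (\<lambda>z. z # u \<in> A)))"
      \<comment> \<open>Under the tuple quantifier the first \<open>m\<close> variables hold
        \<open>u\<close>, so \<open>e (Suc 0)\<close> becomes \<open>e (Suc 0 + m)\<close>. Inside
        \<open>near\<close> the point \<open>z\<close> takes position 0 and \<open>u\<close> moves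
        up by one.\<close>
      proof (rule dpred_all_list, intro dpred_imp list_U dpred_near dterm_var)
        show "dpred \<R> (\<lambda>e. e (Suc 0 + m) # map e [0..<m] \<in> A)" using list[of "Suc 0 + m" 0] by simp
        show "dpred \<R> (\<lambda>e. e 0 # map (\<lambda>i. e (Suc i)) [0..<m] \<in> A)" using list[of 0 1] by simp
      qed
      moreover have "(\<forall>u. length u = m \<longrightarrow> (u \<in> U \<longrightarrow> x # u \<in> A \<longrightarrow> near (At s y) (\<lambda>z. z # u \<in> A))) \<longleftrightarrow>
        (\<forall>u\<in>U. x \<in> B u \<longrightarrow> near (At s y) (\<lambda>z. z \<in> B u))" for x y
        using len_U unfolding B_def by auto
      ultimately show ?thesis by simp
    qed
    show "dpred1 \<R> (\<lambda>y. \<exists>u\<in>U. x \<in> B u \<and> (\<forall>z. z \<in> B u \<and> \<not> P z \<longrightarrow> y < z))" if P: "dpred1 \<R> P" for P x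
    proof -
      have "dpred \<R> (\<lambda>e. \<exists>u. length u = m \<and>
        (u \<in> U \<and> x # u \<in> A \<and> (\<forall>z. z # u \<in> A \<and> \<not> P z \<longrightarrow> e 0 < z)))"
      proof (rule dpred_ex_list, intro dpred_conj list_U list_const dpred_all dpred_imp dpred_not
          dpred_less dterm_var P)
        show "dpred \<R> (\<lambda>e. e 0 # map (\<lambda>i. e (Suc i)) [0..<m] \<in> A)" using list[of 0 1] by simp
      qed
      moreover have "(\<exists>u. length u = m \<and> (u \<in> U \<and> x # u \<in> A \<and> (\<forall>z. z # u \<in> A \<and> \<not> P z \<longrightarrow> y < z))) \<longleftrightarrow>
        (\<exists>u\<in>U. x \<in> B u \<and> (\<forall>z. z \<in> B u \<and> \<not> P z \<longrightarrow> y < z))" for y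
        using len_U unfolding B_def by auto
      ultimately show ?thesis by simp
    qed
  qed
  show ?thesis by (rule decomposition)
qed

end
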